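(* For any integer $d\geq 2$, the Stiefel-Whitney height of the $\mathbb{Z}_2$-bundle $C_2(T^d)\to B_2(T^d)$ is exactly $d$.
   Context: $T^d=\mathbb{R}^d/\mathbb{Z}^d$ is the $d$-dimensional torus, $C_2(T^d)=\{(x_1,x_2)\in T^d\times T^d\mid x_1\neq x_2\}$ the ordered 2-configuration space, on which the group $\Sigma_2\cong\mathbb{Z}_2$ of order 2 acts freely by swapping coordinates, and $B_2(T^d)=C_2(T^d)/\Sigma_2$ the unordered 2-configuration space; the $\mathbb{Z}_2$-bundle in question is the quotient map (a principal $\mathbb{Z}_2$-bundle, i.e. a double cover). The Stiefel-Whitney height of a $\mathbb{Z}_2$-bundle over $B$ is the maximal integer $i$ such that $\alpha^i\neq 0$ in $H^i(B;\mathbb{F}_2)$, where $\alpha\in H^1(B;\mathbb{F}_2)$ is the first Stiefel-Whitney class of the bundle (the pullback of the generator of $H^1(\mathbb{R}P^\infty;\mathbb{F}_2)$ along a classifying map $B\to B\mathbb{Z}_2=\mathbb{R}P^\infty$). *)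

theory Defs
  imports "HOL-Homology.Homology" "HOL-Library.Z2"
begin

section \<open>Quotient spaces\<close>

definition quotient_topology :: "'a topology \<Rightarrow> ('a \<Rightarrow> 'b) \<Rightarrow> 'b topology" where
  "quotient_topology X f =
     topology (\<lambda>U. U \<subseteq> f ` topspace X \<and> openin X {x \<in> topspace X. f x \<in> U})"

lemma openin_quotient_topology:
  "openin (quotient_topology X f) U \<longleftrightarrow>
     U \<subseteq> f ` topspace X \<and> openin X {x \<in> topspace X. f x \<in> U}"
proof -
  have "istopology (\<lambda>U. U \<subseteq> f ` topspace X \<and> openin X {x \<in> topspace X. f x \<in> U})"
    unfolding istopology_def
  proof (intro conjI allI impI)
    fix S T
    assume "S \<subseteq> f ` topspace X \<and> openin X {x \<in> topspace X. f x \<in> S}"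
      and "T \<subseteq> f ` topspace X \<and> openin X {x \<in> topspace X. f x \<in> T}"
    moreover have "{x \<in> topspace X. f x \<in> S \<inter> T} =
        {x \<in> topspace X. f x \<in> S} \<inter> {x \<in> topspace X. f x \<in> T}"
      by auto
    ultimately show "S \<inter> T \<subseteq> f ` topspace X" "openin X {x \<in> topspace X. f x \<in> S \<inter> T}"
      by auto
  next
    fix \<K>
    assume *: "\<forall>K\<in>\<K>. K \<subseteq> f ` topspace X \<and> openin X {x \<in> topspace X. f x \<in> K}"
    have "{x \<in> topspace X. f x \<in> \<Union>\<K>} = (\<Union>K\<in>\<K>. {x \<in> topspace X. f x \<in> K})"
      by auto
    with * show "\<Union>\<K> \<subseteq> f ` topspace X" "openin X {x \<in> topspace X. f x \<in> \<Union>\<K>}"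
      by auto
  qed
  then show ?thesis
    by (simp add: quotient_topology_def)
qed

lemma topspace_quotient_topology [simp]:
  "topspace (quotient_topology X f) = f ` topspace X"
proof -
  have "{x \<in> topspace X. f x \<in> f ` topspace X} = topspace X"
    by blast
  then have "openin (quotient_topology X f) (f ` topspace X)"
    by (simp add: openin_quotient_topology)
  then show ?thesis
    by (metis openin_quotient_topology openin_subset openin_topspace subset_antisym)
qed

lemma quotient_map_quotient_topology: "quotient_map X (quotient_topology X f) f"
  by (auto simp: quotient_map_def openin_quotient_topology)

text \<open>The orbits of the action of the group of order 2 generated by an involution \<open>\<tau>\<close>,
  and the orbit space.\<close>

definition orbit2 :: "('a \<Rightarrow> 'a) \<Rightarrow> 'a \<Rightarrow> 'a set" where
  "orbit2 \<tau> x = {x, \<tau> x}"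

definition orbit_space2 :: "'a topology \<Rightarrow> ('a \<Rightarrow> 'a) \<Rightarrow> 'a set topology" where
  "orbit_space2 X \<tau> = quotient_topology X (orbit2 \<tau>)"


section \<open>The torus and its 2-configuration spaces\<close>

definition lattice_coset :: "nat \<Rightarrow> (nat \<Rightarrow> real) \<Rightarrow> (nat \<Rightarrow> real) set" where
  "lattice_coset d x = {y \<in> topspace (Euclidean_space d). \<forall>i. y i - x i \<in> \<int>}"

definition torus :: "nat \<Rightarrow> (nat \<Rightarrow> real) set topology" where
  "torus d = quotient_topology (Euclidean_space d) (lattice_coset d)"

definition ordered_config2 :: "'a topology \<Rightarrow> ('a \<times> 'a) topology" where
  "ordered_config2 X = subtopology (prod_topology X X) {(x, y). x \<noteq> y}"

definition unordered_config2 :: "'a topology \<Rightarrow> ('a \<times> 'a) set topology" where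
  "unordered_config2 X = orbit_space2 (ordered_config2 X) prod.swap"


section \<open>Singular cohomology with coefficients in the field of two elements\<close>

text \<open>A \<open>p\<close>-cochain is a function on singular \<open>p\<close>-simplices; as these do not form a type, it is
  required to be 0 off them. Since \<open>- 1 = 1\<close> in \<open>bit\<close>, the coboundary carries no signs.\<close>

type_synonym 'a cochain = "((nat \<Rightarrow> real) \<Rightarrow> 'a) \<Rightarrow> bit"

definition cochain_group :: "nat \<Rightarrow> 'a topology \<Rightarrow> 'a cochain monoid" where
  "cochain_group p X =
     \<lparr>carrier = {\<phi>. \<forall>\<sigma>. \<not> singular_simplex p X \<sigma> \<longrightarrow> \<phi> \<sigma> = 0},
      monoid.mult = (\<lambda>\<phi> \<psi> \<sigma>. \<phi> \<sigma> + \<psi> \<sigma>),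
      one = (\<lambda>\<sigma>. 0)\<rparr>"

definition coboundary :: "nat \<Rightarrow> 'a topology \<Rightarrow> 'a cochain \<Rightarrow> 'a cochain" where
  "coboundary p X \<phi> =
     (\<lambda>\<sigma>. if singular_simplex (Suc p) X \<sigma> then \<Sum>k\<le>Suc p. \<phi> (singular_face (Suc p) k \<sigma>) else 0)"

definition cocycles :: "nat \<Rightarrow> 'a topology \<Rightarrow> 'a cochain set" where
  "cocycles p X = {\<phi> \<in> carrier (cochain_group p X). coboundary p X \<phi> = (\<lambda>\<sigma>. 0)}"

definition coboundaries :: "nat \<Rightarrow> 'a topology \<Rightarrow> 'a cochain set" where
  "coboundaries p X =
     (case p of 0 \<Rightarrow> {\<lambda>\<sigma>. 0} | Suc q \<Rightarrow> coboundary q X ` carrier (cochain_group q X))"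

definition cohomology_group :: "nat \<Rightarrow> 'a topology \<Rightarrow> 'a cochain set monoid" where
  "cohomology_group p X = (cochain_group p X)\<lparr>carrier := cocycles p X\<rparr> Mod coboundaries p X"

definition cohomology_class :: "nat \<Rightarrow> 'a topology \<Rightarrow> 'a cochain \<Rightarrow> 'a cochain set" where
  "cohomology_class p X \<phi> = coboundaries p X #>\<^bsub>cochain_group p X\<^esub> \<phi>"

lemma comm_group_cochain_group: "comm_group (cochain_group p X)"
proof (rule comm_groupI)
  fix \<phi> assume "\<phi> \<in> carrier (cochain_group p X)"
  moreover have "(\<lambda>\<sigma>. \<phi> \<sigma> + \<phi> \<sigma>) = (\<lambda>\<sigma>. 0)"
    by (rule ext) simp
  ultimately show "\<exists>\<psi>\<in>carrier (cochain_group p X).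
      \<psi> \<otimes>\<^bsub>cochain_group p X\<^esub> \<phi> = \<one>\<^bsub>cochain_group p X\<^esub>"
    by (intro bexI[of _ \<phi>]) (auto simp: cochain_group_def)
qed (auto simp: cochain_group_def algebra_simps fun_eq_iff)

text \<open>Operations on cohomology classes are given by arbitrary cocycle representatives: the union
  below is a union of equal cosets, as for the multiplication of a quotient group.\<close>

definition pullback_cochain ::
  "nat \<Rightarrow> 'a topology \<Rightarrow> ('a \<Rightarrow> 'b) \<Rightarrow> 'b cochain \<Rightarrow> 'a cochain" where
  "pullback_cochain p X f \<phi> =
     (\<lambda>\<sigma>. if singular_simplex p X \<sigma> then \<phi> (simplex_map p f \<sigma>) else 0)"

definition cohomology_pullback ::
  "nat \<Rightarrow> 'a topology \<Rightarrow> ('a \<Rightarrow> 'b) \<Rightarrow> 'b cochain set \<Rightarrow> 'a cochain set" where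
  "cohomology_pullback p X f A = (\<Union>\<phi>\<in>A. cohomology_class p X (pullback_cochain p X f \<phi>))"

text \<open>The face of a singular \<open>p + q\<close>-simplex on the first \<open>p + 1\<close> vertices and the one on the last
  \<open>q + 1\<close> vertices. For the former only the domain has to be restricted, because the points of
  \<^term>\<open>standard_simplex p\<close> are the points of \<^term>\<open>standard_simplex (p + q)\<close> whose
  last \<open>q\<close> coordinates vanish.\<close>

definition front_face :: "nat \<Rightarrow> ((nat \<Rightarrow> real) \<Rightarrow> 'a) \<Rightarrow> (nat \<Rightarrow> real) \<Rightarrow> 'a" where
  "front_face p \<sigma> = restrict \<sigma> (standard_simplex p)"

definition back_face :: "nat \<Rightarrow> nat \<Rightarrow> ((nat \<Rightarrow> real) \<Rightarrow> 'a) \<Rightarrow> (nat \<Rightarrow> real) \<Rightarrow> 'a" where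
  "back_face p q \<sigma> =
     restrict (\<sigma> \<circ> (\<lambda>x i. if i < p then 0 else x (i - p))) (standard_simplex q)"

definition cup_cochain ::
  "nat \<Rightarrow> nat \<Rightarrow> 'a topology \<Rightarrow> 'a cochain \<Rightarrow> 'a cochain \<Rightarrow> 'a cochain" where
  "cup_cochain p q X \<phi> \<psi> =
     (\<lambda>\<sigma>. if singular_simplex (p + q) X \<sigma> then \<phi> (front_face p \<sigma>) * \<psi> (back_face p q \<sigma>) else 0)"

definition cup_product ::
  "nat \<Rightarrow> nat \<Rightarrow> 'a topology \<Rightarrow> 'a cochain set \<Rightarrow> 'a cochain set \<Rightarrow> 'a cochain set" where
  "cup_product p q X A B =
     (\<Union>\<phi>\<in>A. \<Union>\<psi>\<in>B. cohomology_class (p + q) X (cup_cochain p q X \<phi> \<psi>))"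

definition unit_class :: "'a topology \<Rightarrow> 'a cochain set" where
  "unit_class X = cohomology_class 0 X (\<lambda>\<sigma>. if singular_simplex 0 X \<sigma> then 1 else 0)"

primrec cup_power :: "'a topology \<Rightarrow> 'a cochain set \<Rightarrow> nat \<Rightarrow> 'a cochain set" where
  "cup_power X \<alpha> 0 = unit_class X"
| "cup_power X \<alpha> (Suc n) = cup_product n 1 X (cup_power X \<alpha> n) \<alpha>"


section \<open>The universal bundle and the Stiefel--Whitney height\<close>

text \<open>The infinite sphere is the union of the spheres \<^term>\<open>nsphere n\<close>, with the weak topology.\<close>

definition infinite_sphere :: "(nat \<Rightarrow> real) topology" where
  "infinite_sphere =
     topology (\<lambda>U. U \<subseteq> (\<Union>n. topspace (nsphere n)) \<and>
                   (\<forall>n. openin (nsphere n) (U \<inter> topspace (nsphere n))))"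

lemma openin_infinite_sphere:
  "openin infinite_sphere U \<longleftrightarrow>
     U \<subseteq> (\<Union>n. topspace (nsphere n)) \<and> (\<forall>n. openin (nsphere n) (U \<inter> topspace (nsphere n)))"
proof -
  have "istopology (\<lambda>U. U \<subseteq> (\<Union>n. topspace (nsphere n)) \<and>
          (\<forall>n. openin (nsphere n) (U \<inter> topspace (nsphere n))))"
    unfolding istopology_def
  proof (intro conjI allI impI)
    fix S T n
    assume S: "S \<subseteq> (\<Union>n. topspace (nsphere n)) \<and>
        (\<forall>n. openin (nsphere n) (S \<inter> topspace (nsphere n)))"
      and T: "T \<subseteq> (\<Union>n. topspace (nsphere n)) \<and>
        (\<forall>n. openin (nsphere n) (T \<inter> topspace (nsphere n)))"
    from S show "S \<inter> T \<subseteq> (\<Union>n. topspace (nsphere n))"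
      by blast
    have "S \<inter> T \<inter> topspace (nsphere n) =
        (S \<inter> topspace (nsphere n)) \<inter> (T \<inter> topspace (nsphere n))"
      by blast
    with S T show "openin (nsphere n) (S \<inter> T \<inter> topspace (nsphere n))"
      by (metis openin_Int)
  next
    fix \<K> n
    assume *: "\<forall>K\<in>\<K>. K \<subseteq> (\<Union>n. topspace (nsphere n)) \<and>
        (\<forall>n. openin (nsphere n) (K \<inter> topspace (nsphere n)))"
    then show "\<Union>\<K> \<subseteq> (\<Union>n. topspace (nsphere n))"
      by blast
    have "\<Union>\<K> \<inter> topspace (nsphere n) = (\<Union>K\<in>\<K>. K \<inter> topspace (nsphere n))"
      by blast
    moreover have "openin (nsphere n) (\<Union>K\<in>\<K>. K \<inter> topspace (nsphere n))"
      using * by (intro openin_Union) blast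
    ultimately show "openin (nsphere n) (\<Union>\<K> \<inter> topspace (nsphere n))"
      by simp
  qed
  then show ?thesis
    by (simp add: infinite_sphere_def)
qed

lemma topspace_infinite_sphere: "topspace infinite_sphere = (\<Union>n. topspace (nsphere n))"
proof
  show "topspace infinite_sphere \<subseteq> (\<Union>n. topspace (nsphere n))"
    using openin_infinite_sphere openin_topspace by blast
  have "(\<Union>n. topspace (nsphere n)) \<inter> topspace (nsphere m) = topspace (nsphere m)" for m
    by blast
  then have "openin infinite_sphere (\<Union>n. topspace (nsphere n))"
    unfolding openin_infinite_sphere by (metis openin_topspace order_refl)
  then show "(\<Union>n. topspace (nsphere n)) \<subseteq> topspace infinite_sphere"
    by (rule openin_subset)
qed

definition antipode :: "(nat \<Rightarrow> real) \<Rightarrow> nat \<Rightarrow> real" where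
  "antipode x = (\<lambda>i. - x i)"

definition infinite_projective_space :: "(nat \<Rightarrow> real) set topology" where
  "infinite_projective_space = orbit_space2 infinite_sphere antipode"

text \<open>From here on, a \<open>\<int>\<^sub>2\<close>-bundle (principal, that is, a double cover) is given by its total
  space \<open>E\<close> with the free involution \<open>\<tau>\<close>, its base \<open>B\<close> and its projection \<open>p\<close>. A map from \<open>B\<close> is
  classifying if it is covered by a bundle map to the universal bundle; a bundle map of principal
  bundles is the same as an isomorphism of the bundle with the pullback of the universal one.\<close>

definition classifying_map ::
  "'e topology \<Rightarrow> ('e \<Rightarrow> 'e) \<Rightarrow> 'b topology \<Rightarrow> ('e \<Rightarrow> 'b) \<Rightarrow> ('b \<Rightarrow> (nat \<Rightarrow> real) set) \<Rightarrow> bool" where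
  "classifying_map E \<tau> B p f \<longleftrightarrow>
     continuous_map B infinite_projective_space f \<and>
     (\<exists>g. continuous_map E infinite_sphere g \<and>
          (\<forall>e\<in>topspace E. g (\<tau> e) = antipode (g e) \<and> f (p e) = orbit2 antipode (g e)))"

definition first_SW_class ::
  "'e topology \<Rightarrow> ('e \<Rightarrow> 'e) \<Rightarrow> 'b topology \<Rightarrow> ('e \<Rightarrow> 'b) \<Rightarrow> 'b cochain set \<Rightarrow> bool" where
  "first_SW_class E \<tau> B p \<alpha> \<longleftrightarrow>
     (\<exists>f \<gamma>. classifying_map E \<tau> B p f \<and>
        \<gamma> \<in> carrier (cohomology_group 1 infinite_projective_space) \<and>
        generate (cohomology_group 1 infinite_projective_space) {\<gamma>} =
          carrier (cohomology_group 1 infinite_projective_space) \<and>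
        \<alpha> = cohomology_pullback 1 B f \<gamma>)"

text \<open>The height is a relation rather than a function so that no value is assigned to a bundle
  that has no classifying map or whose powers of the class do not vanish eventually.\<close>

definition has_SW_height ::
  "'e topology \<Rightarrow> ('e \<Rightarrow> 'e) \<Rightarrow> 'b topology \<Rightarrow> ('e \<Rightarrow> 'b) \<Rightarrow> nat \<Rightarrow> bool" where
  "has_SW_height E \<tau> B p n \<longleftrightarrow>
     (\<exists>\<alpha>. first_SW_class E \<tau> B p \<alpha>) \<and>
     (\<forall>\<alpha>. first_SW_class E \<tau> B p \<alpha> \<longrightarrow>
        cup_power B \<alpha> n \<noteq> \<one>\<^bsub>cohomology_group n B\<^esub> \<and>
        (\<forall>i. cup_power B \<alpha> i \<noteq> \<one>\<^bsub>cohomology_group i B\<^esub> \<longrightarrow> i \<le> n))"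

end

theory Submission
  imports Defs "HOL-Analysis.Abstract_Topological_Spaces"
begin

text \<open>For a double cover \<open>E \<rightarrow> B\<close> with involution \<open>\<tau>\<close>, choose a labelling \<open>h\<close> of the points of \<open>E\<close> by
  elements of the field of two elements with \<open>h \<circ> \<tau> = h + 1\<close>. The cochain \<open>\<delta>h\<close> descends to \<open>B\<close> and represents the first
  Stiefel--Whitney class \<open>\<alpha>\<close>; on a simplex of \<open>B\<close> the cochain \<open>(\<delta>h)\<^sup>n\<close> tests whether \<open>h\<close> alternates
  along the vertices of a lift.

  Upper bound: an embedding \<open>f\<close> of the torus in \<open>\<real>\<^sup>d\<^sup>+\<^sup>1\<close> gives the nowhere vanishing odd map
  \<open>(x, y) \<mapsto> f(x) - f(y)\<close>. Each of the \<open>d + 1\<close> coordinates trivializes the cover where it does not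
  vanish, so that by the Lusternik--Schnirelmann argument \<open>\<alpha>\<^sup>d\<^sup>+\<^sup>1 = 0\<close>.

  Lower bound: if \<open>(\<delta>h)\<^sup>d = \<delta>\<psi>\<close> on the base, then \<open>\<Theta> = p\<^sup>*\<psi> + h (\<delta>h)\<^sup>d\<^sup>-\<^sup>1\<close> is a cocycle on the total space
  with \<open>\<Theta> + \<tau>\<^sup>*\<Theta> = (\<delta>h)\<^sup>d\<^sup>-\<^sup>1\<close>. Let \<open>v\<close> run through the boundary of the cube \<open>[-1/2, 1/2]\<^sup>d\<close>, which is
  triangulated by flags of faces. On the equivariant sphere of the pairs \<open>(v/2, -v/2)\<close> the cocycle
  \<open>\<Theta>\<close> has the value of \<open>(\<delta>h)\<^sup>d\<^sup>-\<^sup>1\<close> on a hemisphere, which is 1. The homotopy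
  \<open>(t v, -(1 - t) v)\<close> moves this sphere, within the configuration space, to the one of the pairs
  \<open>(v, 0)\<close>, on which opposite faces of the cube cancel modulo the lattice, so that \<open>\<Theta>\<close> is 0 there.\<close>

section \<open>Singular cochains modulo 2\<close>

text \<open>The labelling \<open>h\<close> need not be continuous, which makes the class discrete:
  two odd labellings differ by a function on the base, so every factor of a power of
  \<open>\<alpha>\<close> may use its own labelling. In the upper bound factor \<open>i\<close> uses
  the sign of coordinate \<open>i\<close>. The product then vanishes on small simplices only;
  iterated subdivision makes it a coboundary. The definition of the class ranges over classifying
  maps and generators, so uniqueness requires the first cohomology of the infinite projective space.
  Cocycles on the infinite sphere get primitives by coning, after compactness has moved a simplex
  into a finite sphere. In the lower bound the obstacle is the diagonal modulo the lattice. The two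
  points of the homotopy always differ by exactly \<open>v\<close>, and on every flag of faces some
  coordinate of \<open>v\<close> is constantly 1/2 or -1/2, so that all simplices of the prism avoid
  the diagonal. The side length 1 of the cube serves both ends: opposite faces differ by a lattice
  vector, while the fixed coordinates are nonintegral. Flags are compatible with the antipode, and
  modulo 2 their boundary terms cancel in pairs, by the two values or the two orders of
  coordinates.\<close>

declare add_bit_eq_xor [simp del] mult_bit_eq_and [simp del]

lemma bit_add_self [simp]: "a + a = (0::bit)" "a + (a + b) = (b::bit)"
  by (cases a; cases b; simp)+

text \<open>Pairing of mod 2 cochains with the integral chains of the library, so that its boundary
  and subdivision operators and their homotopies apply to cochains.\<close>

definition cochain_eval :: "'a cochain \<Rightarrow> 'a chain \<Rightarrow> bit" where
  "cochain_eval \<phi> c =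
     (\<Sum>\<sigma>\<in>Poly_Mapping.keys c. of_int (Poly_Mapping.lookup c \<sigma>) * \<phi> \<sigma>)"

lemma cochain_eval_superset:
  assumes "finite A" "Poly_Mapping.keys c \<subseteq> A"
  shows "cochain_eval \<phi> c = (\<Sum>\<sigma>\<in>A. of_int (Poly_Mapping.lookup c \<sigma>) * \<phi> \<sigma>)"
  unfolding cochain_eval_def
  by (rule sum.mono_neutral_left) (use assms in \<open>auto simp: in_keys_iff\<close>)

lemma cochain_eval_0 [simp]: "cochain_eval \<phi> 0 = 0"
  by (simp add: cochain_eval_def)

lemma cochain_eval_of [simp]: "cochain_eval \<phi> (frag_of \<sigma>) = \<phi> \<sigma>"
  by (simp add: cochain_eval_def)

lemma cochain_eval_add: "cochain_eval \<phi> (a + b) = cochain_eval \<phi> a + cochain_eval \<phi> b"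
proof -
  let ?A = "Poly_Mapping.keys a \<union> Poly_Mapping.keys b"
  have "cochain_eval \<phi> c = (\<Sum>\<sigma>\<in>?A. of_int (Poly_Mapping.lookup c \<sigma>) * \<phi> \<sigma>)"
    if "c \<in> {a, b, a + b}" for c
    using that Poly_Mapping.keys_add[of a b] by (intro cochain_eval_superset) auto
  then show ?thesis
    by (simp add: lookup_add distrib_right sum.distrib)
qed

lemma cochain_eval_uminus: "cochain_eval \<phi> (- a) = cochain_eval \<phi> a"
  proof -
  have "cochain_eval \<phi> (- a) + cochain_eval \<phi> a = 0"
    by (simp flip: cochain_eval_add)
  then show ?thesis
    by (cases "cochain_eval \<phi> a"; cases "cochain_eval \<phi> (- a)") simp_all
qed

lemma cochain_eval_diff: "cochain_eval \<phi> (a - b) = cochain_eval \<phi> a + cochain_eval \<phi> b"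
  by (metis cochain_eval_add cochain_eval_uminus diff_conv_add_uminus)

lemma cochain_eval_sum: "cochain_eval \<phi> (sum f I) = (\<Sum>i\<in>I. cochain_eval \<phi> (f i))"
  by (induction I rule: infinite_finite_induct) (simp_all add: cochain_eval_add)

lemma cochain_eval_sign: "cochain_eval \<phi> (frag_cmul ((- 1) ^ k) c) = cochain_eval \<phi> c"
  by (cases "even k") (simp_all add: cochain_eval_uminus)

lemma cochain_eval_eq_0:
  "(\<And>\<sigma>. \<sigma> \<in> Poly_Mapping.keys c \<Longrightarrow> \<phi> \<sigma> = 0) \<Longrightarrow> cochain_eval \<phi> c = 0"
  by (simp add: cochain_eval_def)

lemma coboundary_simplex:
  "singular_simplex (Suc p) X \<sigma> \<Longrightarrow>
     coboundary p X \<phi> \<sigma> = (\<Sum>k\<le>Suc p. \<phi> (singular_face (Suc p) k \<sigma>))"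
  by (simp add: coboundary_def)

text \<open>Modulo 2 the alternating signs of \<open>chain_boundary\<close> disappear, so the
  unsigned \<open>coboundary\<close> is its adjoint.\<close>

lemma cochain_eval_boundary:
  assumes "singular_chain (Suc p) X c"
  shows "cochain_eval \<phi> (chain_boundary (Suc p) c) = cochain_eval (coboundary p X \<phi>) c"
  using assms unfolding singular_chain_def
proof (induction rule: frag_induction)
  case (one \<sigma>)
  then show ?case
    by (simp add: chain_boundary_of cochain_eval_add cochain_eval_sum cochain_eval_sign
        coboundary_simplex del: sum.atMost_Suc)
qed (simp_all add: chain_boundary_diff cochain_eval_diff)

section \<open>Cocycles, coboundaries and cohomology classes\<close>

lemma cochain_carrier_iff:
  "\<phi> \<in> carrier (cochain_group p X) \<longleftrightarrow> (\<forall>\<sigma>. \<not> singular_simplex p X \<sigma> \<longrightarrow> \<phi> \<sigma> = 0)"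
  by (simp add: cochain_group_def)

lemma coboundary_in_carrier: "coboundary p X \<phi> \<in> carrier (cochain_group (Suc p) X)"
  by (simp add: cochain_carrier_iff coboundary_def)

text \<open>By adjointness this is the vanishing of the double boundary of the chain
  \<open>frag_of \<sigma>\<close>.\<close>

lemma coboundary_coboundary: "coboundary (Suc p) X (coboundary p X \<phi>) = (\<lambda>\<sigma>. 0)"
proof
  fix \<sigma>
  show "coboundary (Suc p) X (coboundary p X \<phi>) \<sigma> = 0"
  proof (cases "singular_simplex (Suc (Suc p)) X \<sigma>")
    case True
    then have c: "singular_chain (Suc (Suc p)) X (frag_of \<sigma>)"
      by (simp add: singular_chain_of)
    have "coboundary (Suc p) X (coboundary p X \<phi>) \<sigma> =
        cochain_eval (coboundary p X \<phi>) (chain_boundary (Suc (Suc p)) (frag_of \<sigma>))"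
      using cochain_eval_boundary[OF c] by simp
    also have "\<dots> = cochain_eval \<phi> (chain_boundary (Suc p) (chain_boundary (Suc (Suc p)) (frag_of \<sigma>)))"
      using cochain_eval_boundary[OF singular_chain_boundary_alt[OF c]] by metis
    also have "\<dots> = 0"
      using chain_boundary_boundary_alt[OF c] by simp
    finally show ?thesis .
  qed (simp add: coboundary_def)
qed

lemma coboundary_add:
  "coboundary p X (\<lambda>\<sigma>. \<phi> \<sigma> + \<psi> \<sigma>) = (\<lambda>\<sigma>. coboundary p X \<phi> \<sigma> + coboundary p X \<psi> \<sigma>)"
  by (auto simp: coboundary_def sum.distrib fun_eq_iff)

lemma coboundary_zero [simp]: "coboundary p X (\<lambda>\<sigma>. 0) = (\<lambda>\<sigma>. 0)"
  by (auto simp: coboundary_def)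

lemma cocycles_iff:
  "\<phi> \<in> cocycles p X \<longleftrightarrow> (\<forall>\<sigma>. \<not> singular_simplex p X \<sigma> \<longrightarrow> \<phi> \<sigma> = 0) \<and>
     coboundary p X \<phi> = (\<lambda>\<sigma>. 0)"
  by (simp add: cocycles_def cochain_carrier_iff)

lemma cocycles_add:
  "\<phi> \<in> cocycles p X \<Longrightarrow> \<psi> \<in> cocycles p X \<Longrightarrow> (\<lambda>\<sigma>. \<phi> \<sigma> + \<psi> \<sigma>) \<in> cocycles p X"
  by (simp add: cocycles_iff coboundary_add)

lemma coboundariesI:
  "\<psi> \<in> carrier (cochain_group p X) \<Longrightarrow> coboundary p X \<psi> \<in> coboundaries (Suc p) X"
  by (simp add: coboundaries_def)

lemma coboundaries_zero: "(\<lambda>\<sigma>. 0) \<in> coboundaries p X"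
proof (cases p)
  case (Suc q)
  have "coboundary q X (\<lambda>\<sigma>. 0) \<in> coboundaries (Suc q) X"
    by (rule coboundariesI) (simp add: cochain_carrier_iff)
  then show ?thesis
    using Suc by simp
qed (simp add: coboundaries_def)

lemma coboundaries_add:
  assumes "\<phi> \<in> coboundaries p X" "\<psi> \<in> coboundaries p X"
  shows "(\<lambda>\<sigma>. \<phi> \<sigma> + \<psi> \<sigma>) \<in> coboundaries p X"
proof (cases p)
  case (Suc q)
  with assms obtain a b where "a \<in> carrier (cochain_group q X)" "\<phi> = coboundary q X a"
      "b \<in> carrier (cochain_group q X)" "\<psi> = coboundary q X b"
    by (auto simp: coboundaries_def)
  moreover from this have "coboundary q X (\<lambda>\<sigma>. a \<sigma> + b \<sigma>) \<in> coboundaries (Suc q) X"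
    by (intro coboundariesI) (simp add: cochain_carrier_iff)
  ultimately show ?thesis
    using Suc by (simp add: coboundary_add)
qed (use assms in \<open>simp add: coboundaries_def\<close>)

lemma coboundaries_subset_cocycles: "coboundaries p X \<subseteq> cocycles p X"
proof (cases p)
  case (Suc q)
  then show ?thesis
    by (auto simp: coboundaries_def cocycles_def coboundary_in_carrier coboundary_coboundary)
qed (auto simp: coboundaries_def cocycles_iff)

lemma cohomology_class_altdef:
  "cohomology_class p X \<phi> = {\<lambda>\<sigma>. b \<sigma> + \<phi> \<sigma> | b. b \<in> coboundaries p X}"
  by (auto simp: cohomology_class_def r_coset_def cochain_group_def)

lemma cohomology_class_self: "\<phi> \<in> cohomology_class p X \<phi>"
  using coboundaries_zero[of p X] by (force simp: cohomology_class_altdef)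

lemma bit_add_cancel: "(a::bit) + b + a = b" "(a::bit) + b + b = a"
  by (cases a; cases b; simp)+

lemma cohomology_class_eq_iff:
  "cohomology_class p X \<phi> = cohomology_class p X \<psi> \<longleftrightarrow>
     (\<lambda>\<sigma>. \<phi> \<sigma> + \<psi> \<sigma>) \<in> coboundaries p X"
proof
  assume "cohomology_class p X \<phi> = cohomology_class p X \<psi>"
  then obtain b where b: "b \<in> coboundaries p X" "\<phi> = (\<lambda>\<sigma>. b \<sigma> + \<psi> \<sigma>)"
    using cohomology_class_self[of \<phi> p X] by (auto simp: cohomology_class_altdef)
  then show "(\<lambda>\<sigma>. \<phi> \<sigma> + \<psi> \<sigma>) \<in> coboundaries p X"
    by (simp add: bit_add_cancel)
next
  have *: "cohomology_class p X \<phi> \<subseteq> cohomology_class p X \<psi>"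
    if "(\<lambda>\<sigma>. \<phi> \<sigma> + \<psi> \<sigma>) \<in> coboundaries p X" for \<phi> \<psi>
  proof
    fix \<theta> assume "\<theta> \<in> cohomology_class p X \<phi>"
    then obtain b where b: "b \<in> coboundaries p X" "\<theta> = (\<lambda>\<sigma>. b \<sigma> + \<phi> \<sigma>)"
      by (auto simp: cohomology_class_altdef)
    have "\<theta> = (\<lambda>\<sigma>. (b \<sigma> + (\<phi> \<sigma> + \<psi> \<sigma>)) + \<psi> \<sigma>)"
      by (simp add: b fun_eq_iff add.assoc)
    with coboundaries_add[OF b(1) that] show "\<theta> \<in> cohomology_class p X \<psi>"
      unfolding cohomology_class_altdef by (intro CollectI exI conjI)
  qed
  assume "(\<lambda>\<sigma>. \<phi> \<sigma> + \<psi> \<sigma>) \<in> coboundaries p X"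
  with *[of \<phi> \<psi>] *[of \<psi> \<phi>] show "cohomology_class p X \<phi> = cohomology_class p X \<psi>"
    by (simp add: add.commute subset_antisym)
qed

lemma cohomology_class_zero: "cohomology_class p X (\<lambda>\<sigma>. 0) = coboundaries p X"
  by (simp add: cohomology_class_altdef)

lemma one_cohomology_group: "\<one>\<^bsub>cohomology_group p X\<^esub> = coboundaries p X"
  by (simp add: cohomology_group_def FactGroup_def)

lemma cohomology_class_eq_one_iff:
  "cohomology_class p X \<phi> = \<one>\<^bsub>cohomology_group p X\<^esub> \<longleftrightarrow> \<phi> \<in> coboundaries p X"
  using cohomology_class_eq_iff[of p X \<phi> "\<lambda>\<sigma>. 0"]
  by (simp add: one_cohomology_group cohomology_class_zero)

lemma carrier_cohomology_group:
  "carrier (cohomology_group p X) = cohomology_class p X ` cocycles p X"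
  by (auto simp: cohomology_group_def FactGroup_def RCOSETS_def cohomology_class_def
      r_coset_def cochain_group_def)

lemma cocycles_cohomology_class:
  assumes "\<phi> \<in> cocycles p X" "\<psi> \<in> cohomology_class p X \<phi>"
  shows "\<psi> \<in> cocycles p X" "cohomology_class p X \<psi> = cohomology_class p X \<phi>"
proof -
  obtain b where b: "b \<in> coboundaries p X" "\<psi> = (\<lambda>\<sigma>. b \<sigma> + \<phi> \<sigma>)"
    using assms(2) by (auto simp: cohomology_class_altdef)
  show "\<psi> \<in> cocycles p X"
    using b coboundaries_subset_cocycles[of p X] assms(1) cocycles_add by blast
  show "cohomology_class p X \<psi> = cohomology_class p X \<phi>"
    unfolding cohomology_class_eq_iff using b by (simp add: bit_add_cancel)
qed

text \<open>The definition of the first class speaks of a generator of this group; the lemmas on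
  \<open>generate\<close> need the group laws.\<close>

lemma comm_group_cohomology_group: "comm_group (cohomology_group p X)"
proof -
  let ?C = "(cochain_group p X)\<lparr>carrier := cocycles p X\<rparr>"
  have C: "comm_group ?C"
  proof (rule comm_groupI)
    fix \<phi> assume "\<phi> \<in> carrier ?C"
    moreover have "(\<lambda>\<sigma>. \<phi> \<sigma> + \<phi> \<sigma>) = (\<lambda>\<sigma>. 0)"
      by (rule ext) simp
    ultimately show "\<exists>\<psi>\<in>carrier ?C. \<psi> \<otimes>\<^bsub>?C\<^esub> \<phi> = \<one>\<^bsub>?C\<^esub>"
      by (intro bexI[of _ \<phi>]) (auto simp: cochain_group_def)
  qed (auto simp: cochain_group_def cocycles_iff coboundary_add algebra_simps fun_eq_iff)
  interpret C: comm_group ?C by fact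
  have "subgroup (coboundaries p X) ?C"
  proof (rule C.subgroupI)
    fix a assume a: "a \<in> coboundaries p X"
    then have "a \<in> cocycles p X"
      using coboundaries_subset_cocycles by blast
    moreover have "a \<otimes>\<^bsub>?C\<^esub> a = \<one>\<^bsub>?C\<^esub>"
      by (simp add: cochain_group_def fun_eq_iff)
    ultimately have "inv\<^bsub>?C\<^esub> a = a"
      using C.inv_equality by simp
    with a show "inv\<^bsub>?C\<^esub> a \<in> coboundaries p X" by simp
  next
    fix a b assume "a \<in> coboundaries p X" "b \<in> coboundaries p X"
    then show "a \<otimes>\<^bsub>?C\<^esub> b \<in> coboundaries p X"
      using coboundaries_add by (simp add: cochain_group_def)
  next
    show "coboundaries p X \<noteq> {}"
      using coboundaries_zero by blast
  qed (simp add: coboundaries_subset_cocycles)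
  then show ?thesis
    unfolding cohomology_group_def by (rule C.abelian_FactGroup)
qed


section \<open>Cup products\<close>

abbreviation "simplex_space p \<equiv> subtopology (powertop_real UNIV) (standard_simplex p)"

lemma shift_in_standard_simplex:
  assumes "x \<in> standard_simplex q"
  shows "(\<lambda>i. if i < p then 0 else x (i - p)) \<in> standard_simplex (p + q)"
proof -
  have "(\<Sum>i\<le>p+q. if i < p then 0 else x (i - p)) = (\<Sum>i\<in>{0+p..q+p}. x (i - p))"
    by (rule sum.mono_neutral_cong_right) auto
  also have "\<dots> = sum x {0..q}"
    by (simp only: sum.shift_bounds_cl_nat_ivl add_diff_cancel_right')
  finally show ?thesis
    using assms by (auto simp: standard_simplex_def atMost_atLeast0)
qed

lemma singular_simplex_front_face:
  assumes "singular_simplex (p + q) X \<sigma>"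
  shows "singular_simplex p X (front_face p \<sigma>)"
proof -
  have "continuous_map (simplex_space p) X \<sigma>"
    using assms standard_simplex_mono[of p "p + q"]
    unfolding singular_simplex_def by (auto intro: continuous_map_from_subtopology_mono)
  then show ?thesis
    unfolding singular_simplex_def front_face_def by simp
qed

lemma singular_simplex_back_face:
  assumes "singular_simplex (p + q) X \<sigma>"
  shows "singular_simplex q X (back_face p q \<sigma>)"
proof -
  let ?s = "\<lambda>x i. if i < p then 0 else x (i - p) :: real"
  have "continuous_map (powertop_real UNIV) (powertop_real UNIV) ?s"
    by (auto simp: continuous_map_componentwise_UNIV intro: continuous_map_product_projection)
  then have "continuous_map (simplex_space q) (simplex_space (p + q)) ?s"
    by (auto simp: continuous_map_in_subtopology continuous_map_from_subtopology
        intro!: shift_in_standard_simplex)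
  then have "continuous_map (simplex_space q) X (\<sigma> \<circ> ?s)"
    using assms unfolding singular_simplex_def by (auto intro: continuous_map_compose)
  then show ?thesis
    unfolding singular_simplex_def back_face_def by simp
qed

text \<open>This and the next three identities track the deletion of vertex \<open>k\<close> of a
  \<open>Suc (p + q)\<close>-simplex: up to \<open>p\<close> it only reindexes the back part, beyond
  \<open>p\<close> it does not touch the front part. The overlap of their ranges yields the
  cancelling term of the Leibniz rule.\<close>

lemma front_face_singular_face:
  assumes "k \<le> Suc p"
  shows "front_face p (singular_face (Suc (p + q)) k \<sigma>) =
         singular_face (Suc p) k (front_face (Suc p) \<sigma>)"
proof -
  have "standard_simplex p \<subseteq> standard_simplex (p + q)"
    by (simp add: standard_simplex_mono)
  moreover have "simplical_face k x \<in> standard_simplex (Suc p)" if "x \<in> standard_simplex p" for x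
    using that assms simplical_face_in_standard_simplex[of "Suc p" k x] by simp
  ultimately show ?thesis
    by (auto simp: front_face_def singular_face_def fun_eq_iff)
qed

lemma front_face_singular_face_gt:
  assumes "p < k"
  shows "front_face p (singular_face (Suc (p + q)) k \<sigma>) = front_face p \<sigma>"
proof -
  have "standard_simplex p \<subseteq> standard_simplex (p + q)"
    by (simp add: standard_simplex_mono)
  moreover have "simplical_face k x = x" if "x \<in> standard_simplex p" for x
    using that assms by (auto simp: simplical_face_def standard_simplex_def fun_eq_iff)
  ultimately show ?thesis
    unfolding front_face_def singular_face_def by (intro ext) (simp add: restrict_def subset_iff)
qed

lemma back_face_singular_face_le:
  assumes "k \<le> p"
  shows "back_face p q (singular_face (Suc (p + q)) k \<sigma>) = back_face (Suc p) q \<sigma>"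
proof -
  have *: "simplical_face k (\<lambda>i. if i < p then 0 else x (i - p)) =
      (\<lambda>i. if i < Suc p then 0 else x (i - Suc p))" for x :: "nat \<Rightarrow> real"
    using assms by (auto simp: simplical_face_def fun_eq_iff)
  show ?thesis
    unfolding back_face_def singular_face_def
  proof (intro restrict_ext)
    fix x :: "nat \<Rightarrow> real"
    assume "x \<in> standard_simplex q"
    then have "restrict (\<sigma> \<circ> simplical_face k) (standard_simplex (p + q)) (\<lambda>i. if i < p then 0 else x (i - p)) =
        \<sigma> (simplical_face k (\<lambda>i. if i < p then 0 else x (i - p)))"
      using shift_in_standard_simplex by simp
    then show "(restrict (\<sigma> \<circ> simplical_face k) (standard_simplex (Suc (p + q) - Suc 0)) \<circ>
        (\<lambda>x i. if i < p then 0 else x (i - p))) x =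
        (\<sigma> \<circ> (\<lambda>x i. if i < Suc p then 0 else x (i - Suc p))) x"
      unfolding o_apply * diff_Suc_Suc diff_zero .
  qed
qed

lemma back_face_singular_face:
  assumes "p \<le> k" "k \<le> Suc (p + q)"
  shows "back_face p q (singular_face (Suc (p + q)) k \<sigma>) =
         singular_face (Suc q) (k - p) (back_face p (Suc q) \<sigma>)"
proof -
  have *: "simplical_face k (\<lambda>i. if i < p then 0 else x (i - p)) =
      (\<lambda>i. if i < p then 0 else simplical_face (k - p) x (i - p))" for x :: "nat \<Rightarrow> real"
    using assms(1) by (auto simp: simplical_face_def fun_eq_iff)
  have face: "simplical_face (k - p) x \<in> standard_simplex (Suc q)" if "x \<in> standard_simplex q" for x
    using that assms simplical_face_in_standard_simplex[of "Suc q" "k - p" x] by simp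
  show ?thesis
    unfolding back_face_def singular_face_def
  proof (simp only: diff_Suc_Suc diff_zero One_nat_def, intro restrict_ext)
    fix x :: "nat \<Rightarrow> real"
    let ?s = "\<lambda>(y::nat \<Rightarrow> real) i. if i < p then 0 else y (i - p)"
    assume x: "x \<in> standard_simplex q"
    have "restrict (\<sigma> \<circ> simplical_face k) (standard_simplex (p + q)) (?s x) = \<sigma> (simplical_face k (?s x))"
      using shift_in_standard_simplex[OF x] by simp
    also have "\<dots> = (restrict (\<sigma> \<circ> ?s) (standard_simplex (Suc q)) \<circ> simplical_face (k - p)) x"
      unfolding o_apply restrict_apply'[OF face[OF x]] *[of x] by (rule refl)
    finally show "(restrict (\<sigma> \<circ> simplical_face k) (standard_simplex (p + q)) \<circ> ?s) x =
        (restrict (\<sigma> \<circ> ?s) (standard_simplex (Suc q)) \<circ> simplical_face (k - p)) x"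
      by (simp only: o_apply)
  qed
qed

lemma cup_cochain_in_carrier: "cup_cochain p q X \<phi> \<psi> \<in> carrier (cochain_group (p + q) X)"
  by (simp add: cochain_carrier_iff cup_cochain_def)

lemma cup_cochain_add_left:
  "cup_cochain p q X (\<lambda>\<sigma>. \<phi> \<sigma> + \<phi>' \<sigma>) \<psi> =
     (\<lambda>\<sigma>. cup_cochain p q X \<phi> \<psi> \<sigma> + cup_cochain p q X \<phi>' \<psi> \<sigma>)"
  by (auto simp: cup_cochain_def distrib_right fun_eq_iff)

lemma cup_cochain_add_right:
  "cup_cochain p q X \<phi> (\<lambda>\<sigma>. \<psi> \<sigma> + \<psi>' \<sigma>) =
     (\<lambda>\<sigma>. cup_cochain p q X \<phi> \<psi> \<sigma> + cup_cochain p q X \<phi> \<psi>' \<sigma>)"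
  by (auto simp: cup_cochain_def distrib_left fun_eq_iff)

lemma cup_cochain_zero [simp]:
  "cup_cochain p q X (\<lambda>\<sigma>. 0) \<psi> = (\<lambda>\<sigma>. 0)" "cup_cochain p q X \<phi> (\<lambda>\<sigma>. 0) = (\<lambda>\<sigma>. 0)"
  by (auto simp: cup_cochain_def)

lemma coboundary_cup_cochain:
  "coboundary (p + q) X (cup_cochain p q X \<phi> \<psi>) =
     (\<lambda>\<sigma>. cup_cochain (Suc p) q X (coboundary p X \<phi>) \<psi> \<sigma> +
          cup_cochain p (Suc q) X \<phi> (coboundary q X \<psi>) \<sigma>)"
proof
  fix \<sigma>
  show "coboundary (p + q) X (cup_cochain p q X \<phi> \<psi>) \<sigma> =
     cup_cochain (Suc p) q X (coboundary p X \<phi>) \<psi> \<sigma> +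
     cup_cochain p (Suc q) X \<phi> (coboundary q X \<psi>) \<sigma>"
  proof (cases "singular_simplex (Suc (p + q)) X \<sigma>")
    case True
    let ?F = "\<lambda>k. singular_face (Suc (p + q)) k \<sigma>"
    let ?f = "\<lambda>k. \<phi> (front_face p (?F k)) * \<psi> (back_face p q (?F k))"
    \<comment> \<open>This term arises twice, from deleting the last vertex of the front
      \<open>Suc p\<close>-simplex and from deleting the first vertex of the back
      \<open>Suc q\<close>-simplex. It cancels modulo 2, and the remaining faces make up the
      left-hand side.\<close>
    let ?m = "\<phi> (front_face p \<sigma>) * \<psi> (back_face (Suc p) q \<sigma>)"
    have F: "singular_simplex (p + q) X (?F k)" if "k \<le> Suc (p + q)" for k
      using singular_simplex_singular_face[OF True] that by simp
    have front: "singular_simplex (Suc p) X (front_face (Suc p) \<sigma>)"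
      using True by (intro singular_simplex_front_face[of _ q]) simp
    have bck: "singular_simplex (Suc q) X (back_face p (Suc q) \<sigma>)"
      using True by (intro singular_simplex_back_face) simp
    have "coboundary (p + q) X (cup_cochain p q X \<phi> \<psi>) \<sigma> = (\<Sum>k\<le>Suc (p + q). ?f k)"
      unfolding coboundary_simplex[OF True]
      by (rule sum.cong) (use F in \<open>auto simp: cup_cochain_def\<close>)
    also have "{..Suc (p + q)} = {..p} \<union> {Suc p..Suc (p + q)}"
      by auto
    also have "sum ?f ({..p} \<union> {Suc p..Suc (p + q)}) = sum ?f {..p} + sum ?f {Suc p..Suc (p + q)}"
      by (rule sum.union_disjoint) auto
    finally have L: "coboundary (p + q) X (cup_cochain p q X \<phi> \<psi>) \<sigma> =
        sum ?f {..p} + sum ?f {Suc p..Suc (p + q)}" .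
    have "cup_cochain (Suc p) q X (coboundary p X \<phi>) \<psi> \<sigma> =
        (\<Sum>k\<le>Suc p. \<phi> (singular_face (Suc p) k (front_face (Suc p) \<sigma>))) * \<psi> (back_face (Suc p) q \<sigma>)"
      using True by (simp add: cup_cochain_def coboundary_simplex[OF front] del: sum.atMost_Suc)
    also have "\<dots> = (\<Sum>k\<le>Suc p. \<phi> (front_face p (?F k)) * \<psi> (back_face (Suc p) q \<sigma>))"
      by (simp add: front_face_singular_face sum_distrib_right del: sum.atMost_Suc)
    also have "\<dots> = (\<Sum>k\<le>p. \<phi> (front_face p (?F k)) * \<psi> (back_face (Suc p) q \<sigma>)) + ?m"
      by (simp add: front_face_singular_face_gt)
    also have "\<dots> = sum ?f {..p} + ?m"
      by (simp add: back_face_singular_face_le)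
    finally have R1: "cup_cochain (Suc p) q X (coboundary p X \<phi>) \<psi> \<sigma> = sum ?f {..p} + ?m" .
    have *: "\<psi> (singular_face (Suc q) k (back_face p (Suc q) \<sigma>)) =
        \<psi> (back_face p q (?F (p + k)))" if "k \<le> Suc q" for k
      using that back_face_singular_face[of p "p + k" q \<sigma>] by simp
    have "cup_cochain p (Suc q) X \<phi> (coboundary q X \<psi>) \<sigma> =
        \<phi> (front_face p \<sigma>) * (\<Sum>k\<le>Suc q. \<psi> (singular_face (Suc q) k (back_face p (Suc q) \<sigma>)))"
      using True by (simp add: cup_cochain_def coboundary_simplex[OF bck] del: sum.atMost_Suc)
    also have "\<dots> = \<phi> (front_face p \<sigma>) * (\<Sum>k\<le>Suc q. \<psi> (back_face p q (?F (p + k))))"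
      by (intro arg_cong2[of _ _ _ _ "(*)"] sum.cong refl *) simp
    also have "\<dots> = (\<Sum>k\<in>{0..Suc q}. \<phi> (front_face p \<sigma>) * \<psi> (back_face p q (?F (p + k))))"
      by (simp only: sum_distrib_left atMost_atLeast0)
    also have "\<dots> = \<phi> (front_face p \<sigma>) * \<psi> (back_face p q (?F p)) +
        (\<Sum>k\<in>{Suc 0..Suc q}. \<phi> (front_face p \<sigma>) * \<psi> (back_face p q (?F (p + k))))"
      by (subst sum.atLeast_Suc_atMost) auto
    also have "\<phi> (front_face p \<sigma>) * \<psi> (back_face p q (?F p)) = ?m"
      by (simp add: back_face_singular_face_le)
    also have "(\<Sum>k\<in>{Suc 0..Suc q}. \<phi> (front_face p \<sigma>) * \<psi> (back_face p q (?F (p + k)))) =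
        (\<Sum>k\<in>{Suc 0..Suc q}. ?f (k + p))"
      by (intro sum.cong) (auto simp: front_face_singular_face_gt add.commute)
    also have "\<dots> = sum ?f {Suc p..Suc (p + q)}"
      by (subst sum.shift_bounds_cl_nat_ivl[symmetric]) (simp add: add.commute)
    finally have R2: "cup_cochain p (Suc q) X \<phi> (coboundary q X \<psi>) \<sigma> =
        ?m + sum ?f {Suc p..Suc (p + q)}" .
    show ?thesis
      unfolding L R1 R2 by (simp add: add.assoc bit_add_cancel)
  qed (simp add: coboundary_def cup_cochain_def)
qed

lemma cup_cochain_cocycle:
  "\<phi> \<in> cocycles p X \<Longrightarrow> \<psi> \<in> cocycles q X \<Longrightarrow> cup_cochain p q X \<phi> \<psi> \<in> cocycles (p + q) X"
  by (simp add: cocycles_def cup_cochain_in_carrier coboundary_cup_cochain)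

lemma cup_cochain_coboundary_left:
  assumes "\<phi> \<in> coboundaries p X" "\<psi> \<in> cocycles q X"
  shows "cup_cochain p q X \<phi> \<psi> \<in> coboundaries (p + q) X"
proof (cases p)
  case (Suc n)
  with assms obtain a where "\<phi> = coboundary n X a"
    by (auto simp: coboundaries_def)
  then have "cup_cochain p q X \<phi> \<psi> = coboundary (n + q) X (cup_cochain n q X a \<psi>)"
    using assms(2) by (simp add: coboundary_cup_cochain cocycles_iff Suc)
  then show ?thesis
    using Suc coboundariesI[OF cup_cochain_in_carrier] by simp
qed (use assms coboundaries_zero in \<open>simp add: coboundaries_def\<close>)

lemma cup_cochain_coboundary_right:
  assumes "\<phi> \<in> cocycles p X" "\<psi> \<in> coboundaries q X"
  shows "cup_cochain p q X \<phi> \<psi> \<in> coboundaries (p + q) X"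
proof (cases q)
  case (Suc n)
  with assms obtain a where "\<psi> = coboundary n X a"
    by (auto simp: coboundaries_def)
  then have "cup_cochain p q X \<phi> \<psi> = coboundary (p + n) X (cup_cochain p n X \<phi> a)"
    using assms(1) by (simp add: coboundary_cup_cochain cocycles_iff Suc)
  then show ?thesis
    using Suc coboundariesI[OF cup_cochain_in_carrier] by simp
qed (use assms coboundaries_zero in \<open>simp add: coboundaries_def\<close>)

text \<open>Replacing one factor at a time by a cohomologous cocycle changes the product by a
  coboundary, so all cosets in the union that defines \<open>cup_product\<close> coincide.\<close>

lemma cup_product_cohomology_class:
  assumes "\<phi> \<in> cocycles p X" "\<psi> \<in> cocycles q X"
  shows "cup_product p q X (cohomology_class p X \<phi>) (cohomology_class q X \<psi>) =
         cohomology_class (p + q) X (cup_cochain p q X \<phi> \<psi>)"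
proof -
  have "cohomology_class (p + q) X (cup_cochain p q X \<phi>' \<psi>') =
      cohomology_class (p + q) X (cup_cochain p q X \<phi> \<psi>)"
    if "\<phi>' \<in> cohomology_class p X \<phi>" "\<psi>' \<in> cohomology_class q X \<psi>" for \<phi>' \<psi>'
  proof -
    have \<psi>': "\<psi>' \<in> cocycles q X"
      using cocycles_cohomology_class that assms by blast
    have 1: "(\<lambda>\<sigma>. \<phi>' \<sigma> + \<phi> \<sigma>) \<in> coboundaries p X" "(\<lambda>\<sigma>. \<psi>' \<sigma> + \<psi> \<sigma>) \<in> coboundaries q X"
      using cocycles_cohomology_class(2) that assms cohomology_class_eq_iff by metis+
    have "(\<lambda>\<sigma>. cup_cochain p q X \<phi>' \<psi>' \<sigma> + cup_cochain p q X \<phi> \<psi>' \<sigma>) \<in> coboundaries (p + q) X"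
      using cup_cochain_coboundary_left[OF 1(1) \<psi>'] by (simp add: cup_cochain_add_left)
    moreover have "(\<lambda>\<sigma>. cup_cochain p q X \<phi> \<psi>' \<sigma> + cup_cochain p q X \<phi> \<psi> \<sigma>) \<in> coboundaries (p + q) X"
      using cup_cochain_coboundary_right[OF assms(1) 1(2)] by (simp add: cup_cochain_add_right)
    ultimately show ?thesis
      by (metis cohomology_class_eq_iff)
  qed
  moreover have "cohomology_class p X \<phi> \<noteq> {}" "cohomology_class q X \<psi> \<noteq> {}"
    using cohomology_class_self by blast+
  ultimately show ?thesis
    unfolding cup_product_def by (simp cong: SUP_cong)
qed


section \<open>Small simplices\<close>

text \<open>Turns a functional of chains, such as \<open>\<phi>\<close> composed with a chain
  homotopy, into a cochain.\<close>

lemma additive_eq_cochain_eval: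
  fixes g :: "'a chain \<Rightarrow> bit"
  assumes "g 0 = 0" "\<And>a b. g (a - b) = g a + g b"
  shows "g c = cochain_eval (\<lambda>\<sigma>. g (frag_of \<sigma>)) c"
proof -
  have "Poly_Mapping.keys c \<subseteq> UNIV"
    by simp
  then show ?thesis
    by (induction rule: frag_induction) (simp_all add: assms cochain_eval_diff)
qed

lemma singular_chain_iterated_subdivision:
  "singular_chain p X c \<Longrightarrow> singular_chain p X ((singular_subdivision p ^^ m) c)"
  by (induction m) (simp_all add: singular_chain_singular_subdivision)

lemma chain_boundary_iterated_subdivision:
  assumes "singular_chain p X c"
  shows "chain_boundary p ((singular_subdivision p ^^ m) c) =
         (singular_subdivision (p - Suc 0) ^^ m) (chain_boundary p c)"
proof (induction m)
  case (Suc m)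
  then show ?case
    using chain_boundary_singular_subdivision[OF singular_chain_iterated_subdivision[OF assms]]
    by simp
qed simp

lemma sum_telescope_bit: "(\<Sum>j<M. a (Suc j) + a j) = a M + (a 0 :: bit)"
  by (induction M) (simp_all add: ac_simps)

text \<open>The subdivision homotopies \<open>h\<close> are summed over the number of subdivisions that a simplex needs
  in order to become small; the homotopy of a small chain is again small, hence the number may be
  increased at will.\<close>

theorem cocycle_vanishing_on_small_simplices:
  assumes \<phi>: "\<phi> \<in> cocycles (Suc q) X"
    and opn: "\<And>U. U \<in> \<C> \<Longrightarrow> openin X U" and cover: "topspace X \<subseteq> \<Union>\<C>"
    and small: "\<And>\<sigma> U. \<lbrakk>singular_simplex (Suc q) X \<sigma>; U \<in> \<C>; \<sigma> ` standard_simplex (Suc q) \<subseteq> U\<rbrakk> \<Longrightarrow> \<phi> \<sigma> = 0"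
  shows "\<phi> \<in> coboundaries (Suc q) X"
proof -
  obtain h :: "nat \<Rightarrow> 'a chain \<Rightarrow> 'a chain" where
        h0: "\<And>p. h p 0 = 0"
    and hdiff: "\<And>p c1 c2. h p (c1 - c2) = h p c1 - h p c2"
    and hchain: "\<And>p X c. singular_chain p X c \<Longrightarrow> singular_chain (Suc p) X (h p c)"
    and hbd: "\<And>p X c. singular_chain p X c
                 \<Longrightarrow> chain_boundary (Suc p) (h p c) + h (p - Suc 0) (chain_boundary p c) = singular_subdivision p c - c"
    by (blast intro: chain_homotopic_singular_subdivision)
  let ?S = "\<lambda>p m c. (singular_subdivision p ^^ m) c"
  \<comment> \<open>The value of \<open>\<phi>\<close> on the homotopy between the
    \<open>j\<close>-th subdivision of a chain and the next one. As \<open>\<phi>\<close> is a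
    cocycle, on a boundary it is the difference of the values of \<open>\<phi>\<close> on two
    successive subdivisions (\<open>step\<close> below).\<close>
  define E where "E j c = cochain_eval \<phi> (h q (?S q j c))" for j c
  have Elin: "E j c = cochain_eval (\<lambda>\<sigma>. E j (frag_of \<sigma>)) c" for j c
    by (rule additive_eq_cochain_eval)
      (simp_all add: E_def h0 hdiff singular_subdivision_power_diff cochain_eval_diff)
  \<comment> \<open>The homotopy is natural in the space: \<open>hchain\<close> for the subspace
    \<open>U\<close> keeps the homotopy of a simplex in \<open>U\<close> inside
    \<open>U\<close>.\<close>
  have h_small: "cochain_eval \<phi> (h q c) = 0"
    if "Poly_Mapping.keys c \<subseteq> {\<tau>. singular_simplex q X \<tau> \<and> (\<exists>U\<in>\<C>. \<tau> ` standard_simplex q \<subseteq> U)}" for c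
    using that
  proof (induction rule: frag_induction)
    case (one \<tau>)
    then obtain U where U: "U \<in> \<C>" "singular_simplex q (subtopology X U) \<tau>"
      by (auto simp: singular_simplex_subtopology)
    then have "singular_chain (Suc q) (subtopology X U) (h q (frag_of \<tau>))"
      by (intro hchain) (simp add: singular_chain_of)
    then have "singular_simplex (Suc q) X \<sigma> \<and> \<sigma> ` standard_simplex (Suc q) \<subseteq> U"
      if "\<sigma> \<in> Poly_Mapping.keys (h q (frag_of \<tau>))" for \<sigma>
      using that unfolding singular_chain_def singular_simplex_subtopology[symmetric] by blast
    with small U show ?case
      by (intro cochain_eval_eq_0) blast
  qed (simp_all add: h0 hdiff cochain_eval_diff)
  have "\<exists>m. \<forall>j\<ge>m. E j (frag_of \<tau>) = 0" if \<tau>: "singular_simplex q X \<tau>" for \<tau>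
  proof -
    have c: "singular_chain q X (frag_of \<tau>)"
      using \<tau> by (simp add: singular_chain_of)
    obtain m where m: "\<And>j f. \<lbrakk>m \<le> j; f \<in> Poly_Mapping.keys (?S q j (frag_of \<tau>))\<rbrakk>
        \<Longrightarrow> \<exists>V \<in> \<C>. f \<in> standard_simplex q \<rightarrow> V"
      using sufficient_iterated_singular_subdivision_exists[OF opn cover c] by metis
    have "E j (frag_of \<tau>) = 0" if "m \<le> j" for j
      unfolding E_def
    proof (rule h_small, rule subsetI)
      fix f assume f: "f \<in> Poly_Mapping.keys (?S q j (frag_of \<tau>))"
      then have "singular_simplex q X f"
        using singular_chain_iterated_subdivision[OF c] by (auto simp: singular_chain_def)
      with m[OF that f] show "f \<in> {\<tau>. singular_simplex q X \<tau> \<and> (\<exists>U\<in>\<C>. \<tau> ` standard_simplex q \<subseteq> U)}"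
        by blast
    qed
    then show ?thesis by blast
  qed
  then obtain m where m: "\<And>\<tau> j. singular_simplex q X \<tau> \<Longrightarrow> m \<tau> \<le> j \<Longrightarrow> E j (frag_of \<tau>) = 0"
    by metis
  define \<psi> where "\<psi> \<tau> = (if singular_simplex q X \<tau> then \<Sum>j<m \<tau>. E j (frag_of \<tau>) else 0)" for \<tau>
  have \<psi>: "\<psi> \<tau> = (\<Sum>j<M. E j (frag_of \<tau>))" if "singular_simplex q X \<tau>" "m \<tau> \<le> M" for \<tau> M
  proof -
    have "(\<Sum>j<m \<tau>. E j (frag_of \<tau>)) = (\<Sum>j<M. E j (frag_of \<tau>))"
      by (rule sum.mono_neutral_left) (use that m in auto)
    then show ?thesis
      using that by (simp add: \<psi>_def)
  qed
  have "coboundary q X \<psi> \<sigma> = \<phi> \<sigma>" for \<sigma>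
  proof (cases "singular_simplex (Suc q) X \<sigma>")
    case True
    define a where "a j = cochain_eval \<phi> (?S (Suc q) j (frag_of \<sigma>))" for j
    have c: "singular_chain (Suc q) X (frag_of \<sigma>)"
      using True by (simp add: singular_chain_of)
    obtain m0 where m0: "\<And>j f. \<lbrakk>m0 \<le> j; f \<in> Poly_Mapping.keys (?S (Suc q) j (frag_of \<sigma>))\<rbrakk>
        \<Longrightarrow> \<exists>V \<in> \<C>. f \<in> standard_simplex (Suc q) \<rightarrow> V"
      using sufficient_iterated_singular_subdivision_exists[OF opn cover c] by metis
    \<comment> \<open>Late enough for \<open>\<sigma>\<close> and all its faces at once: every sum
      in \<open>\<psi>\<close> may end at \<open>M\<close>, and the telescoping sum leaves
      \<open>a 0\<close> because \<open>a M\<close> vanishes.\<close>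
    define M where "M = Max (insert m0 ((\<lambda>k. m (singular_face (Suc q) k \<sigma>)) ` {..Suc q}))"
    have M: "m0 \<le> M" "\<And>k. k \<le> Suc q \<Longrightarrow> m (singular_face (Suc q) k \<sigma>) \<le> M"
      unfolding M_def by (rule Max_ge; simp)+
    have aM: "a M = 0"
      unfolding a_def
    proof (rule cochain_eval_eq_0)
      fix f assume f: "f \<in> Poly_Mapping.keys (?S (Suc q) M (frag_of \<sigma>))"
      then have "singular_simplex (Suc q) X f"
        using singular_chain_iterated_subdivision[OF c] by (auto simp: singular_chain_def)
      moreover obtain V where "V \<in> \<C>" "f \<in> standard_simplex (Suc q) \<rightarrow> V"
        using m0[OF M(1) f] by blast
      ultimately show "\<phi> f = 0"
        by (intro small[of f V]) auto
    qed
    have step: "E j (chain_boundary (Suc q) (frag_of \<sigma>)) = a (Suc j) + a j" for j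
    proof -
      let ?c = "?S (Suc q) j (frag_of \<sigma>)"
      have cj: "singular_chain (Suc q) X ?c"
        by (rule singular_chain_iterated_subdivision[OF c])
      have "E j (chain_boundary (Suc q) (frag_of \<sigma>)) = cochain_eval \<phi> (h q (chain_boundary (Suc q) ?c))"
        by (simp add: E_def chain_boundary_iterated_subdivision[OF c])
      also have "h q (chain_boundary (Suc q) ?c) =
          (singular_subdivision (Suc q) ?c - ?c) - chain_boundary (Suc (Suc q)) (h (Suc q) ?c)"
        using hbd[OF cj] by (simp add: algebra_simps)
      also have "cochain_eval \<phi> \<dots> = a (Suc j) + a j +
          cochain_eval \<phi> (chain_boundary (Suc (Suc q)) (h (Suc q) ?c))"
        by (simp add: cochain_eval_diff a_def)
      also have "cochain_eval \<phi> (chain_boundary (Suc (Suc q)) (h (Suc q) ?c)) = 0"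
        using \<phi> by (simp add: cochain_eval_boundary[OF hchain[OF cj]] cocycles_iff cochain_eval_eq_0)
      finally show ?thesis by simp
    qed
    have "coboundary q X \<psi> \<sigma> = (\<Sum>k\<le>Suc q. \<Sum>j<M. E j (frag_of (singular_face (Suc q) k \<sigma>)))"
      unfolding coboundary_simplex[OF True]
      using singular_simplex_singular_face[OF True] M(2) by (intro sum.cong \<psi> refl) auto
    also have "\<dots> = (\<Sum>j<M. \<Sum>k\<le>Suc q. E j (frag_of (singular_face (Suc q) k \<sigma>)))"
      by (rule sum.swap)
    also have "\<dots> = (\<Sum>j<M. E j (chain_boundary (Suc q) (frag_of \<sigma>)))"
      by (subst (2) Elin) (simp add: chain_boundary_of cochain_eval_sum cochain_eval_sign del: sum.atMost_Suc)

    also have "\<dots> = a M + a 0"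
      unfolding step by (rule sum_telescope_bit)
    also have "\<dots> = \<phi> \<sigma>"
      unfolding aM by (simp add: a_def)
    finally show ?thesis .
  next
    case False
    with \<phi> show ?thesis
      by (simp add: coboundary_def cocycles_iff)
  qed
  then have "\<phi> = coboundary q X \<psi>" by (intro ext) simp
  moreover have "\<psi> \<in> carrier (cochain_group q X)"
    by (simp add: cochain_carrier_iff \<psi>_def)
  ultimately show ?thesis
    using coboundariesI by metis
qed


section \<open>Double covers\<close>

abbreviation unit_square :: "(real \<times> real) set" where "unit_square \<equiv> {0..1} \<times> {0..1}"

text \<open>A free involution on a Hausdorff space has evenly covered orbits, which is derived in
  \<open>sheet_exists\<close>; base and projection are determined by \<open>E\<close> and
  \<open>\<tau>\<close>.\<close>

locale double_cover =
  fixes E :: "'e topology" and \<tau> :: "'e \<Rightarrow> 'e"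
  assumes hausdorff: "Hausdorff_space E"
    and continuous_involution: "continuous_map E E \<tau>"
    and involution: "\<And>e. e \<in> topspace E \<Longrightarrow> \<tau> (\<tau> e) = e"
    and free: "\<And>e. e \<in> topspace E \<Longrightarrow> \<tau> e \<noteq> e"
begin

abbreviation "base \<equiv> orbit_space2 E \<tau>"
abbreviation "proj \<equiv> orbit2 \<tau>"

lemma involution_in [simp]: "e \<in> topspace E \<Longrightarrow> \<tau> e \<in> topspace E"
  using continuous_involution by (auto simp: continuous_map_def)

lemma topspace_base: "topspace base = proj ` topspace E"
  by (simp add: orbit_space2_def)

lemma quotient_map_proj: "quotient_map E base proj"
  unfolding orbit_space2_def by (rule quotient_map_quotient_topology)

lemma continuous_map_proj: "continuous_map E base proj"
  using quotient_map_proj quotient_imp_continuous_map by blast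

lemma proj_eq_iff:
  "e \<in> topspace E \<Longrightarrow> e' \<in> topspace E \<Longrightarrow> proj e = proj e' \<longleftrightarrow> e' = e \<or> e' = \<tau> e"
  using involution by (auto simp: orbit2_def doubleton_eq_iff)

lemma proj_involution [simp]: "e \<in> topspace E \<Longrightarrow> proj (\<tau> e) = proj e"
  by (auto simp: orbit2_def involution)

lemma openin_involution: "openin E V \<Longrightarrow> openin E {e \<in> topspace E. \<tau> e \<in> V}"
  using continuous_involution by (auto simp: continuous_map_def)

lemma openin_base_proj_image:
  assumes "openin E V"
  shows "openin base (proj ` V)"
proof -
  have V: "V \<subseteq> topspace E"
    using assms openin_subset by blast
  have "{e \<in> topspace E. proj e \<in> proj ` V} = V \<union> {e \<in> topspace E. \<tau> e \<in> V}"
    using V proj_eq_iff proj_involution by (auto simp: image_iff) (metis involution_in subsetD)+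
  then show ?thesis
    using assms openin_involution V
    by (auto simp: orbit_space2_def openin_quotient_topology)
qed

lemma sheet_exists:
  assumes e: "e \<in> topspace E"
  obtains V where "openin E V" "e \<in> V" "inj_on proj V"
proof -
  obtain U1 U2 where U: "openin E U1" "openin E U2" "e \<in> U1" "\<tau> e \<in> U2" "disjnt U1 U2"
    using hausdorff e free[OF e] unfolding Hausdorff_space_def by (metis involution_in)
  \<comment> \<open>\<open>\<tau>\<close> carries this set into \<open>U2\<close>, which is disjoint
    from \<open>U1\<close>; so it meets each orbit at most once.\<close>
  let ?V = "U1 \<inter> {x \<in> topspace E. \<tau> x \<in> U2}"
  show ?thesis
  proof
    show "openin E ?V"
      using U openin_involution by blast
    show "e \<in> ?V"
      using U e by simp
    show "inj_on proj ?V"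
      using U(5) proj_eq_iff by (fastforce simp: inj_on_def disjnt_iff)
  qed
qed

lemma local_lift:
  assumes \<sigma>: "continuous_map Z base \<sigma>" and z: "z \<in> topspace Z"
  obtains W f where "openin Z W" "z \<in> W" "continuous_map (subtopology Z W) E f"
    "\<And>x. x \<in> W \<Longrightarrow> proj (f x) = \<sigma> x"
proof -
  have "\<sigma> z \<in> topspace base"
    using \<sigma> z by (auto simp: continuous_map_def)
  then obtain e where e: "e \<in> topspace E" "proj e = \<sigma> z"
    unfolding topspace_base by auto
  obtain V where V: "openin E V" "e \<in> V" "inj_on proj V"
    using sheet_exists[OF e(1)] .
  define f where "f x = the_inv_into V proj (\<sigma> x)" for x
  let ?W = "{x \<in> topspace Z. \<sigma> x \<in> proj ` V}"
  have f: "f x \<in> V" "proj (f x) = \<sigma> x" if "x \<in> ?W" for x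
    using that the_inv_into_into[OF V(3)] f_the_inv_into_f[OF V(3)] by (auto simp: f_def)
  show ?thesis
  proof
    show W: "openin Z ?W"
      using \<sigma> openin_base_proj_image[OF V(1)] by (auto simp: continuous_map_def)
    show "z \<in> ?W"
      using z e V(2) by force
    show "continuous_map (subtopology Z ?W) E f"
      unfolding continuous_map_def
    proof (intro conjI allI impI)
      show "f \<in> topspace (subtopology Z ?W) \<rightarrow> topspace E"
        using f(1) openin_subset[OF V(1)] by auto
      fix U assume U: "openin E U"
      \<comment> \<open>\<open>proj\<close> is open, so preimages under the local lift are preimages
        under \<open>\<sigma>\<close> of open sets of the base.\<close>
      have "{x \<in> topspace (subtopology Z ?W). f x \<in> U} = {x \<in> topspace Z. \<sigma> x \<in> proj ` (U \<inter> V)}"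
        using f by (auto simp: f_def the_inv_into_f_f[OF V(3)])
      moreover have "openin Z {x \<in> topspace Z. \<sigma> x \<in> proj ` (U \<inter> V)}"
        using \<sigma> openin_base_proj_image[of "U \<inter> V"] U V(1) by (auto simp: continuous_map_def)
      ultimately show "openin (subtopology Z ?W) {x \<in> topspace (subtopology Z ?W). f x \<in> U}"
        using W by (auto simp: openin_open_subtopology)
    qed
    show "proj (f x) = \<sigma> x" if "x \<in> ?W" for x
      using f(2) that .
  qed
qed

text \<open>The set where the lifts agree and the set where \<open>\<tau>\<close> exchanges them are
  closed since \<open>E\<close> is Hausdorff, disjoint since \<open>\<tau>\<close> is free, and
  cover \<open>Z\<close>; by connectedness one of them is empty.\<close>

lemma lift_dichotomy:
  assumes Z: "connected_space Z"
    and f: "continuous_map Z E f" and g: "continuous_map Z E g"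
    and eq: "\<And>z. z \<in> topspace Z \<Longrightarrow> proj (f z) = proj (g z)"
  shows "(\<forall>z\<in>topspace Z. g z = f z) \<or> (\<forall>z\<in>topspace Z. g z = \<tau> (f z))"
proof -
  have fg: "f z \<in> topspace E" "g z \<in> topspace E" if "z \<in> topspace Z" for z
    using f g that by (auto simp: continuous_map_def)
  let ?A = "{z \<in> topspace Z. g z = f z}" and ?B = "{z \<in> topspace Z. g z = (\<tau> \<circ> f) z}"
  have "closedin Z ?A" "closedin Z ?B"
    using continuous_map_compose[OF f continuous_involution]
    by (intro closedin_continuous_maps_eq[OF hausdorff] f g; simp add: o_def)+
  moreover have "topspace Z \<subseteq> ?A \<union> ?B"
    using fg eq proj_eq_iff by fastforce
  moreover have "?A \<inter> ?B = {}"
    using fg free by fastforce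
  ultimately have "?A = {} \<or> ?B = {}"
    using Z unfolding connected_space_closedin by blast
  then show ?thesis
    using \<open>topspace Z \<subseteq> ?A \<union> ?B\<close> by auto
qed

text \<open>On the connected overlap the lifts agree or differ by \<open>\<tau>\<close>; in the
  second case \<open>\<tau> \<circ> g\<close> replaces \<open>g\<close>.\<close>

lemma lift_glue:
  fixes S T :: "'z::topological_space set"
  assumes S: "closed S" "continuous_map (top_of_set S) E f" "\<And>x. x \<in> S \<Longrightarrow> proj (f x) = \<sigma> x"
    and T: "closed T" "continuous_map (top_of_set T) E g" "\<And>x. x \<in> T \<Longrightarrow> proj (g x) = \<sigma> x"
    and conn: "connected (S \<inter> T)"
  shows "\<exists>k. continuous_map (top_of_set (S \<union> T)) E k \<and> (\<forall>x\<in>S \<union> T. proj (k x) = \<sigma> x)"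
proof -
  have "\<exists>g'. continuous_map (top_of_set T) E g' \<and> (\<forall>x\<in>T. proj (g' x) = \<sigma> x) \<and> (\<forall>x\<in>S \<inter> T. g' x = f x)"
  proof -
    have g_in: "g x \<in> topspace E" if "x \<in> T" for x
      using T(2) that by (auto simp: continuous_map_def)
    have f_in: "f x \<in> topspace E" if "x \<in> S" for x
      using S(2) that by (auto simp: continuous_map_def)
    have "continuous_map (top_of_set (S \<inter> T)) E f" "continuous_map (top_of_set (S \<inter> T)) E g"
      using S(2) T(2) continuous_map_from_subtopology_mono by blast+
    moreover have "connected_space (top_of_set (S \<inter> T))"
      using conn by (simp add: connected_space_subtopology)
    ultimately consider "\<forall>x\<in>S \<inter> T. g x = f x" | "\<forall>x\<in>S \<inter> T. g x = \<tau> (f x)"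
      using lift_dichotomy[of "top_of_set (S \<inter> T)" f g] S(3) T(3) by auto
    then show ?thesis
    proof cases
      case 2
      have "continuous_map (top_of_set T) E (\<tau> \<circ> g)"
        using T(2) continuous_involution continuous_map_compose by blast
      then show ?thesis
        using 2 T(3) g_in f_in involution by (intro exI[of _ "\<tau> \<circ> g"]) auto
    qed (use T in blast)
  qed
  then obtain g' where g': "continuous_map (top_of_set T) E g'" "\<And>x. x \<in> T \<Longrightarrow> proj (g' x) = \<sigma> x"
    "\<And>x. x \<in> S \<Longrightarrow> x \<in> T \<Longrightarrow> g' x = f x"
    by blast
  let ?k = "\<lambda>x. if x \<in> S then f x else g' x"
  have "continuous_map (top_of_set (S \<union> T)) E ?k"
  proof (rule pasting_lemma_closed[where I = "{True, False}" and T = "\<lambda>b. if b then S else T"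
        and f = "\<lambda>b. if b then f else g'"])
    show "closedin (top_of_set (S \<union> T)) (if i then S else T)" if "i \<in> {True, False}" for i
      using S(1) T(1) by (auto intro: closed_subset)
    show "continuous_map (subtopology (top_of_set (S \<union> T)) (if i then S else T)) E (if i then f else g')"
      if "i \<in> {True, False}" for i
      using S(2) g'(1) by (simp add: subtopology_subtopology Int_absorb1 inf_commute)
  qed (use g'(3) in auto)
  moreover have "\<forall>x\<in>S \<union> T. proj (?k x) = \<sigma> x"
    using S(3) g'(2) by auto
  ultimately show ?thesis by blast
qed

text \<open>Lifts over small boxes are glued along convex overlaps by bisecting one direction after
  the other. The square is enough because simplices of dimension 1 and 2 are images of it.\<close>

lemma square_lift:
  fixes \<sigma> :: "real \<times> real \<Rightarrow> 'e set"
  assumes \<sigma>: "continuous_map (top_of_set unit_square) base \<sigma>"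
  obtains f where "continuous_map (top_of_set unit_square) E f"
    "\<And>x. x \<in> unit_square \<Longrightarrow> proj (f x) = \<sigma> x"
proof -
  let ?S = unit_square
  define good where "good A \<longleftrightarrow>
      (\<exists>f. continuous_map (top_of_set (?S \<inter> A)) E f \<and> (\<forall>x\<in>?S \<inter> A. proj (f x) = \<sigma> x))" for A
  have good_mono: "good A" if "good A'" "A \<subseteq> A'" for A A'
    using that unfolding good_def
    by (meson Int_mono continuous_map_from_subtopology_mono order_refl subsetD)
  have good_Un: "good (A \<union> A')" if "good A" "good A'" "closed A" "closed A'" "convex A" "convex A'" for A A'
  proof -
    have clo: "closed (?S \<inter> A)" "closed (?S \<inter> A')"
      using that by (auto intro!: closed_Times)
    have conn: "connected ((?S \<inter> A) \<inter> (?S \<inter> A'))"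
      using that by (intro convex_connected convex_Int convex_Times) auto
    obtain f g where "continuous_map (top_of_set (?S \<inter> A)) E f" "\<And>x. x \<in> ?S \<inter> A \<Longrightarrow> proj (f x) = \<sigma> x"
      "continuous_map (top_of_set (?S \<inter> A')) E g" "\<And>x. x \<in> ?S \<inter> A' \<Longrightarrow> proj (g x) = \<sigma> x"
      using \<open>good A\<close> \<open>good A'\<close> unfolding good_def by blast
    from lift_glue[OF clo(1) this(1,2) clo(2) this(3,4) conn]
    have "\<exists>k. continuous_map (top_of_set ((?S \<inter> A) \<union> (?S \<inter> A'))) E k \<and>
        (\<forall>x\<in>(?S \<inter> A) \<union> (?S \<inter> A'). proj (k x) = \<sigma> x)" .
    then show ?thesis
      by (simp add: good_def Int_Un_distrib)
  qed
  have nbhd: "\<exists>r>0. good ({x - r..x + r} \<times> {y - r..y + r})"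
    if "0 \<le> x" "x \<le> 1" "0 \<le> y" "y \<le> 1" for x y
  proof -
    have xy: "(x, y) \<in> topspace (top_of_set ?S)"
      using that by simp
    obtain W f where W: "openin (top_of_set ?S) W" "(x, y) \<in> W"
      "continuous_map (subtopology (top_of_set ?S) W) E f" "\<And>x. x \<in> W \<Longrightarrow> proj (f x) = \<sigma> x"
      using local_lift[OF \<sigma> xy] by blast
    obtain O' where O: "open O'" "W = ?S \<inter> O'"
      using W(1) by (auto simp: openin_open)
    obtain X Y where XY: "open X" "open Y" "x \<in> X" "y \<in> Y" "X \<times> Y \<subseteq> O'"
      using O W(2) by (metis IntD2 mem_Sigma_iff open_prod_elim)
    obtain r1 r2 where r: "r1 > 0" "cball x r1 \<subseteq> X" "r2 > 0" "cball y r2 \<subseteq> Y"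
      using XY open_contains_cball by metis
    let ?r = "min r1 r2"
    have "good O'"
      using W O by (auto simp: good_def subtopology_subtopology)
    moreover have "{x - ?r..x + ?r} \<times> {y - ?r..y + ?r} \<subseteq> O'"
      using XY(5) r by (force simp: cball_eq_atLeastAtMost)
    ultimately show ?thesis
      using good_mono r by (intro exI[of _ ?r]) auto
  qed
  \<comment> \<open>Bisection in the second coordinate, where each join takes the smaller of two
    widths. The bisection in the first coordinate follows, with full strips as the pieces.\<close>
  have strip: "\<exists>r>0. good ({x - r..x + r} \<times> {0..1})" if x: "0 \<le> x" "x \<le> 1" for x
  proof -
    define Q where "Q a b \<longleftrightarrow> (\<exists>r>0. good ({x - r..x + r} \<times> {a..b}))" for a b
    have "(0::real) \<le> 1" by simp
    then have "Q 0 1"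
    proof (induction rule: Bolzano)
      case (trans a b c)
      then obtain r1 r2 where r: "r1 > 0" "good ({x - r1..x + r1} \<times> {a..b})"
          "r2 > 0" "good ({x - r2..x + r2} \<times> {b..c})"
        unfolding Q_def by blast
      let ?r = "min r1 r2"
      have "good ({x - ?r..x + ?r} \<times> {a..b})" "good ({x - ?r..x + ?r} \<times> {b..c})"
        by (rule good_mono[OF r(2)], force) (rule good_mono[OF r(4)], force)
      then have "good ({x - ?r..x + ?r} \<times> {a..b} \<union> {x - ?r..x + ?r} \<times> {b..c})"
        by (intro good_Un closed_Times convex_Times) auto
      moreover have "{x - ?r..x + ?r} \<times> {a..b} \<union> {x - ?r..x + ?r} \<times> {b..c} = {x - ?r..x + ?r} \<times> {a..c}"
        using trans(3,4) by (simp add: Times_Un_distrib1[symmetric] Sigma_Un_distrib2[symmetric]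
            ivl_disj_un_two_touch)
      ultimately show ?case
        using r unfolding Q_def by (intro exI[of _ ?r]) auto
    next
      case (local y)
      then obtain r where "r > 0" "good ({x - r..x + r} \<times> {y - r..y + r})"
        using nbhd x by blast
      then have "Q a b" if "a \<le> y" "y \<le> b" "b - a < r" for a b
        using that unfolding Q_def by (intro exI[of _ r] conjI good_mono[of _ "{x - r..x + r} \<times> {a..b}"]) auto
      with \<open>r > 0\<close> show ?case by blast
    qed
    then show ?thesis by (simp add: Q_def)
  qed
  define Q where "Q a b \<longleftrightarrow> good ({a..b} \<times> {0..1})" for a b
  have "(0::real) \<le> 1" by simp
  then have "Q 0 1"
  proof (induction rule: Bolzano)
    case (trans a b c)
    then have "good ({a..b} \<times> {0..1} \<union> {b..c} \<times> {0..1})"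
      unfolding Q_def by (intro good_Un closed_Times convex_Times) auto
    moreover have "{a..b} \<times> {0..1} \<union> {b..c} \<times> {0..1} = {a..c} \<times> {0..1::real}"
      using trans(3,4) by (simp add: Sigma_Un_distrib1[symmetric] ivl_disj_un_two_touch)
    ultimately show ?case by (simp add: Q_def)
  next
    case (local x)
    then obtain r where "r > 0" "good ({x - r..x + r} \<times> {0..1})"
      using strip by blast
    then have "Q a b" if "a \<le> x" "x \<le> b" "b - a < r" for a b
      using that unfolding Q_def by (elim good_mono) auto
    with \<open>r > 0\<close> show ?case by blast
  qed
  then obtain f where "continuous_map (top_of_set ?S) E f" "\<forall>x\<in>?S. proj (f x) = \<sigma> x"
    unfolding Q_def good_def by auto
  then show ?thesis
    using that by blast
qed

end


section \<open>Cochains representing the first Stiefel--Whitney class\<close>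

definition simplex_vertex :: "nat \<Rightarrow> nat \<Rightarrow> real" where
  "simplex_vertex j = (\<lambda>i. if i = j then 1 else 0)"

lemma simplex_vertex_in [simp]: "simplex_vertex j \<in> standard_simplex p \<longleftrightarrow> j \<le> p"
  by (simp add: simplex_vertex_def)

lemma simplical_face_vertex:
  "simplical_face k (simplex_vertex j) = simplex_vertex (if j < k then j else Suc j)"
  by (auto simp: simplical_face_def simplex_vertex_def fun_eq_iff)

lemma standard_simplex_1_iff:
  "x \<in> standard_simplex (Suc 0) \<longleftrightarrow>
     (\<exists>t\<in>{0..1}. x = (\<lambda>i. if i = 0 then 1 - t else if i = Suc 0 then t else 0))"
proof
  assume x: "x \<in> standard_simplex (Suc 0)"
  then have "x 0 + x (Suc 0) = 1" "\<And>i. i > Suc 0 \<Longrightarrow> x i = 0" "0 \<le> x 1" "x 1 \<le> 1"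
    by (auto simp: standard_simplex_def)
  then show "\<exists>t\<in>{0..1}. x = (\<lambda>i. if i = 0 then 1 - t else if i = Suc 0 then t else 0)"
    by (intro bexI[of _ "x 1"] ext) auto
qed (auto simp: standard_simplex_def)

lemma sum_atMost_Suc_1: "sum g {..Suc 1} = g 0 + g 1 + g (2::nat)"
  by (simp add: numeral_2_eq_2)

lemma connected_space_standard_simplex:
  "connected_space (simplex_space p)"
  by (simp add: connected_space_subtopology connectedin_standard_simplex)

lemma singular_simplex_in:
  "singular_simplex n X \<rho> \<Longrightarrow> x \<in> standard_simplex n \<Longrightarrow> \<rho> x \<in> topspace X"
  by (auto simp: singular_simplex_def continuous_map_def)

lemma singular_simplex_edge:
  assumes "continuous_map (top_of_set S) X f" "continuous_on {0..1} c" "c ` {0..1} \<subseteq> S"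
  shows "singular_simplex 1 X (restrict (\<lambda>x. f (c (x (Suc 0)))) (standard_simplex 1))"
proof -
  have "continuous_on (standard_simplex 1) (\<lambda>x. x (Suc 0))"
    by (rule continuous_on_subset[OF continuous_on_product_coordinates]) simp
  moreover have *: "(\<lambda>x. x (Suc 0)) ` standard_simplex 1 \<subseteq> {0..1}"
    by (auto simp: standard_simplex_def)
  ultimately have "continuous_on (standard_simplex 1) (\<lambda>x. c (x (Suc 0)))"
    using assms(2) continuous_on_compose2 by blast
  then have "continuous_map (top_of_set (standard_simplex 1)) (top_of_set S) (\<lambda>x. c (x (Suc 0)))"
    using * assms(3) by (force simp: continuous_map_in_subtopology)
  from continuous_map_compose[OF this assms(1)] show ?thesis
    by (simp add: singular_simplex_def euclidean_product_topology o_def)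
qed

text \<open>For a labelling \<open>h\<close> of the total space that takes different values on the two points of each
  fibre, the cochain below is the coboundary of \<open>h\<close> on lifted paths; it detects whether a loop
  lifts to a loop.\<close>

definition sw_cochain :: "'e topology \<Rightarrow> ('e \<Rightarrow> 'e) \<Rightarrow> ('e \<Rightarrow> bit) \<Rightarrow> 'e set cochain" where
  "sw_cochain E \<tau> h \<sigma> =
     (if singular_simplex 1 (orbit_space2 E \<tau>) \<sigma>
      then THE b. \<exists>\<rho>. singular_simplex 1 E \<rho> \<and> simplex_map 1 (orbit2 \<tau>) \<rho> = \<sigma> \<and>
             b = h (\<rho> (simplex_vertex 0)) + h (\<rho> (simplex_vertex 1))
      else 0)"

text \<open>Every factor has its own labelling: the upper bound uses the sign of a different
  coordinate in each of them, the lower bound a constant sequence.\<close>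

primrec sw_product :: "'e topology \<Rightarrow> ('e \<Rightarrow> 'e) \<Rightarrow> (nat \<Rightarrow> 'e \<Rightarrow> bit) \<Rightarrow> nat \<Rightarrow> 'e set cochain" where
  "sw_product E \<tau> hs 0 = (\<lambda>\<sigma>. if singular_simplex 0 (orbit_space2 E \<tau>) \<sigma> then 1 else 0)"
| "sw_product E \<tau> hs (Suc n) =
     cup_cochain n 1 (orbit_space2 E \<tau>) (sw_product E \<tau> hs n) (sw_cochain E \<tau> (hs n))"

definition odd_labelling :: "'e topology \<Rightarrow> ('e \<Rightarrow> 'e) \<Rightarrow> ('e \<Rightarrow> bit) \<Rightarrow> bool" where
  "odd_labelling E \<tau> h \<longleftrightarrow> (\<forall>e\<in>topspace E. h (\<tau> e) = h e + 1)"

context double_cover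
begin

lemma simplex_lift_unique:
  assumes "singular_simplex n E \<rho>" "singular_simplex n E \<rho>'"
    and "simplex_map n proj \<rho> = simplex_map n proj \<rho>'"
  shows "(\<forall>x\<in>standard_simplex n. \<rho>' x = \<rho> x) \<or> (\<forall>x\<in>standard_simplex n. \<rho>' x = \<tau> (\<rho> x))"
proof -
  have "proj (\<rho> x) = proj (\<rho>' x)" if "x \<in> standard_simplex n" for x
    using fun_cong[OF assms(3), of x] that by (simp add: simplex_map_def)
  then show ?thesis
    using lift_dichotomy[OF connected_space_standard_simplex[of n], of \<rho> \<rho>'] assms(1,2)
    by (simp add: singular_simplex_def)
qed

lemma singular_simplex_proj:
  "singular_simplex n E \<rho> \<Longrightarrow> singular_simplex n base (simplex_map n proj \<rho>)"
  by (rule singular_simplex_simplex_map[OF _ continuous_map_proj])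

lemma square_lift_simplex:
  assumes q: "continuous_map (top_of_set unit_square) (simplex_space n) q"
    and \<sigma>: "singular_simplex n base \<sigma>"
  obtains f where "continuous_map (top_of_set unit_square) E f"
    "\<And>x. x \<in> unit_square \<Longrightarrow> proj (f x) = \<sigma> (q x)"
proof -
  have "continuous_map (top_of_set unit_square) base (\<sigma> \<circ> q)"
    using \<sigma> q continuous_map_compose unfolding singular_simplex_def by blast
  from square_lift[OF this] that show ?thesis by (metis comp_apply)
qed

lemma path_lift:
  assumes \<sigma>: "singular_simplex 1 base \<sigma>"
  obtains \<rho> where "singular_simplex 1 E \<rho>" "simplex_map 1 proj \<rho> = \<sigma>"
proof -
  \<comment> \<open>The second coordinate is a dummy that makes a path an instance of the lifting
    over the square.\<close>
  define q where "q x = (\<lambda>i::nat. if i = 0 then 1 - fst x else if i = Suc 0 then fst x else 0)"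
    for x :: "real \<times> real"
  have "continuous_map (top_of_set unit_square) (simplex_space 1) q"
    unfolding continuous_map_in_subtopology continuous_map_componentwise_UNIV q_def
  proof (intro conjI allI)
    show "continuous_map (top_of_set unit_square) euclideanreal
        (\<lambda>x. if i = 0 then 1 - fst x else if i = Suc 0 then fst x else 0)" for i :: nat
      by (cases "i = 0"; cases "i = Suc 0") (auto intro!: continuous_intros)
    show "(\<lambda>x i. if i = 0 then 1 - fst x else if i = Suc 0 then fst x else 0) \<in>
        topspace (top_of_set unit_square) \<rightarrow> standard_simplex 1"
      by (auto simp: standard_simplex_def)
  qed
  then obtain f where f: "continuous_map (top_of_set unit_square) E f"
      "\<And>x. x \<in> unit_square \<Longrightarrow> proj (f x) = \<sigma> (q x)"
    using square_lift_simplex[OF _ \<sigma>] by blast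
  let ?\<rho> = "restrict (\<lambda>x. f (x (Suc 0), 0)) (standard_simplex 1)"
  show ?thesis
  proof
    show "singular_simplex 1 E ?\<rho>"
      by (rule singular_simplex_edge[OF f(1), of "\<lambda>t. (t, 0)"]) (auto intro!: continuous_intros)
    have "proj (f (x (Suc 0), 0)) = \<sigma> x" if x: "x \<in> standard_simplex 1" for x
    proof -
      have "q (x (Suc 0), 0) = x" "x (Suc 0) \<in> {0..1}"
        using x by (auto simp: standard_simplex_1_iff q_def fun_eq_iff)
      with f(2)[of "(x (Suc 0), 0)"] show ?thesis by simp
    qed
    then show "simplex_map 1 proj ?\<rho> = \<sigma>"
      using \<sigma> by (intro ext) (auto simp: simplex_map_def restrict_def singular_simplex_def extensional_def)
  qed
qed

text \<open>The other lift is the \<open>\<tau>\<close>-translate, which changes the labels of both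
  ends and hence not their sum; so the description in \<open>sw_cochain\<close> determines a unique
  value.\<close>

lemma sw_cochain_lift:
  assumes h: "odd_labelling E \<tau> h" and \<rho>: "singular_simplex 1 E \<rho>"
  shows "sw_cochain E \<tau> h (simplex_map 1 proj \<rho>) = h (\<rho> (simplex_vertex 0)) + h (\<rho> (simplex_vertex 1))"
proof -
  have "h (\<rho>' (simplex_vertex 0)) + h (\<rho>' (simplex_vertex 1)) =
      h (\<rho> (simplex_vertex 0)) + h (\<rho> (simplex_vertex 1))"
    if \<rho>': "singular_simplex 1 E \<rho>'" "simplex_map 1 proj \<rho>' = simplex_map 1 proj \<rho>" for \<rho>'
  proof -
    have "h (\<tau> (\<rho> (simplex_vertex j))) = h (\<rho> (simplex_vertex j)) + 1" if "j \<le> 1" for j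
      using h that singular_simplex_in[OF \<rho>, of "simplex_vertex j"] by (simp add: odd_labelling_def)
    moreover have "(\<forall>x\<in>standard_simplex 1. \<rho>' x = \<rho> x) \<or> (\<forall>x\<in>standard_simplex 1. \<rho>' x = \<tau> (\<rho> x))"
      using simplex_lift_unique[OF \<rho> \<rho>'(1)] \<rho>'(2) by simp
    ultimately show ?thesis
      by (elim disjE) (simp_all add: ac_simps)
  qed
  then have "(THE b. \<exists>\<rho>'. singular_simplex 1 E \<rho>' \<and> simplex_map 1 proj \<rho>' = simplex_map 1 proj \<rho> \<and>
        b = h (\<rho>' (simplex_vertex 0)) + h (\<rho>' (simplex_vertex 1))) =
      h (\<rho> (simplex_vertex 0)) + h (\<rho> (simplex_vertex 1))"
    using \<rho> by (intro the_equality) metis+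
  then show ?thesis
    using singular_simplex_proj[OF \<rho>] by (simp add: sw_cochain_def)
qed

lemma sw_cochain_outside: "\<not> singular_simplex 1 base \<sigma> \<Longrightarrow> sw_cochain E \<tau> h \<sigma> = 0"
  by (simp add: sw_cochain_def)

lemma sw_cochain_cocycle:
  assumes h: "odd_labelling E \<tau> h"
  shows "sw_cochain E \<tau> h \<in> cocycles 1 base"
  unfolding cocycles_iff
proof (intro conjI ext)
  fix \<sigma>
  show "coboundary 1 base (sw_cochain E \<tau> h) \<sigma> = 0"
  proof (cases "singular_simplex (Suc 1) base \<sigma>")
    case True
    let ?I = "{0..1::real}"
    \<comment> \<open>Polar coordinates centred at vertex 0: the side \<open>fst x = 0\<close> of
      the square collapses to that vertex, the other three sides run along the faces of the
      triangle.\<close>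
    define q where "q x = (\<lambda>i::nat. if i = 0 then 1 - fst x else if i = 1 then fst x * (1 - snd x)
        else if i = 2 then fst x * snd x else 0)" for x :: "real \<times> real"
    have "continuous_map (top_of_set (?I \<times> ?I)) (simplex_space (Suc 1)) q"
      unfolding continuous_map_in_subtopology continuous_map_componentwise_UNIV
    proof (intro conjI allI)
      show "continuous_map (top_of_set (?I \<times> ?I)) euclideanreal (\<lambda>x. q x i)" for i
        unfolding q_def
        by (cases "i = 0"; cases "i = 1"; cases "i = 2") (auto intro!: continuous_intros)
      have "(\<Sum>i\<le>Suc 1. q x i) = 1" for x
        by (simp add: q_def algebra_simps numeral_2_eq_2)
      moreover have "fst x * (1 - snd x) \<in> ?I" "fst x * snd x \<in> ?I" if "x \<in> ?I \<times> ?I" for x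
        using that by (auto intro: mult_le_one)
      ultimately show "q \<in> topspace (top_of_set (?I \<times> ?I)) \<rightarrow> standard_simplex (Suc 1)"
        by (auto simp: standard_simplex_def) (auto simp: q_def)
    qed
    then obtain f where f: "continuous_map (top_of_set (?I \<times> ?I)) E f"
        "\<And>x. x \<in> ?I \<times> ?I \<Longrightarrow> proj (f x) = \<sigma> (q x)"
      using square_lift_simplex[OF _ True] by blast
    have face: "sw_cochain E \<tau> h (singular_face (Suc 1) k \<sigma>) = h (f (c 0)) + h (f (c 1))"
      if c: "continuous_on ?I c" "c ` ?I \<subseteq> ?I \<times> ?I" and "k \<le> 2"
        and ck: "\<And>t. t \<in> ?I \<Longrightarrow> q (c t) =
          simplical_face k (\<lambda>i. if i = 0 then 1 - t else if i = Suc 0 then t else 0)" for c k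
    proof -
      let ?\<rho> = "restrict (\<lambda>x. f (c (x (Suc 0)))) (standard_simplex 1)"
      have \<rho>: "singular_simplex 1 E ?\<rho>"
        by (rule singular_simplex_edge[OF f(1) c])
      have "proj (f (c (x (Suc 0)))) = \<sigma> (simplical_face k x)" if x: "x \<in> standard_simplex 1" for x
      proof -
        obtain t where t: "t \<in> ?I" "x = (\<lambda>i. if i = 0 then 1 - t else if i = Suc 0 then t else 0)"
          using x unfolding One_nat_def standard_simplex_1_iff by blast
        then have "c t \<in> ?I \<times> ?I" "x (Suc 0) = t"
          using c(2) by auto
        then show ?thesis
          using f(2)[of "c t"] ck[OF t(1)] t(2) by simp
      qed
      then have "simplex_map 1 proj ?\<rho> = singular_face (Suc 1) k \<sigma>"
        by (intro ext) (simp add: simplex_map_def singular_face_def restrict_def)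
      then show ?thesis
        using sw_cochain_lift[OF h \<rho>] by (simp add: simplex_vertex_def)
    qed
    have f0: "sw_cochain E \<tau> h (singular_face (Suc 1) 0 \<sigma>) = h (f (1, 0)) + h (f (1, 1))"
      by (rule face[of "\<lambda>t. (1, t)"])
        (auto simp: q_def simplical_face_def fun_eq_iff intro!: continuous_intros)
    have f1: "sw_cochain E \<tau> h (singular_face (Suc 1) 1 \<sigma>) = h (f (0, 1)) + h (f (1, 1))"
      by (rule face[of "\<lambda>t. (t, 1)"])
        (auto simp: q_def simplical_face_def fun_eq_iff intro!: continuous_intros)
    have f2: "sw_cochain E \<tau> h (singular_face (Suc 1) 2 \<sigma>) = h (f (0, 0)) + h (f (1, 0))"
      by (rule face[of "\<lambda>t. (t, 0)"])
        (auto simp: q_def simplical_face_def fun_eq_iff intro!: continuous_intros)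
    \<comment> \<open>Along the collapsed side the lift stays in one fibre, so it is constant; the
      alternative of \<open>lift_dichotomy\<close> already fails at \<open>t = 0\<close>.\<close>
    have "f (0, 1) = f (0, 0)"
    proof -
      have "continuous_map (top_of_set ?I) (top_of_set (?I \<times> ?I)) (\<lambda>t. (0, t))"
        by (auto simp: continuous_map_in_subtopology intro!: continuous_intros)
      from continuous_map_compose[OF this f(1)]
      have 1: "continuous_map (top_of_set ?I) E (\<lambda>t. f (0, t))"
        by (simp add: o_def)
      have in_E: "f (0, 0) \<in> topspace E"
        using f(1) by (auto simp: continuous_map_def)
      then have 2: "continuous_map (top_of_set ?I) E (\<lambda>t. f (0, 0))"
        by simp
      have q0: "q (0, t) = q (0, 0)" for t
        by (auto simp: q_def fun_eq_iff)
      have conn: "connected_space (top_of_set ?I)"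
        by (rule connected_space_subtopology) (simp add: is_interval_convex_1)
      have "proj (f (0, 0)) = proj (f (0, t))" if "t \<in> ?I" for t
        using that f(2)[of "(0, t)"] f(2)[of "(0, 0)"] q0[of t] by simp
      then have "(\<forall>t\<in>?I. f (0, t) = f (0, 0)) \<or> (\<forall>t\<in>?I. f (0, t) = \<tau> (f (0, 0)))"
        using lift_dichotomy[OF conn 2 1] by simp
      then show ?thesis
      proof
        assume "\<forall>t\<in>?I. f (0, t) = \<tau> (f (0, 0))"
        then have "f (0, 0) = \<tau> (f (0, 0))"
          by (rule bspec) simp
        with free[OF in_E] show ?thesis by simp
      next
        assume "\<forall>t\<in>?I. f (0, t) = f (0, 0)"
        then show ?thesis
          by (rule bspec) simp
      qed
    qed
    then have f1': "sw_cochain E \<tau> h (singular_face (Suc 1) 1 \<sigma>) = h (f (0, 0)) + h (f (1, 1))"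
      using f1 by simp
    have "(a + b) + (c + b) + (c + a) = 0" for a b c :: bit
      by (cases a; cases b; cases c) simp_all
    then show ?thesis
      unfolding coboundary_simplex[OF True] sum_atMost_Suc_1 f0 f1' f2 .
  qed (simp add: coboundary_def)
qed (use sw_cochain_outside in auto)

text \<open>The sum of two odd labellings is invariant under \<open>\<tau>\<close> and descends to a
  function \<open>k\<close> on the base, whose coboundary is the difference of the cochains.\<close>

lemma sw_cochain_cohomologous:
  assumes h: "odd_labelling E \<tau> h" "odd_labelling E \<tau> h'"
  shows "(\<lambda>\<sigma>. sw_cochain E \<tau> h \<sigma> + sw_cochain E \<tau> h' \<sigma>) \<in> coboundaries 1 base"
proof -
  define k where "k b = (let e = SOME e. e \<in> topspace E \<and> proj e = b in h e + h' e)" for b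
  have k: "k (proj e) = h e + h' e" if e: "e \<in> topspace E" for e
  proof -
    let ?e = "SOME e'. e' \<in> topspace E \<and> proj e' = proj e"
    have "?e \<in> topspace E \<and> proj ?e = proj e"
      by (rule someI[of _ e]) (use e in simp)
    then consider "?e = e" | "?e = \<tau> e"
      using proj_eq_iff e by metis
    then show ?thesis
      by cases (use h e in \<open>simp_all add: k_def Let_def odd_labelling_def ac_simps\<close>)
  qed
  define u where "u \<sigma> = (if singular_simplex 0 base \<sigma> then k (\<sigma> (simplex_vertex 0)) else 0)" for \<sigma>
  have "coboundary 0 base u \<sigma> = sw_cochain E \<tau> h \<sigma> + sw_cochain E \<tau> h' \<sigma>" for \<sigma>
  proof (cases "singular_simplex 1 base \<sigma>")
    case True
    then obtain \<rho> where \<rho>: "singular_simplex 1 E \<rho>" "simplex_map 1 proj \<rho> = \<sigma>"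
      using path_lift by blast
    have "u (singular_face 1 j \<sigma>) = h (\<rho> v) + h' (\<rho> v)"
      if "j \<le> 1" "v = simplex_vertex (if j = 0 then 1 else 0)" for j v
    proof -
      have v: "v \<in> standard_simplex 1"
        using that by auto
      have "singular_simplex 0 base (singular_face 1 j \<sigma>)"
        using singular_simplex_singular_face[OF True] that by simp
      then have "u (singular_face 1 j \<sigma>) = k (\<sigma> v)"
        using that by (auto simp: u_def singular_face_def simplical_face_vertex)
      also have "\<sigma> v = proj (\<rho> v)"
        using \<rho>(2) v by (auto simp: simplex_map_def)
      finally show ?thesis
        using k singular_simplex_in[OF \<rho>(1) v] by simp
    qed
    from this[of 0] this[of 1] show ?thesis
      using True sw_cochain_lift[OF h(1) \<rho>(1)] sw_cochain_lift[OF h(2) \<rho>(1)] \<rho>(2)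
      by (simp add: coboundary_def ac_simps)
  next
    case False
    then show ?thesis
      by (simp add: coboundary_def sw_cochain_def)
  qed
  then have "coboundary 0 base u = (\<lambda>\<sigma>. sw_cochain E \<tau> h \<sigma> + sw_cochain E \<tau> h' \<sigma>)"
    by (rule ext)
  moreover have "coboundary 0 base u \<in> coboundaries (Suc 0) base"
    by (rule coboundariesI) (simp add: u_def cochain_carrier_iff)
  ultimately show ?thesis
    by simp
qed

lemma sw_product_cocycle:
  assumes "\<And>n. odd_labelling E \<tau> (hs n)"
  shows "sw_product E \<tau> hs n \<in> cocycles n base"
proof (induction n)
  case 0
  show ?case
    unfolding cocycles_iff
  proof (intro conjI ext)
    fix \<sigma>
    have "singular_simplex 0 base (singular_face (Suc 0) k \<sigma>)"
      if "singular_simplex (Suc 0) base \<sigma>" "k \<le> Suc 0" for k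
      using singular_simplex_singular_face[OF that(1)] that by simp
    then show "coboundary 0 base (sw_product E \<tau> hs 0) \<sigma> = 0"
      by (simp add: coboundary_def)
  qed simp
next
  case (Suc n)
  then show ?case
    using cup_cochain_cocycle[OF Suc sw_cochain_cocycle[OF assms]] by simp
qed

text \<open>Each factor may be replaced by a cohomologous one, so the labellings of the factors can
  be adapted to the purpose at hand.\<close>

theorem cup_power_sw_class:
  assumes "\<And>n. odd_labelling E \<tau> (hs n)" "odd_labelling E \<tau> h"
  shows "cup_power base (cohomology_class 1 base (sw_cochain E \<tau> h)) n =
         cohomology_class n base (sw_product E \<tau> hs n)"
proof (induction n)
  case (Suc n)
  have "cohomology_class 1 base (sw_cochain E \<tau> h) = cohomology_class 1 base (sw_cochain E \<tau> (hs n))"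
    using sw_cochain_cohomologous assms by (simp add: cohomology_class_eq_iff)
  with Suc show ?case
    using cup_product_cohomology_class[OF sw_product_cocycle sw_cochain_cocycle] assms by simp
qed (simp add: unit_class_def)

text \<open>Splitting off back faces one by one, factor \<open>j\<close> is evaluated on the edge
  from vertex \<open>j\<close> to vertex \<open>Suc j\<close>.\<close>

lemma sw_product_lift:
  assumes h: "\<And>n. odd_labelling E \<tau> (hs n)" and \<rho>: "singular_simplex n E \<rho>"
  shows "sw_product E \<tau> hs n (simplex_map n proj \<rho>) =
         (\<Prod>j<n. hs j (\<rho> (simplex_vertex j)) + hs j (\<rho> (simplex_vertex (Suc j))))"
  using \<rho>
proof (induction n arbitrary: \<rho>)
  case 0
  then show ?case
    using singular_simplex_proj by simp
next
  case (Suc n)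
  have sub: "standard_simplex n \<subseteq> standard_simplex (Suc n)"
    by (simp add: standard_simplex_mono)
  have sing: "singular_simplex n E (front_face n \<rho>)" "singular_simplex 1 E (back_face n 1 \<rho>)"
    using Suc.prems singular_simplex_front_face[of n 1] singular_simplex_back_face[of n 1] by auto
  have front: "front_face n (simplex_map (Suc n) proj \<rho>) = simplex_map n proj (front_face n \<rho>)"
    using sub by (auto simp: front_face_def simplex_map_def fun_eq_iff)
  have back': "back_face n 1 (simplex_map (Suc n) proj \<rho>) = simplex_map 1 proj (back_face n 1 \<rho>)"
    unfolding back_face_def simplex_map_def
    using shift_in_standard_simplex[of _ 1 n] by (intro ext) (simp add: restrict_def)
  have fv: "front_face n \<rho> (simplex_vertex j) = \<rho> (simplex_vertex j)" if "j \<le> n" for j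
    using that by (simp add: front_face_def)
  have "(\<lambda>i. if i < n then 0 else simplex_vertex j (i - n)) = simplex_vertex (n + j)" for j
    by (auto simp: simplex_vertex_def fun_eq_iff)
  then have bv: "back_face n 1 \<rho> (simplex_vertex j) = \<rho> (simplex_vertex (n + j))" if "j \<le> 1" for j
    using that by (simp add: back_face_def)
  have "sw_product E \<tau> hs (Suc n) (simplex_map (Suc n) proj \<rho>) =
      sw_product E \<tau> hs n (simplex_map n proj (front_face n \<rho>)) *
      sw_cochain E \<tau> (hs n) (simplex_map 1 proj (back_face n 1 \<rho>))"
    using singular_simplex_proj[OF Suc.prems] front back' by (simp add: cup_cochain_def)
  also have "\<dots> = (\<Prod>j<n. hs j (\<rho> (simplex_vertex j)) + hs j (\<rho> (simplex_vertex (Suc j)))) *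
      (hs n (\<rho> (simplex_vertex n)) + hs n (\<rho> (simplex_vertex (Suc n))))"
    using Suc.IH[OF sing(1)] sw_cochain_lift[OF h sing(2), of n] fv bv by simp
  finally show ?case by simp
qed

text \<open>A single vanishing factor suffices, here the one on the edge from vertex
  \<open>i\<close> to vertex \<open>Suc i\<close>. This is the algebraic half of the
  Lusternik--Schnirelmann argument.\<close>

lemma sw_product_vanishing:
  assumes "singular_simplex n base \<sigma>" "\<sigma> ` standard_simplex n \<subseteq> U" "i < n"
    and U: "\<And>\<rho>. singular_simplex 1 base \<rho> \<Longrightarrow> \<rho> ` standard_simplex 1 \<subseteq> U \<Longrightarrow> sw_cochain E \<tau> (hs i) \<rho> = 0"
  shows "sw_product E \<tau> hs n \<sigma> = 0"
  using assms(1-3)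
proof (induction n arbitrary: \<sigma>)
  case (Suc n)
  have sing: "singular_simplex n base (front_face n \<sigma>)" "singular_simplex 1 base (back_face n 1 \<sigma>)"
    using Suc.prems singular_simplex_front_face[of n 1] singular_simplex_back_face[of n 1] by auto
  show ?case
  proof (cases "i = n")
    case True
    have "back_face n 1 \<sigma> ` standard_simplex 1 \<subseteq> U"
      using Suc.prems(2) shift_in_standard_simplex[of _ 1 n] by (auto simp: back_face_def)
    then show ?thesis
      using U[OF sing(2)] True by (simp add: cup_cochain_def)
  next
    case False
    have "standard_simplex n \<subseteq> standard_simplex (Suc n)"
      by (simp add: standard_simplex_mono)
    then have "front_face n \<sigma> ` standard_simplex n \<subseteq> U"
      using Suc.prems(2) by (auto simp: front_face_def)
    then show ?thesis
      using Suc.IH[OF sing(1)] Suc.prems(3) False by (simp add: cup_cochain_def)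
  qed
qed simp

end

text \<open>A lift of \<open>\<sigma>\<close> is carried by \<open>g\<close> to a lift of the image
  of \<open>\<sigma>\<close>, so naturality holds already for cochains if the labelling is pulled
  back as well.\<close>

lemma pullback_sw_cochain:
  assumes "double_cover E \<tau>" "double_cover E' \<tau>'"
    and g: "continuous_map E E' g" "\<And>e. e \<in> topspace E \<Longrightarrow> g (\<tau> e) = \<tau>' (g e)"
    and f: "\<And>e. e \<in> topspace E \<Longrightarrow> f (orbit2 \<tau> e) = orbit2 \<tau>' (g e)"
    and h: "odd_labelling E' \<tau>' h"
  shows "pullback_cochain 1 (orbit_space2 E \<tau>) f (sw_cochain E' \<tau>' h) = sw_cochain E \<tau> (h \<circ> g)"
proof
  fix \<sigma>
  interpret E: double_cover E \<tau> by fact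
  interpret E': double_cover E' \<tau>' by fact
  have hg: "odd_labelling E \<tau> (h \<circ> g)"
    using g h by (auto simp: odd_labelling_def continuous_map_def)
  show "pullback_cochain 1 E.base f (sw_cochain E' \<tau>' h) \<sigma> = sw_cochain E \<tau> (h \<circ> g) \<sigma>"
  proof (cases "singular_simplex 1 E.base \<sigma>")
    case True
    then obtain \<rho> where \<rho>: "singular_simplex 1 E \<rho>" "simplex_map 1 E.proj \<rho> = \<sigma>"
      using E.path_lift by blast
    have "f (\<sigma> x) = E'.proj (g (\<rho> x))" if "x \<in> standard_simplex 1" for x
      using that f singular_simplex_in[OF \<rho>(1) that] \<rho>(2) by (auto simp: simplex_map_def)
    then have "simplex_map 1 f \<sigma> = simplex_map 1 E'.proj (simplex_map 1 g \<rho>)"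
      by (auto simp: simplex_map_def fun_eq_iff)
    moreover have "singular_simplex 1 E' (simplex_map 1 g \<rho>)"
      using \<rho>(1) g(1) by (rule singular_simplex_simplex_map)
    ultimately show ?thesis
      using True E'.sw_cochain_lift[OF h] E.sw_cochain_lift[OF hg \<rho>(1)] \<rho>(2)
      by (simp add: pullback_cochain_def) (simp add: simplex_map_def)
  qed (simp add: pullback_cochain_def sw_cochain_def)
qed


section \<open>The infinite sphere\<close>

lemma in_nsphere_iff: "x \<in> topspace (nsphere n) \<longleftrightarrow> (\<Sum>i\<le>n. (x i)\<^sup>2) = 1 \<and> (\<forall>i>n. x i = 0)"
  by (auto simp: nsphere)

lemma nsphere_mono:
  assumes "x \<in> topspace (nsphere n)" "n \<le> m"
  shows "x \<in> topspace (nsphere m)"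
proof -
  have "(\<Sum>i\<le>n. (x i)\<^sup>2) = (\<Sum>i\<le>m. (x i)\<^sup>2)"
    by (rule sum.mono_neutral_left) (use assms in \<open>auto simp: in_nsphere_iff\<close>)
  then show ?thesis
    using assms by (auto simp: in_nsphere_iff)
qed

lemma simplex_vertex_in_nsphere: "n \<le> m \<Longrightarrow> simplex_vertex n \<in> topspace (nsphere m)"
proof (rule nsphere_mono[of _ n])
  have "(\<Sum>i\<le>n. (simplex_vertex n i)\<^sup>2) = (\<Sum>i\<in>{n}. (simplex_vertex n i)\<^sup>2)"
    by (rule sum.mono_neutral_right) (auto simp: simplex_vertex_def)
  then show "simplex_vertex n \<in> topspace (nsphere n)"
    by (auto simp: in_nsphere_iff simplex_vertex_def)
qed

lemma continuous_map_into_nsphere: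
  assumes "\<And>i. continuous_map X euclideanreal (\<lambda>x. f x i)"
    and "\<And>x. x \<in> topspace X \<Longrightarrow> f x \<in> topspace (nsphere n)"
  shows "continuous_map X (nsphere n) f"
  using assms
  by (auto simp: nsphere continuous_map_in_subtopology continuous_map_componentwise_UNIV)

lemma continuous_map_nsphere_infinite_sphere: "continuous_map (nsphere n) infinite_sphere (\<lambda>x. x)"
  unfolding continuous_map_def
proof (intro conjI allI impI)
  fix U assume "openin infinite_sphere U"
  then have "openin (nsphere n) (U \<inter> topspace (nsphere n))"
    by (simp add: openin_infinite_sphere)
  moreover have "{x \<in> topspace (nsphere n). x \<in> U} = U \<inter> topspace (nsphere n)"
    by auto
  ultimately show "openin (nsphere n) {x \<in> topspace (nsphere n). x \<in> U}"
    by simp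
qed (auto simp: topspace_infinite_sphere)

lemma continuous_map_nsphere_imp:
  "continuous_map X (nsphere n) f \<Longrightarrow> continuous_map X infinite_sphere f"
  using continuous_map_compose[OF _ continuous_map_nsphere_infinite_sphere] by (simp add: o_def)

lemma continuous_map_from_infinite_sphere:
  assumes "\<And>n. continuous_map (nsphere n) Y f"
  shows "continuous_map infinite_sphere Y f"
  unfolding continuous_map_def
proof (intro conjI allI impI)
  show "f \<in> topspace infinite_sphere \<rightarrow> topspace Y"
    using assms by (auto simp: topspace_infinite_sphere continuous_map_def)
  fix U assume U: "openin Y U"
  have "{x \<in> topspace infinite_sphere. f x \<in> U} \<inter> topspace (nsphere n) = {x \<in> topspace (nsphere n). f x \<in> U}" for n
    by (auto simp: topspace_infinite_sphere)
  moreover have "openin (nsphere n) {x \<in> topspace (nsphere n). f x \<in> U}" for n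
    using assms[of n] U by (simp add: continuous_map_def)
  ultimately show "openin infinite_sphere {x \<in> topspace infinite_sphere. f x \<in> U}"
    by (auto simp: openin_infinite_sphere topspace_infinite_sphere)
qed

text \<open>The weak topology is finer than that of the product, which makes the infinite sphere
  Hausdorff.\<close>

lemma continuous_map_infinite_sphere_coordinates:
  "continuous_map infinite_sphere (powertop_real UNIV) (\<lambda>x. x)"
  by (rule continuous_map_from_infinite_sphere)
    (simp add: continuous_map_componentwise_UNIV continuous_map_nsphere_projection)

lemma antipode_in_nsphere: "x \<in> topspace (nsphere n) \<Longrightarrow> antipode x \<in> topspace (nsphere n)"
  by (simp add: in_nsphere_iff antipode_def)

lemma double_cover_infinite_sphere: "double_cover infinite_sphere antipode"
proof
  have "Hausdorff_space (powertop_real UNIV)"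
    by (simp add: Hausdorff_space_product_topology)
  then show "Hausdorff_space infinite_sphere"
    by (rule Hausdorff_space_injective_preimage[OF _ continuous_map_infinite_sphere_coordinates]) simp
  have "continuous_map (nsphere n) (nsphere n) antipode" for n
  proof (rule continuous_map_into_nsphere)
    show "continuous_map (nsphere n) euclideanreal (\<lambda>x. antipode x i)" for i
      by (simp add: antipode_def continuous_map_nsphere_projection)
  qed (rule antipode_in_nsphere)
  then show "continuous_map infinite_sphere infinite_sphere antipode"
    by (intro continuous_map_from_infinite_sphere continuous_map_nsphere_imp)
  fix x assume "x \<in> topspace infinite_sphere"
  then obtain n where n: "x \<in> topspace (nsphere n)"
    by (auto simp: topspace_infinite_sphere)
  show "antipode (antipode x) = x"
    by (simp add: antipode_def)
  show "antipode x \<noteq> x"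
  proof
    assume "antipode x = x"
    then have "x i = 0" for i
      by (metis antipode_def add.inverse_inverse equal_neg_zero)
    with n show False
      by (simp add: in_nsphere_iff)
  qed
qed

interpretation infinite_sphere: double_cover infinite_sphere antipode
  by (rule double_cover_infinite_sphere)

text \<open>Otherwise points of \<open>K\<close> outside \<open>nsphere n\<close>, one for each
  \<open>n\<close>, form a sequence with finitely many terms in every sphere. Its tails are closed
  in the weak topology, and their complements are an open cover of \<open>K\<close> without a finite
  subcover.\<close>

lemma compactin_infinite_sphere:
  assumes K: "compactin infinite_sphere K"
  obtains n where "K \<subseteq> topspace (nsphere n)"
proof -
  have "\<exists>n. K \<subseteq> topspace (nsphere n)"
  proof (rule ccontr)
    assume "\<nexists>n. K \<subseteq> topspace (nsphere n)"
    then have "\<forall>n. \<exists>y. y \<in> K \<and> y \<notin> topspace (nsphere n)"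
      by blast
    then obtain x where x: "\<And>n. x n \<in> K" "\<And>n. x n \<notin> topspace (nsphere n)"
      by metis
    let ?U = "\<lambda>n. topspace infinite_sphere - x ` {n..}"
    have "openin infinite_sphere (?U n)" for n
      unfolding openin_infinite_sphere
    proof (intro conjI allI)
      fix m
      have "x ` {n..} \<inter> topspace (nsphere m) \<subseteq> x ` {..<m}"
      proof
        fix y assume "y \<in> x ` {n..} \<inter> topspace (nsphere m)"
        then obtain j where "y = x j" "x j \<in> topspace (nsphere m)"
          by blast
        with x(2)[of j] nsphere_mono[of "x j" m j] show "y \<in> x ` {..<m}"
          by (cases "j < m") auto
      qed
      then have "finite (x ` {n..} \<inter> topspace (nsphere m))"
        using finite_surj by blast
      then have "closedin (nsphere m) (x ` {n..} \<inter> topspace (nsphere m))"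
        using Hausdorff_Euclidean_space Hausdorff_imp_t1_space Hausdorff_space_subtopology
        unfolding nsphere_def by (metis inf_le2 t1_space_closedin_finite)
      moreover have "?U n \<inter> topspace (nsphere m) =
          topspace (nsphere m) - (x ` {n..} \<inter> topspace (nsphere m))"
        by (auto simp: topspace_infinite_sphere)
      ultimately show "openin (nsphere m) (?U n \<inter> topspace (nsphere m))"
        by (simp add: openin_diff)
    qed (auto simp: topspace_infinite_sphere)
    moreover have "K \<subseteq> (\<Union>n. ?U n)"
    proof
      fix y assume "y \<in> K"
      then have y: "y \<in> topspace infinite_sphere"
        using compactin_subset_topspace[OF K] by blast
      then obtain N where "y \<in> topspace (nsphere N)"
        by (auto simp: topspace_infinite_sphere)
      then have "y \<notin> x ` {N..}"
        using x(2) nsphere_mono[of y N] by auto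
      with y show "y \<in> (\<Union>n. ?U n)" by blast
    qed
    ultimately obtain \<F> where F: "finite \<F>" "\<F> \<subseteq> range ?U" "K \<subseteq> \<Union>\<F>"
      using K unfolding compactin_def by (metis (no_types, lifting) imageE)
    then obtain A where A: "finite A" "\<F> = ?U ` A"
      using finite_subset_image by metis
    define N where "N = Max (insert 0 A)"
    have "a \<le> N" if "a \<in> A" for a
      using A(1) that by (simp add: N_def)
    then have "x N \<notin> \<Union>\<F>"
      using A(2) by auto
    with F(3) x(1) show False by blast
  qed
  with that show ?thesis by blast
qed

lemma singular_simplex_infinite_sphere:
  assumes \<sigma>: "singular_simplex p infinite_sphere \<sigma>"
  obtains n where "singular_simplex p (nsphere n) \<sigma>"
proof -
  let ?S = "simplex_space p"
  have cont: "continuous_map ?S infinite_sphere \<sigma>"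
    using \<sigma> by (simp add: singular_simplex_def)
  have "compactin ?S (standard_simplex p)"
    using compactin_standard_simplex by (simp add: compactin_subtopology)
  then have "compactin infinite_sphere (\<sigma> ` standard_simplex p)"
    by (rule image_compactin[OF _ cont])
  then obtain n where n: "\<sigma> ` standard_simplex p \<subseteq> topspace (nsphere n)"
    using compactin_infinite_sphere by blast
  have "continuous_map ?S (powertop_real UNIV) \<sigma>"
    using continuous_map_compose[OF cont continuous_map_infinite_sphere_coordinates] by (simp add: o_def)
  then have "continuous_map ?S (nsphere n) \<sigma>"
    using n by (intro continuous_map_into_nsphere) (auto simp: continuous_map_componentwise_UNIV)
  then show ?thesis
    using \<sigma> that by (simp add: singular_simplex_def)
qed

lemma singular_simplex_nsphere_imp:
  "singular_simplex p (nsphere n) \<sigma> \<Longrightarrow> singular_simplex p infinite_sphere \<sigma>"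
  unfolding singular_simplex_def by (blast intro: continuous_map_nsphere_imp)

lemma singular_simplex_nsphere_mono:
  assumes "singular_simplex p (nsphere n) \<sigma>" "n \<le> m"
  shows "singular_simplex p (nsphere m) \<sigma>"
proof -
  have "continuous_map (nsphere n) (nsphere m) (\<lambda>x. x)"
    using nsphere_mono[OF _ assms(2)]
    by (intro continuous_map_into_nsphere continuous_map_nsphere_projection)
  then have "continuous_map (simplex_space p) (nsphere m) ((\<lambda>x. x) \<circ> \<sigma>)"
    using assms(1) unfolding singular_simplex_def by (intro continuous_map_compose) auto
  then show ?thesis
    using assms(1) by (simp add: singular_simplex_def o_def)
qed


section \<open>The first cohomology of the infinite projective space\<close>

text \<open>The square is cut along its diagonal, whose value occurs in the cocycle condition of
  both triangles and cancels.\<close>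

lemma cocycle_square:
  assumes c: "c \<in> cocycles 1 X" and H: "continuous_map (top_of_set unit_square) X H"
  shows "c (restrict (\<lambda>x. H (x 1, 0)) (standard_simplex 1)) + c (restrict (\<lambda>x. H (1, x 1)) (standard_simplex 1)) =
         c (restrict (\<lambda>x. H (0, x 1)) (standard_simplex 1)) + c (restrict (\<lambda>x. H (x 1, 1)) (standard_simplex 1))"
proof -
  let ?Q = "unit_square"
  have tri: "c (singular_face 2 0 \<tau>) + c (singular_face 2 1 \<tau>) + c (singular_face 2 2 \<tau>) = 0"
    if \<tau>: "\<tau> = restrict (\<lambda>x. H (a x)) (standard_simplex 2)"
      and a: "continuous_on UNIV a" "\<And>x. x \<in> standard_simplex 2 \<Longrightarrow> a x \<in> ?Q" for a \<tau>
  proof -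
    have "continuous_map (top_of_set (standard_simplex 2)) (top_of_set ?Q) a"
      using a continuous_on_subset[OF a(1)] by (force simp: continuous_map_in_subtopology)
    from continuous_map_compose[OF this H] have "singular_simplex (Suc 1) X \<tau>"
      by (simp add: singular_simplex_def \<tau> euclidean_product_topology o_def numeral_2_eq_2)
    then show ?thesis
      using c coboundary_simplex[of 1 X \<tau> c] unfolding cocycles_iff sum_atMost_Suc_1
      by (simp add: numeral_2_eq_2)
  qed
  have face: "singular_face 2 k (restrict (\<lambda>x. H (a x)) (standard_simplex 2)) =
      restrict (\<lambda>x. H (a (simplical_face k x))) (standard_simplex 1)" if "k \<le> 2" for a k
    using simplical_face_in_standard_simplex[of 2 k] that
    by (intro ext) (simp add: singular_face_def restrict_def)
  have cont: "continuous_on UNIV (\<lambda>x::nat \<Rightarrow> real. x i)" for i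
    by (rule continuous_on_product_coordinates)
  have s2: "x 0 + x 1 + x 2 = 1" "0 \<le> x i" if "x \<in> standard_simplex 2" for x i
    using that by (auto simp: standard_simplex_def numeral_2_eq_2)
  have s1: "x 0 + x 1 = 1" if "x \<in> standard_simplex 1" for x
    using that by (auto simp: standard_simplex_def)
  \<comment> \<open>Affine parametrizations of the triangles with vertices (0,0), (1,0), (1,1) and
    (0,0), (0,1), (1,1).\<close>
  let ?a = "\<lambda>x::nat \<Rightarrow> real. (x 1 + x 2, x 2)" and ?b = "\<lambda>x::nat \<Rightarrow> real. (x 2, x 1 + x 2)"
  have in_Q: "?a x \<in> ?Q" "?b x \<in> ?Q" if "x \<in> standard_simplex 2" for x
    using s2(1)[OF that] s2(2)[OF that, of 0] s2(2)[OF that, of 1] s2(2)[OF that, of 2] by auto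
  let ?d = "c (restrict (\<lambda>x. H (x 1, x 1)) (standard_simplex 1))"
  have "c (restrict (\<lambda>x. H (1, x 1)) (standard_simplex 1)) + ?d + c (restrict (\<lambda>x. H (x 1, 0)) (standard_simplex 1)) = 0"
    using tri[OF refl, of ?a] in_Q s1 unfolding face[OF order.refl] face[OF zero_le] face[OF one_le_numeral]
    by (simp add: continuous_on_Pair continuous_on_add cont simplical_face_def cong: restrict_cong)
  moreover have "c (restrict (\<lambda>x. H (x 1, 1)) (standard_simplex 1)) + ?d + c (restrict (\<lambda>x. H (0, x 1)) (standard_simplex 1)) = 0"
    using tri[OF refl, of ?b] in_Q s1 unfolding face[OF order.refl] face[OF zero_le] face[OF one_le_numeral]
    by (simp add: continuous_on_Pair continuous_on_add cont simplical_face_def cong: restrict_cong)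
  moreover have "x + y = z + w" if "y + d + x = 0" "w + d + z = 0" for x y z w d :: bit
    using that by (cases x; cases y; cases z; cases w; cases d) simp_all
  ultimately show ?thesis
    by blast
qed

text \<open>The constant 2-simplex has three equal faces, and 3 is 1 modulo 2.\<close>

lemma cocycle_constant:
  assumes c: "c \<in> cocycles 1 X" and x: "x \<in> topspace X"
  shows "c (restrict (\<lambda>_. x) (standard_simplex 1)) = 0"
proof -
  let ?\<sigma> = "restrict (\<lambda>_. x) (standard_simplex (Suc 1))"
  have \<sigma>: "singular_simplex (Suc 1) X ?\<sigma>"
    using x by (simp add: singular_simplex_def)
  have "singular_face (Suc 1) k ?\<sigma> = restrict (\<lambda>_. x) (standard_simplex 1)" if "k \<le> 2" for k
    using simplical_face_in_standard_simplex[of 2 k] that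
    by (intro ext) (simp add: singular_face_def restrict_def numeral_2_eq_2)
  then show ?thesis
    using c coboundary_simplex[OF \<sigma>, of c] unfolding cocycles_iff sum_atMost_Suc_1 by simp
qed

text \<open>The cone point is \<open>simplex_vertex (Suc N)\<close>, orthogonal to the sphere of dimension \<open>N\<close>.\<close>

definition sphere_cone :: "nat \<Rightarrow> (nat \<Rightarrow> real) \<Rightarrow> real \<Rightarrow> nat \<Rightarrow> real" where
  "sphere_cone N x s = (\<lambda>i. if i = Suc N then sin (pi / 2 * s) else cos (pi / 2 * s) * x i)"

lemma sphere_cone_in_nsphere:
  assumes "x \<in> topspace (nsphere N)"
  shows "sphere_cone N x s \<in> topspace (nsphere (Suc N))"
proof -
  have "(\<Sum>i\<le>Suc N. (sphere_cone N x s i)\<^sup>2) =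
      (\<Sum>i\<le>N. (cos (pi / 2 * s))\<^sup>2 * (x i)\<^sup>2) + (sin (pi / 2 * s))\<^sup>2"
    by (simp add: sphere_cone_def power_mult_distrib)
  also have "\<dots> = 1"
    using assms by (simp add: in_nsphere_iff flip: sum_distrib_left)
  finally show ?thesis
    using assms by (auto simp: in_nsphere_iff sphere_cone_def)
qed

lemma sphere_cone_ends:
  assumes "x \<in> topspace (nsphere N)"
  shows "sphere_cone N x 0 = x" "sphere_cone N x 1 = simplex_vertex (Suc N)"
  using assms by (auto simp: sphere_cone_def in_nsphere_iff simplex_vertex_def fun_eq_iff)

definition cone_path :: "nat \<Rightarrow> (nat \<Rightarrow> real) \<Rightarrow> (nat \<Rightarrow> real) \<Rightarrow> nat \<Rightarrow> real" where
  "cone_path N x = restrict (\<lambda>y. sphere_cone N x (y 1)) (standard_simplex 1)"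

lemma singular_simplex_cone_path:
  assumes "x \<in> topspace (nsphere N)"
  shows "singular_simplex 1 (nsphere (Suc N)) (cone_path N x)"
proof -
  have coord: "continuous_on UNIV (\<lambda>y::nat \<Rightarrow> real. y 1)"
    by (rule continuous_on_product_coordinates)
  have "continuous_on UNIV (\<lambda>y::nat \<Rightarrow> real. sin (pi / 2 * y 1))"
    "continuous_on UNIV (\<lambda>y::nat \<Rightarrow> real. cos (pi / 2 * y 1) * x i)" for i
    by (intro continuous_intros coord)+
  then have "continuous_on UNIV (\<lambda>y::nat \<Rightarrow> real. sphere_cone N x (y 1) i)" for i
    by (cases "i = Suc N") (simp_all add: sphere_cone_def)
  then have "continuous_on (standard_simplex 1) (\<lambda>y. sphere_cone N x (y 1) i)" for i
    by (rule continuous_on_subset) simp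
  then have "continuous_map (simplex_space 1) euclideanreal
      (\<lambda>y. sphere_cone N x (y 1) i)" for i
    by (simp add: euclidean_product_topology)
  then have "continuous_map (simplex_space 1) (nsphere (Suc N))
      (\<lambda>y. sphere_cone N x (y 1))"
    using assms by (intro continuous_map_into_nsphere sphere_cone_in_nsphere)
  then show ?thesis
    by (simp add: singular_simplex_def cone_path_def)
qed

lemma cone_path_ends:
  assumes "x \<in> topspace (nsphere N)"
  shows "cone_path N x (simplex_vertex 0) = x" "cone_path N x (simplex_vertex 1) = simplex_vertex (Suc N)"
proof -
  have "simplex_vertex 0 \<in> standard_simplex 1" "simplex_vertex 1 \<in> standard_simplex 1"
    by simp_all
  then show "cone_path N x (simplex_vertex 0) = x" "cone_path N x (simplex_vertex 1) = simplex_vertex (Suc N)"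
    using sphere_cone_ends[OF assms] unfolding cone_path_def by (simp_all add: simplex_vertex_def)
qed

text \<open>Coning off \<open>\<sigma>\<close> gives a square whose sides are
  \<open>\<sigma>\<close>, the cone paths of its two ends and a constant path at the cone
  point.\<close>

lemma cocycle_cone_path:
  assumes c: "c \<in> cocycles 1 infinite_sphere" and \<sigma>: "singular_simplex 1 (nsphere N) \<sigma>"
  shows "c \<sigma> = c (cone_path N (\<sigma> (simplex_vertex 0))) + c (cone_path N (\<sigma> (simplex_vertex 1)))"
proof -
  let ?Q = "unit_square"
  define seg where "seg t = (\<lambda>i. if i = 0 then 1 - t else if i = Suc 0 then t else 0)" for t :: real
  have seg: "seg t \<in> standard_simplex 1" if "t \<in> {0..1}" for t
    using that unfolding One_nat_def standard_simplex_1_iff seg_def by blast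
  define H where "H z = sphere_cone N (\<sigma> (seg (snd z))) (fst z)" for z
  have "continuous_on ?Q (\<lambda>z. seg (snd z) i)" for i
    by (cases "i = 0"; cases "i = Suc 0") (auto simp: seg_def intro!: continuous_intros)
  then have seg_cont: "continuous_map (top_of_set ?Q) (simplex_space 1) (\<lambda>z. seg (snd z))"
    using seg by (auto simp: continuous_map_in_subtopology continuous_map_componentwise_UNIV)
  have "continuous_map (top_of_set ?Q) (nsphere N) (\<sigma> \<circ> (\<lambda>z. seg (snd z)))"
    using \<sigma> unfolding singular_simplex_def by (intro continuous_map_compose[OF seg_cont]) blast
  from continuous_map_compose[OF this continuous_map_nsphere_projection]
  have \<sigma>_cont: "continuous_map (top_of_set ?Q) euclideanreal (\<lambda>z. \<sigma> (seg (snd z)) i)" for i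
    by (simp add: o_def)
  have "continuous_map (top_of_set ?Q) (nsphere (Suc N)) H"
  proof (rule continuous_map_into_nsphere)
    fix i
    show "continuous_map (top_of_set ?Q) euclideanreal (\<lambda>z. H z i)"
      unfolding H_def sphere_cone_def using \<sigma>_cont[of i]
      by (cases "i = Suc N") (auto intro!: continuous_intros)
  next
    fix z assume "z \<in> topspace (top_of_set ?Q)"
    then have "\<sigma> (seg (snd z)) \<in> topspace (nsphere N)"
      using singular_simplex_in[OF \<sigma>] seg by auto
    then show "H z \<in> topspace (nsphere (Suc N))"
      unfolding H_def by (rule sphere_cone_in_nsphere)
  qed
  then have H: "continuous_map (top_of_set ?Q) infinite_sphere H"
    by (rule continuous_map_nsphere_imp)
  have vert: "seg 0 = simplex_vertex 0" "seg 1 = simplex_vertex 1"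
    by (auto simp: seg_def simplex_vertex_def fun_eq_iff)
  have in_N: "\<sigma> y \<in> topspace (nsphere N)" if "y \<in> standard_simplex 1" for y
    using singular_simplex_in[OF \<sigma> that] .
  have "restrict (\<lambda>x. H (0, x 1)) (standard_simplex 1) = restrict \<sigma> (standard_simplex 1)"
  proof (rule restrict_ext)
    fix x assume x: "x \<in> standard_simplex 1"
    then have "seg (x 1) = x"
      unfolding One_nat_def standard_simplex_1_iff by (auto simp: seg_def)
    then show "H (0, x 1) = \<sigma> x"
      using sphere_cone_ends(1)[OF in_N[OF x]] by (simp add: H_def)
  qed
  also have "\<dots> = \<sigma>"
    using \<sigma> by (simp add: singular_simplex_def extensional_restrict)
  finally have 1: "restrict (\<lambda>x. H (0, x 1)) (standard_simplex 1) = \<sigma>" .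
  have "restrict (\<lambda>x. H (1, x 1)) (standard_simplex 1) = restrict (\<lambda>_. simplex_vertex (Suc N)) (standard_simplex 1)"
  proof (rule restrict_ext)
    fix x assume x: "x \<in> standard_simplex 1"
    then have "seg (x 1) = x"
      unfolding One_nat_def standard_simplex_1_iff by (auto simp: seg_def)
    then show "H (1, x 1) = simplex_vertex (Suc N)"
      using sphere_cone_ends(2)[OF in_N[OF x]] by (simp add: H_def)
  qed
  moreover have "simplex_vertex (Suc N) \<in> topspace infinite_sphere"
    using simplex_vertex_in_nsphere by (auto simp: topspace_infinite_sphere)
  ultimately have 2: "c (restrict (\<lambda>x. H (1, x 1)) (standard_simplex 1)) = 0"
    using cocycle_constant[OF c] by simp
  have 3: "restrict (\<lambda>x. H (x 1, 0)) (standard_simplex 1) = cone_path N (\<sigma> (simplex_vertex 0))"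
    "restrict (\<lambda>x. H (x 1, 1)) (standard_simplex 1) = cone_path N (\<sigma> (simplex_vertex 1))"
    by (simp_all add: H_def cone_path_def vert)
  have "a = b + d" if "b + 0 = a + d" for a b d :: bit
    using that by (cases a; cases b; cases d) simp_all
  then show ?thesis
    using cocycle_square[OF c H] unfolding 1 2 3 .
qed

text \<open>The first cohomology of the infinite sphere vanishes: a primitive of \<open>c\<close> is
  its value on cone paths.\<close>

lemma cocycle_infinite_sphere:
  assumes c: "c \<in> cocycles 1 infinite_sphere"
  obtains h where "\<And>\<sigma>. singular_simplex 1 infinite_sphere \<sigma> \<Longrightarrow>
    c \<sigma> = h (\<sigma> (simplex_vertex 0)) + h (\<sigma> (simplex_vertex 1))"
proof -
  \<comment> \<open>Passing to another cone point changes the value on cone paths by a constant.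
    Normalizing at \<open>simplex_vertex 0\<close>, which lies in all spheres, makes
    \<open>k N x\<close> independent of \<open>N\<close>.\<close>
  define k where "k N x = c (cone_path N x) + c (cone_path N (simplex_vertex 0))" for N x
  have k_less: "k N x = k M x" if "x \<in> topspace (nsphere N)" "N < M" for x N M
  proof -
    have "c (cone_path N y) = c (cone_path M y) + c (cone_path M (simplex_vertex (Suc N)))"
      if y: "y \<in> topspace (nsphere N)" for y
    proof -
      have "singular_simplex 1 (nsphere M) (cone_path N y)"
        using singular_simplex_nsphere_mono[OF singular_simplex_cone_path[OF y]] \<open>N < M\<close> by simp
      from cocycle_cone_path[OF c this] show ?thesis
        unfolding cone_path_ends[OF y] .
    qed
    from this[OF that(1)] this[OF simplex_vertex_in_nsphere[of 0 N]] show ?thesis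
      by (simp add: k_def ac_simps)
  qed
  define h where "h x = k (LEAST N. x \<in> topspace (nsphere N)) x" for x
  have h: "h x = k N x" if x: "x \<in> topspace (nsphere N)" for x N
  proof -
    let ?L = "LEAST N. x \<in> topspace (nsphere N)"
    have L: "x \<in> topspace (nsphere ?L)"
      using x by (rule LeastI)
    have "k ?L x = k (Suc (?L + N)) x" "k N x = k (Suc (?L + N)) x"
      using k_less[OF L] k_less[OF x] by simp_all
    then show ?thesis
      by (simp add: h_def)
  qed
  show ?thesis
  proof
    fix \<sigma> assume "singular_simplex 1 infinite_sphere \<sigma>"
    then obtain N where N: "singular_simplex 1 (nsphere N) \<sigma>"
      using singular_simplex_infinite_sphere by blast
    then have "\<sigma> (simplex_vertex j) \<in> topspace (nsphere N)" if "j \<le> 1" for j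
      using singular_simplex_in[OF N] that by simp
    then have "h (\<sigma> (simplex_vertex j)) = k N (\<sigma> (simplex_vertex j))" if "j \<le> 1" for j
      using h that by simp
    moreover have "a + b = (a + z) + (b + z)" for a b z :: bit
      by (cases a; cases b; cases z) simp_all
    ultimately show "c \<sigma> = h (\<sigma> (simplex_vertex 0)) + h (\<sigma> (simplex_vertex 1))"
      unfolding cocycle_cone_path[OF c N] k_def by simp
  qed
qed

text \<open>Two points lie in a common finite sphere and are joined through its cone point.\<close>

lemma path_invariant_constant:
  assumes k: "\<And>\<sigma>. singular_simplex 1 infinite_sphere \<sigma> \<Longrightarrow>
      k (\<sigma> (simplex_vertex 0)) = k (\<sigma> (simplex_vertex 1))"
    and x: "x \<in> topspace infinite_sphere" and y: "y \<in> topspace infinite_sphere"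
  shows "k x = k y"
proof -
  obtain n m where "x \<in> topspace (nsphere n)" "y \<in> topspace (nsphere m)"
    using x y by (auto simp: topspace_infinite_sphere)
  then have N: "x \<in> topspace (nsphere (max n m))" "y \<in> topspace (nsphere (max n m))"
    using nsphere_mono by (meson max.cobounded1 max.cobounded2)+
  have "k z = k (simplex_vertex (Suc (max n m)))" if z: "z \<in> topspace (nsphere (max n m))" for z
    using k[OF singular_simplex_nsphere_imp[OF singular_simplex_cone_path[OF z]]]
    unfolding cone_path_ends[OF z] .
  with N show ?thesis by metis
qed


section \<open>Pullbacks of cochains and of cohomology classes\<close>

lemma coboundary_pullback_cochain:
  assumes f: "continuous_map X Y f"
  shows "coboundary p X (pullback_cochain p X f \<phi>) = pullback_cochain (Suc p) X f (coboundary p Y \<phi>)"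
proof
  fix \<sigma>
  show "coboundary p X (pullback_cochain p X f \<phi>) \<sigma> = pullback_cochain (Suc p) X f (coboundary p Y \<phi>) \<sigma>"
  proof (cases "singular_simplex (Suc p) X \<sigma>")
    case True
    have "pullback_cochain p X f \<phi> (singular_face (Suc p) k \<sigma>) =
        \<phi> (singular_face (Suc p) k (simplex_map (Suc p) f \<sigma>))" if k: "k \<le> Suc p" for k
    proof -
      have "singular_simplex p X (singular_face (Suc p) k \<sigma>)"
        using singular_simplex_singular_face[OF True _ k] by simp
      moreover have "simplex_map p f (singular_face (Suc p) k \<sigma>) =
          singular_face (Suc p) k (simplex_map (Suc p) f \<sigma>)"
        using k simplical_face_in_standard_simplex[of "Suc p" k]
        by (intro ext) (simp add: simplex_map_def singular_face_def restrict_def)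
      ultimately show ?thesis
        by (simp add: pullback_cochain_def)
    qed
    then show ?thesis
      using True singular_simplex_simplex_map[OF True f]
      by (simp add: coboundary_def pullback_cochain_def del: sum.atMost_Suc)
  qed (simp add: coboundary_def pullback_cochain_def)
qed

lemma pullback_cochain_cocycle:
  assumes "continuous_map X Y f" "\<phi> \<in> cocycles p Y"
  shows "pullback_cochain p X f \<phi> \<in> cocycles p X"
  using assms(2) unfolding cocycles_iff coboundary_pullback_cochain[OF assms(1)]
  by (auto simp: pullback_cochain_def)

lemma pullback_cochain_coboundary:
  assumes "continuous_map X Y f" "\<phi> \<in> coboundaries p Y"
  shows "pullback_cochain p X f \<phi> \<in> coboundaries p X"
proof (cases p)
  case 0
  with assms(2) show ?thesis
    by (simp add: coboundaries_def pullback_cochain_def)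
next
  case (Suc q)
  with assms(2) obtain a where "\<phi> = coboundary q Y a"
    by (auto simp: coboundaries_def)
  then have "pullback_cochain p X f \<phi> = coboundary q X (pullback_cochain q X f a)"
    using Suc by (simp add: coboundary_pullback_cochain[OF assms(1)])
  moreover have "pullback_cochain q X f a \<in> carrier (cochain_group q X)"
    by (simp add: cochain_carrier_iff pullback_cochain_def)
  ultimately show ?thesis
    using Suc coboundariesI by metis
qed

lemma pullback_cochain_add:
  "pullback_cochain p X f (\<lambda>\<sigma>. \<phi> \<sigma> + \<psi> \<sigma>) =
     (\<lambda>\<sigma>. pullback_cochain p X f \<phi> \<sigma> + pullback_cochain p X f \<psi> \<sigma>)"
  by (auto simp: pullback_cochain_def)

lemma cohomology_pullback_class:
  assumes f: "continuous_map X Y f" and \<phi>: "\<phi> \<in> cocycles p Y"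
  shows "cohomology_pullback p X f (cohomology_class p Y \<phi>) =
         cohomology_class p X (pullback_cochain p X f \<phi>)"
proof -
  have "cohomology_class p X (pullback_cochain p X f \<phi>') = cohomology_class p X (pullback_cochain p X f \<phi>)"
    if "\<phi>' \<in> cohomology_class p Y \<phi>" for \<phi>'
  proof -
    have "(\<lambda>\<sigma>. \<phi>' \<sigma> + \<phi> \<sigma>) \<in> coboundaries p Y"
      using cocycles_cohomology_class(2)[OF \<phi> that] by (simp add: cohomology_class_eq_iff)
    from pullback_cochain_coboundary[OF f this] show ?thesis
      by (simp add: cohomology_class_eq_iff pullback_cochain_add)
  qed
  moreover have "cohomology_class p Y \<phi> \<noteq> {}"
    using cohomology_class_self by blast
  ultimately show ?thesis
    unfolding cohomology_pullback_def by (simp cong: SUP_cong)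
qed

text \<open>A section chosen without continuity: label 0 on its values, 1 on the other points of the
  fibres.\<close>

lemma (in double_cover) odd_labelling_exists: obtains h where "odd_labelling E \<tau> h"
proof -
  define s where "s b = (SOME e. e \<in> topspace E \<and> proj e = b)" for b
  define h :: "'e \<Rightarrow> bit" where "h e = (if e = s (proj e) then 0 else 1)" for e
  have "h (\<tau> e) = h e + 1" if e: "e \<in> topspace E" for e
  proof -
    have "s (proj e) \<in> topspace E \<and> proj (s (proj e)) = proj e"
      unfolding s_def by (rule someI[of _ e]) (use e in simp)
    then have "s (proj e) = e \<or> s (proj e) = \<tau> e"
      using proj_eq_iff e by metis
    then show ?thesis
      using e free[OF e] by (auto simp: h_def)
  qed
  then have "odd_labelling E \<tau> h"
    by (simp add: odd_labelling_def)
  then show ?thesis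
    by (rule that)
qed

text \<open>With a primitive \<open>u\<close>, the sum of \<open>h\<close> and the lift of
  \<open>u\<close> would be constant along paths, hence on the sphere; but at antipodal points the
  lift of \<open>u\<close> agrees and \<open>h\<close> does not.\<close>

lemma projective_sw_cochain_not_coboundary:
  assumes h: "odd_labelling infinite_sphere antipode h"
  shows "sw_cochain infinite_sphere antipode h \<notin> coboundaries 1 infinite_projective_space"
proof
  assume "sw_cochain infinite_sphere antipode h \<in> coboundaries 1 infinite_projective_space"
  then obtain u where u: "sw_cochain infinite_sphere antipode h = coboundary 0 infinite_projective_space u"
    by (auto simp: coboundaries_def)
  define U where "U b = u (restrict (\<lambda>_. b) (standard_simplex 0))" for b
  let ?p = "orbit2 antipode"
  have inv: "h (\<sigma> (simplex_vertex 0)) + U (?p (\<sigma> (simplex_vertex 0))) =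
      h (\<sigma> (simplex_vertex 1)) + U (?p (\<sigma> (simplex_vertex 1)))"
    if \<sigma>: "singular_simplex 1 infinite_sphere \<sigma>" for \<sigma>
  proof -
    have face: "singular_face 1 k (simplex_map 1 ?p \<sigma>) =
        restrict (\<lambda>_. ?p (\<sigma> (simplex_vertex (if k = 0 then 1 else 0)))) (standard_simplex 0)" if "k \<le> 1" for k
    proof -
      have eq: "simplical_face k x = simplex_vertex (if k = 0 then 1 else 0)" if x: "x \<in> standard_simplex 0" for x
      proof -
        have "x = simplex_vertex 0"
          using x by (simp add: standard_simplex_0 simplex_vertex_def)
        then show ?thesis
          using \<open>k \<le> 1\<close> by (simp add: simplical_face_vertex)
      qed
      have "simplex_vertex (if k = 0 then 1 else 0) \<in> standard_simplex 1"
        by simp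
      then show ?thesis
        by (intro ext) (simp add: singular_face_def simplex_map_def restrict_def eq)
    qed
    have "h (\<sigma> (simplex_vertex 0)) + h (\<sigma> (simplex_vertex 1)) =
        coboundary 0 infinite_projective_space u (simplex_map 1 ?p \<sigma>)"
      using infinite_sphere.sw_cochain_lift[OF h \<sigma>] u by simp
    also have "\<dots> = u (singular_face 1 0 (simplex_map 1 ?p \<sigma>)) + u (singular_face 1 1 (simplex_map 1 ?p \<sigma>))"
      using infinite_sphere.singular_simplex_proj[OF \<sigma>]
      by (simp add: coboundary_def infinite_projective_space_def)
    also have "\<dots> = U (?p (\<sigma> (simplex_vertex 1))) + U (?p (\<sigma> (simplex_vertex 0)))"
      unfolding face[OF zero_le] face[OF order.refl] by (simp add: U_def)
    finally have *: "h (\<sigma> (simplex_vertex 0)) + h (\<sigma> (simplex_vertex 1)) =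
        U (?p (\<sigma> (simplex_vertex 1))) + U (?p (\<sigma> (simplex_vertex 0)))" .
    have "a + d = b + c" if "a + b = c + d" for a b c d :: bit
      using that by (cases a; cases b; cases c; cases d) simp_all
    from this[OF *] show ?thesis .
  qed
  have v: "simplex_vertex 0 \<in> topspace infinite_sphere"
    using simplex_vertex_in_nsphere by (auto simp: topspace_infinite_sphere)
  have "h (simplex_vertex 0) + U (?p (simplex_vertex 0)) =
      h (antipode (simplex_vertex 0)) + U (?p (antipode (simplex_vertex 0)))"
    by (rule path_invariant_constant[of "\<lambda>x. h x + U (?p x)", OF inv])
      (use v infinite_sphere.involution_in in auto)
  then show False
    using h v infinite_sphere.proj_involution[OF v]
    by (cases "h (simplex_vertex 0)"; cases "U (?p (simplex_vertex 0))")
      (simp_all add: odd_labelling_def)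
qed

text \<open>The pullback of \<open>c\<close> to the sphere has a primitive \<open>g\<close>, which
  the antipode changes by a constant. If the constant is 0, then \<open>h + g\<close> is odd like
  \<open>h\<close>, and \<open>c\<close> is the sum of their cochains; if it is 1, then
  \<open>g\<close> itself is an odd labelling and \<open>c\<close> is its cochain.\<close>

lemma projective_cocycle_cases:
  assumes h: "odd_labelling infinite_sphere antipode h"
    and c: "c \<in> cocycles 1 infinite_projective_space"
  shows "c \<in> coboundaries 1 infinite_projective_space \<or>
         (\<lambda>\<sigma>. c \<sigma> + sw_cochain infinite_sphere antipode h \<sigma>) \<in> coboundaries 1 infinite_projective_space"
proof -
  let ?p = "orbit2 antipode" and ?sw = "sw_cochain infinite_sphere antipode"
  have RP: "infinite_projective_space = infinite_sphere.base"
    by (simp add: infinite_projective_space_def)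
  obtain g where "\<And>\<sigma>. singular_simplex 1 infinite_sphere \<sigma> \<Longrightarrow>
      pullback_cochain 1 infinite_sphere ?p c \<sigma> = g (\<sigma> (simplex_vertex 0)) + g (\<sigma> (simplex_vertex 1))"
    using cocycle_infinite_sphere[OF pullback_cochain_cocycle[OF infinite_sphere.continuous_map_proj]]
      c RP by metis
  then have g: "c (simplex_map 1 ?p \<sigma>) = g (\<sigma> (simplex_vertex 0)) + g (\<sigma> (simplex_vertex 1))"
    if "singular_simplex 1 infinite_sphere \<sigma>" for \<sigma>
    using that by (simp add: pullback_cochain_def)
  have c_eqI: "c = d" if "d \<in> cocycles 1 infinite_projective_space"
    "\<And>\<rho>. singular_simplex 1 infinite_sphere \<rho> \<Longrightarrow> d (simplex_map 1 ?p \<rho>) = c (simplex_map 1 ?p \<rho>)" for d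
  proof
    fix \<sigma>
    show "c \<sigma> = d \<sigma>"
    proof (cases "singular_simplex 1 infinite_sphere.base \<sigma>")
      case True
      then obtain \<rho> where "singular_simplex 1 infinite_sphere \<rho>" "simplex_map 1 ?p \<rho> = \<sigma>"
        using infinite_sphere.path_lift by blast
      with that(2) show ?thesis by metis
    next
      case False
      with c that(1) show ?thesis
        by (simp add: cocycles_iff RP)
    qed
  qed
  define k where "k x = g (antipode x) + g x" for x
  have k_inv: "k (\<sigma> (simplex_vertex 0)) = k (\<sigma> (simplex_vertex 1))"
    if \<sigma>: "singular_simplex 1 infinite_sphere \<sigma>" for \<sigma>
  proof -
    let ?\<sigma>' = "simplex_map 1 antipode \<sigma>"
    have \<sigma>': "singular_simplex 1 infinite_sphere ?\<sigma>'"
      using \<sigma> infinite_sphere.continuous_involution by (rule singular_simplex_simplex_map)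
    have "?p (antipode (\<sigma> x)) = ?p (\<sigma> x)" if "x \<in> standard_simplex 1" for x
      using singular_simplex_in[OF \<sigma> that] by simp
    then have "simplex_map 1 ?p ?\<sigma>' = simplex_map 1 ?p \<sigma>"
      by (intro ext) (simp add: simplex_map_def restrict_def)
    moreover have "?\<sigma>' (simplex_vertex j) = antipode (\<sigma> (simplex_vertex j))" if "j \<le> 1" for j
      using that by (simp add: simplex_map_def)
    ultimately have *: "g (\<sigma> (simplex_vertex 0)) + g (\<sigma> (simplex_vertex 1)) =
        g (antipode (\<sigma> (simplex_vertex 0))) + g (antipode (\<sigma> (simplex_vertex 1)))"
      using g[OF \<sigma>] g[OF \<sigma>'] by simp
    have "a' + a = b' + b" if "a + b = a' + b'" for a a' b b' :: bit
      using that by (cases a; cases b; cases a'; cases b') simp_all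
    from this[OF *] show ?thesis
      unfolding k_def .
  qed
  have v: "simplex_vertex 0 \<in> topspace infinite_sphere"
    using simplex_vertex_in_nsphere by (auto simp: topspace_infinite_sphere)
  have k: "k x = k (simplex_vertex 0)" if "x \<in> topspace infinite_sphere" for x
    by (rule path_invariant_constant[of k, OF k_inv that v])
  show ?thesis
  proof (cases "k (simplex_vertex 0) = 0")
    case True
    have "odd_labelling infinite_sphere antipode (\<lambda>x. h x + g x)"
      unfolding odd_labelling_def
    proof
      fix x assume x: "x \<in> topspace infinite_sphere"
      have "g (antipode x) = g x"
        using k[OF x] True by (cases "g x"; cases "g (antipode x)") (simp_all add: k_def)
      then show "h (antipode x) + g (antipode x) = h x + g x + 1"
        using h x by (simp add: odd_labelling_def ac_simps)
    qed
    note hg = this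
    have "c = (\<lambda>\<sigma>. ?sw h \<sigma> + ?sw (\<lambda>x. h x + g x) \<sigma>)"
    proof (rule c_eqI)
      show "(\<lambda>\<sigma>. ?sw h \<sigma> + ?sw (\<lambda>x. h x + g x) \<sigma>) \<in> cocycles 1 infinite_projective_space"
        unfolding RP using infinite_sphere.sw_cochain_cocycle[OF h] infinite_sphere.sw_cochain_cocycle[OF hg]
        by (rule cocycles_add)
      fix \<rho> assume \<rho>: "singular_simplex 1 infinite_sphere \<rho>"
      have "(a + b) + ((a + c) + (b + d)) = c + d" for a b c d :: bit
        by (cases a; cases b; cases c; cases d) simp_all
      then show "?sw h (simplex_map 1 ?p \<rho>) + ?sw (\<lambda>x. h x + g x) (simplex_map 1 ?p \<rho>) = c (simplex_map 1 ?p \<rho>)"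
        unfolding g[OF \<rho>] infinite_sphere.sw_cochain_lift[OF h \<rho>] infinite_sphere.sw_cochain_lift[OF hg \<rho>] .
    qed
    then have "c \<in> coboundaries 1 infinite_projective_space"
      using infinite_sphere.sw_cochain_cohomologous[OF h hg] by (simp add: RP)
    then show ?thesis ..
  next
    case False
    have og: "odd_labelling infinite_sphere antipode g"
      unfolding odd_labelling_def
    proof
      fix x assume x: "x \<in> topspace infinite_sphere"
      show "g (antipode x) = g x + 1"
        using k[OF x] False by (cases "g x"; cases "g (antipode x)") (simp_all add: k_def)
    qed
    have "c = ?sw g"
      using infinite_sphere.sw_cochain_cocycle[OF og] infinite_sphere.sw_cochain_lift[OF og] g
      by (intro c_eqI) (simp_all add: RP)
    then show ?thesis
      using infinite_sphere.sw_cochain_cohomologous[OF og h] by (simp add: RP)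
  qed
qed

text \<open>The group consists of the identity and the class of the cochain, which are different; a
  group of order 2 has one generator.\<close>

lemma projective_cohomology_generator_iff:
  assumes h: "odd_labelling infinite_sphere antipode h"
  shows "\<gamma> \<in> carrier (cohomology_group 1 infinite_projective_space) \<and>
      generate (cohomology_group 1 infinite_projective_space) {\<gamma>} =
        carrier (cohomology_group 1 infinite_projective_space) \<longleftrightarrow>
      \<gamma> = cohomology_class 1 infinite_projective_space (sw_cochain infinite_sphere antipode h)"
proof -
  let ?G = "cohomology_group 1 infinite_projective_space"
  let ?w = "cohomology_class 1 infinite_projective_space (sw_cochain infinite_sphere antipode h)"
  interpret comm_group ?G by (rule comm_group_cohomology_group)
  have "sw_cochain infinite_sphere antipode h \<in> cocycles 1 infinite_projective_space"
    using infinite_sphere.sw_cochain_cocycle[OF h] by (simp add: infinite_projective_space_def)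
  then have w: "?w \<in> carrier ?G"
    by (simp add: carrier_cohomology_group)
  have w1: "?w \<noteq> \<one>\<^bsub>?G\<^esub>"
    using projective_sw_cochain_not_coboundary[OF h] by (simp add: cohomology_class_eq_one_iff)
  have G: "x = \<one>\<^bsub>?G\<^esub> \<or> x = ?w" if "x \<in> carrier ?G" for x
  proof -
    obtain c where c: "c \<in> cocycles 1 infinite_projective_space" "x = cohomology_class 1 infinite_projective_space c"
      using \<open>x \<in> carrier ?G\<close> by (auto simp: carrier_cohomology_group)
    then show ?thesis
      using projective_cocycle_cases[OF h c(1)] by (simp add: cohomology_class_eq_one_iff cohomology_class_eq_iff)
  qed
  show ?thesis
  proof
    assume \<gamma>: "\<gamma> \<in> carrier ?G \<and> generate ?G {\<gamma>} = carrier ?G"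
    have "\<gamma> \<noteq> \<one>\<^bsub>?G\<^esub>"
    proof
      assume "\<gamma> = \<one>\<^bsub>?G\<^esub>"
      then have "carrier ?G = {\<one>\<^bsub>?G\<^esub>}"
        using \<gamma> generate_one by simp
      with w w1 show False by blast
    qed
    with \<gamma> G show "\<gamma> = ?w" by blast
  next
    assume \<gamma>: "\<gamma> = ?w"
    have "generate ?G {\<gamma>} \<subseteq> carrier ?G"
      using w \<gamma> by (intro generate_incl) simp
    moreover have "carrier ?G \<subseteq> generate ?G {\<gamma>}"
    proof
      fix x assume "x \<in> carrier ?G"
      then consider "x = \<one>\<^bsub>?G\<^esub>" | "x = \<gamma>"
        using G \<gamma> by blast
      then show "x \<in> generate ?G {\<gamma>}"
        by cases (auto intro: generate.one generate.incl)
    qed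
    ultimately show "\<gamma> \<in> carrier ?G \<and> generate ?G {\<gamma>} = carrier ?G"
      using w \<gamma> by blast
  qed
qed


section \<open>The first Stiefel--Whitney class of a double cover\<close>

context double_cover
begin

text \<open>If \<open>g\<close> covers the classifying map, then \<open>k \<circ> g\<close> is an
  odd labelling of \<open>E\<close>, and all odd labellings give the same class.\<close>

lemma classifying_map_pullback:
  assumes "classifying_map E \<tau> base proj f" and k: "odd_labelling infinite_sphere antipode k"
    and h: "odd_labelling E \<tau> h"
  shows "cohomology_pullback 1 base f
      (cohomology_class 1 infinite_projective_space (sw_cochain infinite_sphere antipode k)) =
    cohomology_class 1 base (sw_cochain E \<tau> h)"
proof -
  obtain g where f: "continuous_map base infinite_projective_space f"
    and g: "continuous_map E infinite_sphere g"
      "\<And>e. e \<in> topspace E \<Longrightarrow> g (\<tau> e) = antipode (g e)"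
      "\<And>e. e \<in> topspace E \<Longrightarrow> f (proj e) = orbit2 antipode (g e)"
    using assms(1) unfolding classifying_map_def by blast
  have kg: "odd_labelling E \<tau> (k \<circ> g)"
    using g(1,2) k by (auto simp: odd_labelling_def continuous_map_def)
  have "sw_cochain infinite_sphere antipode k \<in> cocycles 1 infinite_projective_space"
    using infinite_sphere.sw_cochain_cocycle[OF k] by (simp add: infinite_projective_space_def)
  from cohomology_pullback_class[OF f this]
  have "cohomology_pullback 1 base f
      (cohomology_class 1 infinite_projective_space (sw_cochain infinite_sphere antipode k)) =
    cohomology_class 1 base (sw_cochain E \<tau> (k \<circ> g))"
    using pullback_sw_cochain[OF double_cover_axioms double_cover_infinite_sphere g k] by simp
  also have "\<dots> = cohomology_class 1 base (sw_cochain E \<tau> h)"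
    using sw_cochain_cohomologous[OF kg h] by (simp add: cohomology_class_eq_iff)
  finally show ?thesis .
qed

text \<open>Removes the choices of classifying map and generator: the relation holds for at most one
  class, and any odd labelling represents it.\<close>

theorem first_SW_class_iff:
  assumes h: "odd_labelling E \<tau> h"
  shows "first_SW_class E \<tau> base proj \<alpha> \<longleftrightarrow>
     (\<exists>f. classifying_map E \<tau> base proj f) \<and> \<alpha> = cohomology_class 1 base (sw_cochain E \<tau> h)"
proof -
  obtain k where k: "odd_labelling infinite_sphere antipode k"
    by (rule infinite_sphere.odd_labelling_exists)
  show ?thesis
    unfolding first_SW_class_def
    using projective_cohomology_generator_iff[OF k] classifying_map_pullback[OF _ k h] by metis
qed

end


section \<open>Odd maps to Euclidean space and the upper bound\<close>

context double_cover
begin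

text \<open>Normalizing \<open>F\<close> gives an equivariant map to the sphere of dimension
  \<open>d\<close>, which descends to the orbit spaces.\<close>

lemma classifying_map_exists:
  fixes F :: "'e \<Rightarrow> nat \<Rightarrow> real"
  assumes cont: "\<And>i. continuous_map E euclideanreal (\<lambda>e. F e i)"
    and odd: "\<And>e i. e \<in> topspace E \<Longrightarrow> F (\<tau> e) i = - F e i"
    and nonzero: "\<And>e. e \<in> topspace E \<Longrightarrow> \<exists>i\<le>d. F e i \<noteq> 0"
  shows "\<exists>f. classifying_map E \<tau> base proj f"
proof -
  define r where "r e = sqrt (\<Sum>j\<le>d. (F e j)\<^sup>2)" for e
  define g where "g e = (\<lambda>i. if i \<le> d then F e i / r e else 0)" for e
  have pos: "(\<Sum>j\<le>d. (F e j)\<^sup>2) > 0" if e: "e \<in> topspace E" for e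
  proof -
    obtain i where "i \<le> d" "F e i \<noteq> 0"
      using nonzero[OF e] by blast
    then show ?thesis
      by (intro sum_pos2[of _ i]) auto
  qed
  have "continuous_map E (nsphere d) g"
  proof (rule continuous_map_into_nsphere)
    have r: "continuous_map E euclideanreal r"
      unfolding r_def by (intro continuous_intros cont) auto
    have "r e \<noteq> 0" if "e \<in> topspace E" for e
      using pos[OF that] by (simp add: r_def)
    then have "continuous_map E euclideanreal (\<lambda>e. F e i / r e)" for i
      by (intro continuous_map_real_divide cont r) auto
    then show "continuous_map E euclideanreal (\<lambda>e. g e i)" for i
      by (cases "i \<le> d") (simp_all add: g_def)
    fix e assume e: "e \<in> topspace E"
    have "(\<Sum>i\<le>d. (g e i)\<^sup>2) = (\<Sum>i\<le>d. (F e i)\<^sup>2 / (\<Sum>j\<le>d. (F e j)\<^sup>2))"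
      by (rule sum.cong) (auto simp: g_def r_def power_divide sum_nonneg)
    also have "\<dots> = 1"
      using pos[OF e] by (simp flip: sum_divide_distrib)
    finally show "g e \<in> topspace (nsphere d)"
      by (simp add: in_nsphere_iff) (simp add: g_def)
  qed
  then have g: "continuous_map E infinite_sphere g"
    by (rule continuous_map_nsphere_imp)
  have g_odd: "g (\<tau> e) = antipode (g e)" if e: "e \<in> topspace E" for e
    using odd[OF e] by (auto simp: g_def r_def antipode_def fun_eq_iff)
  have cont_p: "continuous_map E infinite_projective_space (orbit2 antipode \<circ> g)"
    unfolding infinite_projective_space_def
    by (rule continuous_map_compose[OF g infinite_sphere.continuous_map_proj])
  have resp: "(orbit2 antipode \<circ> g) e = (orbit2 antipode \<circ> g) e'"
    if "e \<in> topspace E" "e' \<in> topspace E" "proj e = proj e'" for e e'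
  proof -
    have "e' = e \<or> e' = \<tau> e"
      using proj_eq_iff that by blast
    then show ?thesis
      using g_odd[OF \<open>e \<in> topspace E\<close>] by (auto simp: orbit2_def antipode_def)
  qed
  obtain f where f: "continuous_map base infinite_projective_space f"
    "\<And>e. e \<in> topspace E \<Longrightarrow> f (proj e) = (orbit2 antipode \<circ> g) e"
    by (rule quotient_map_lift_exists[OF quotient_map_proj cont_p]) (use resp in blast)+
  show ?thesis
    unfolding classifying_map_def using f g g_odd by (intro exI[of _ f] conjI exI[of _ g]) auto
qed

text \<open>The base is covered by the \<open>d + 1\<close> open sets on which a coordinate of \<open>F\<close> does not vanish; the
  sign of that coordinate trivializes the cover there.\<close>

lemma sw_product_coboundary:
  fixes F :: "'e \<Rightarrow> nat \<Rightarrow> real"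
  assumes cont: "\<And>i. continuous_map E euclideanreal (\<lambda>e. F e i)"
    and odd: "\<And>e i. e \<in> topspace E \<Longrightarrow> F (\<tau> e) i = - F e i"
    and nonzero: "\<And>e. e \<in> topspace E \<Longrightarrow> \<exists>i\<le>d. F e i \<noteq> 0"
    and "d < n"
  obtains hs where "\<And>i. odd_labelling E \<tau> (hs i)" "sw_product E \<tau> hs n \<in> coboundaries n base"
proof -
  obtain h where h: "odd_labelling E \<tau> h"
    by (rule odd_labelling_exists)
  \<comment> \<open>The sign of coordinate \<open>i\<close>; where that coordinate vanishes,
    \<open>h\<close> keeps the labelling odd.\<close>
  define hs where "hs i e = (if F e i < 0 then 1 else if F e i > 0 then 0 else h e)" for i :: nat and e
  have hs: "odd_labelling E \<tau> (hs i)" for i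
    using h odd by (auto simp: odd_labelling_def hs_def)
  define U where "U i = proj ` {e \<in> topspace E. F e i \<noteq> 0}" for i
  have opn: "openin base (U i)" for i
  proof -
    have "openin E {e \<in> topspace E. F e i \<in> - {0}}"
      by (rule openin_continuous_map_preimage[OF cont]) (simp add: open_Compl)
    then show ?thesis
      unfolding U_def by (intro openin_base_proj_image) simp
  qed
  have cover: "topspace base \<subseteq> \<Union>(U ` {..d})"
    using nonzero unfolding topspace_base U_def by fastforce
  have edge: "sw_cochain E \<tau> (hs i) \<rho> = 0"
    if \<rho>: "singular_simplex 1 base \<rho>" "\<rho> ` standard_simplex 1 \<subseteq> U i" for i \<rho>
  proof -
    obtain \<rho>' where \<rho>': "singular_simplex 1 E \<rho>'" "simplex_map 1 proj \<rho>' = \<rho>"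
      using path_lift[OF \<rho>(1)] by blast
    let ?g = "\<lambda>x. F (\<rho>' x) i"
    have nz: "?g x \<noteq> 0" if x: "x \<in> standard_simplex 1" for x
    proof -
      have "proj (\<rho>' x) \<in> U i"
        using \<rho>(2) \<rho>'(2) x by (auto simp: simplex_map_def)
      then obtain e where e: "e \<in> topspace E" "F e i \<noteq> 0" "proj e = proj (\<rho>' x)"
        by (auto simp: U_def)
      then have "\<rho>' x = e \<or> \<rho>' x = \<tau> e"
        using proj_eq_iff singular_simplex_in[OF \<rho>'(1) x] by blast
      then show ?thesis
        using e odd by auto
    qed
    have "continuous_map (simplex_space 1) euclideanreal ((\<lambda>e. F e i) \<circ> \<rho>')"
      using \<rho>'(1) unfolding singular_simplex_def by (intro continuous_map_compose[OF _ cont]) auto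
    then have "connectedin euclideanreal (((\<lambda>e. F e i) \<circ> \<rho>') ` standard_simplex 1)"
      by (rule connectedin_continuous_map_image) (simp add: connectedin_subtopology connectedin_standard_simplex)
    \<comment> \<open>By connectedness coordinate \<open>i\<close> cannot change its sign along the
      lift of an edge in \<open>U i\<close>, where it has no zero.\<close>
    then have "is_interval (?g ` standard_simplex 1)"
      by (simp add: is_interval_connected_1 image_comp o_def)
    then have "0 \<in> ?g ` standard_simplex 1"
      if "?g x \<le> 0" "0 \<le> ?g y" "x \<in> standard_simplex 1" "y \<in> standard_simplex 1" for x y
      using that unfolding is_interval_1 by blast
    then have "?g x < 0 \<longleftrightarrow> ?g y < 0" if "x \<in> standard_simplex 1" "y \<in> standard_simplex 1" for x y
      using that nz by (metis (no_types, lifting) imageE less_eq_real_def not_less)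
    from this[of "simplex_vertex 0" "simplex_vertex 1"]
    have "hs i (\<rho>' (simplex_vertex 0)) = hs i (\<rho>' (simplex_vertex 1))"
      using nz[of "simplex_vertex 0"] nz[of "simplex_vertex 1"] by (auto simp: hs_def)
    then show ?thesis
      using sw_cochain_lift[OF hs \<rho>'(1)] \<rho>'(2) by simp
  qed
  \<comment> \<open>As \<open>i \<le> d < n\<close>, the product has a factor with labelling
    \<open>i\<close>; this is where the number of coordinates enters.\<close>
  have van: "sw_product E \<tau> hs n \<sigma> = 0"
    if \<sigma>: "singular_simplex n base \<sigma>" "V \<in> U ` {..d}" "\<sigma> ` standard_simplex n \<subseteq> V" for \<sigma> V
  proof -
    obtain i where i: "i \<le> d" "V = U i"
      using \<sigma>(2) by blast
    show ?thesis
      by (rule sw_product_vanishing[OF \<sigma>(1,3), of i]) (use i \<open>d < n\<close> edge in auto)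
  qed
  obtain q where q: "n = Suc q"
    using \<open>d < n\<close> by (cases n) auto
  have "sw_product E \<tau> hs n \<in> coboundaries n base"
    unfolding q
  proof (rule cocycle_vanishing_on_small_simplices[OF _ _ cover])
    show "sw_product E \<tau> hs (Suc q) \<in> cocycles (Suc q) base"
      by (rule sw_product_cocycle) (rule hs)
  qed (use opn van[unfolded q] in blast)+
  with hs that show ?thesis by blast
qed

end


section \<open>The torus as a hypersurface\<close>

lemma double_cover_ordered_config2:
  fixes X :: "'a topology"
  assumes "Hausdorff_space X"
  shows "double_cover (ordered_config2 X) prod.swap"
proof
  show "Hausdorff_space (ordered_config2 X)"
    unfolding ordered_config2_def
    using assms by (intro Hausdorff_space_subtopology) (simp add: Hausdorff_space_prod_topology)
  have "continuous_map (prod_topology X X) (prod_topology X X) prod.swap"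
  proof -
    have "prod.swap = (\<lambda>(x::'a, y::'a). (y, x))"
      by auto
    then show ?thesis
      using homeomorphic_imp_continuous_map[OF homeomorphic_map_swap[of X X]] by simp
  qed
  then show "continuous_map (ordered_config2 X) (ordered_config2 X) prod.swap"
    unfolding ordered_config2_def
    by (auto simp: continuous_map_in_subtopology continuous_map_from_subtopology)
qed (auto simp: ordered_config2_def)

text \<open>The torus of dimension \<open>k + 1\<close> is obtained by rotating the one of dimension \<open>k\<close>, which lies at
  positive distance \<open>torus_radius k x\<close> from the axis.\<close>

primrec torus_radius :: "nat \<Rightarrow> (nat \<Rightarrow> real) \<Rightarrow> real" where
  "torus_radius 0 x = 1"
| "torus_radius (Suc k) x = 2 ^ Suc k + torus_radius k x * cos (2 * pi * x k)"

text \<open>A rotation turns the last coordinate \<open>r\<close> into \<open>r\<close> times a sine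
  and, up to translation, \<open>r\<close> times a cosine. The latter is the next radius, so only
  the sines and the final radius remain as coordinates.\<close>

definition torus_point :: "nat \<Rightarrow> (nat \<Rightarrow> real) \<Rightarrow> nat \<Rightarrow> real" where
  "torus_point d x i = (if i < d then torus_radius i x * sin (2 * pi * x i) else torus_radius d x)"

definition torus_embedding :: "nat \<Rightarrow> (nat \<Rightarrow> real) set \<Rightarrow> nat \<Rightarrow> real" where
  "torus_embedding d t = torus_point d (SOME x. x \<in> t)"

text \<open>The upper bound is one less than the constant added in the next rotation, so all radii
  stay at least 1. This is the origin of the constants \<open>2 ^ Suc k\<close>.\<close>

lemma torus_radius_bounds: "1 \<le> torus_radius k x \<and> torus_radius k x \<le> 2 ^ Suc k - 1"
proof (induction k)
  case (Suc k)
  have "\<bar>torus_radius k x * cos (2 * pi * x k)\<bar> \<le> torus_radius k x * 1"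
    unfolding abs_mult using Suc by (intro mult_mono) auto
  then have "torus_radius k x * cos (2 * pi * x k) \<le> torus_radius k x"
    "- (torus_radius k x * cos (2 * pi * x k)) \<le> torus_radius k x"
    by linarith+
  moreover have "torus_radius k x \<le> 2 * 2 ^ k - 1"
    using Suc by simp
  ultimately show ?case
    unfolding torus_radius.simps power_Suc by (intro conjI; linarith)
qed simp

lemma sin_cos_integer_shift:
  assumes "y - x \<in> \<int>"
  shows "sin (2 * pi * y) = sin (2 * pi * x)" "cos (2 * pi * y) = cos (2 * pi * x)"
proof -
  obtain n :: int where "y = x + of_int n"
    using assms by (metis Ints_cases add.commute diff_add_cancel)
  then have "\<exists>n::int. 2 * pi * y = 2 * pi * x + 2 * pi * n"
    by (auto simp: algebra_simps)
  then show "sin (2 * pi * y) = sin (2 * pi * x)" "cos (2 * pi * y) = cos (2 * pi * x)"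
    using sin_cos_eq_iff by blast+
qed

lemma integer_shift_if_sin_cos:
  assumes "sin (2 * pi * y) = sin (2 * pi * x)" "cos (2 * pi * y) = cos (2 * pi * x)"
  shows "y - x \<in> \<int>"
proof -
  obtain n :: int where "2 * pi * y = 2 * pi * x + 2 * pi * n"
    using assms sin_cos_eq_iff by blast
  then have "2 * pi * (y - x) = 2 * pi * of_int n"
    by (simp add: algebra_simps)
  then have "y - x = of_int n"
    by simp
  then show ?thesis by simp
qed

lemma torus_radius_shift:
  "(\<And>i. y i - x i \<in> \<int>) \<Longrightarrow> torus_radius k y = torus_radius k x"
  by (induction k) (simp_all add: sin_cos_integer_shift)

lemma torus_point_shift:
  "(\<And>i. y i - x i \<in> \<int>) \<Longrightarrow> torus_point d y = torus_point d x"
  by (auto simp: torus_point_def torus_radius_shift[of y x] sin_cos_integer_shift)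

text \<open>Peels off one rotation: the outer radius yields \<open>r\<close> times the cosine, the
  coordinate yields \<open>r\<close> times the sine, and as \<open>r\<close> is positive both
  \<open>r\<close> and the angle modulo full turns are determined.\<close>

lemma torus_radius_inject:
  assumes "torus_radius k x = torus_radius k y"
    "\<And>i. i < k \<Longrightarrow> torus_radius i x * sin (2 * pi * x i) = torus_radius i y * sin (2 * pi * y i)"
  shows "\<forall>i<k. x i - y i \<in> \<int>"
  using assms
proof (induction k)
  case (Suc k)
  let ?r = "torus_radius k x" and ?s = "torus_radius k y"
  have c: "?r * cos (2 * pi * x k) = ?s * cos (2 * pi * y k)"
    using Suc.prems(1) by simp
  have s: "?r * sin (2 * pi * x k) = ?s * sin (2 * pi * y k)"
    using Suc.prems(2) by simp
  have pos: "?r > 0" "?s > 0"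
    using torus_radius_bounds[of k x] torus_radius_bounds[of k y] by auto
  have sq: "(a * sin t)\<^sup>2 + (a * cos t)\<^sup>2 = a\<^sup>2" for a t :: real
    by (simp add: power_mult_distrib flip: distrib_left)
  have "?r\<^sup>2 = ?s\<^sup>2"
    using sq[of ?r "2 * pi * x k"] sq[of ?s "2 * pi * y k"] c s by simp
  then have rs: "?r = ?s"
    using pos by simp
  then have "\<forall>i<k. x i - y i \<in> \<int>"
    using Suc by simp
  moreover have "x k - y k \<in> \<int>"
    using c s rs pos by (intro integer_shift_if_sin_cos) auto
  ultimately show ?case
    using less_Suc_eq by auto
qed simp

lemma lattice_coset_shift:
  assumes "\<And>i. x i - y i \<in> \<int>"
  shows "lattice_coset d x = lattice_coset d y"
proof -
  have "z i - x i \<in> \<int> \<longleftrightarrow> z i - y i \<in> \<int>" for z :: "nat \<Rightarrow> real" and i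
  proof -
    have "z i - y i = (z i - x i) + (x i - y i)" "z i - x i = (z i - y i) - (x i - y i)"
      by simp_all
    with assms show ?thesis
      by (metis Ints_add Ints_diff)
  qed
  then show ?thesis
    by (simp add: lattice_coset_def)
qed

lemma lattice_coset_eq_iff:
  assumes "x \<in> topspace (Euclidean_space d)"
  shows "lattice_coset d x = lattice_coset d y \<longleftrightarrow> (\<forall>i. x i - y i \<in> \<int>)"
proof
  assume "lattice_coset d x = lattice_coset d y"
  moreover have "x \<in> lattice_coset d x"
    using assms by (simp add: lattice_coset_def)
  ultimately show "\<forall>i. x i - y i \<in> \<int>"
    by (simp add: lattice_coset_def)
qed (simp add: lattice_coset_shift)

lemma topspace_torus: "topspace (torus d) = lattice_coset d ` topspace (Euclidean_space d)"
  by (simp add: torus_def)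

lemma torus_embedding_coset:
  assumes x: "x \<in> topspace (Euclidean_space d)"
  shows "torus_embedding d (lattice_coset d x) = torus_point d x"
proof -
  have "(SOME y. y \<in> lattice_coset d x) \<in> lattice_coset d x"
    by (rule someI[of _ x]) (use x in \<open>simp add: lattice_coset_def\<close>)
  then show ?thesis
    unfolding torus_embedding_def by (intro torus_point_shift) (simp add: lattice_coset_def)
qed

lemma continuous_map_torus_embedding:
  "continuous_map (torus d) euclideanreal (\<lambda>t. torus_embedding d t i)"
proof -
  have coord: "continuous_on UNIV (\<lambda>x::nat \<Rightarrow> real. x k)" for k
    by (rule continuous_on_product_coordinates)
  have rad: "continuous_on UNIV (torus_radius k)" for k
    by (induction k) (auto intro!: continuous_intros coord)
  have "continuous_on UNIV (\<lambda>x. torus_radius i x * sin (2 * pi * x i))"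
    by (intro continuous_intros coord rad)
  then have "continuous_on UNIV (\<lambda>x. torus_point d x i)"
    using rad by (cases "i < d") (simp_all add: torus_point_def)
  then have "continuous_on (topspace (Euclidean_space d)) (\<lambda>x. torus_point d x i)"
    by (rule continuous_on_subset) simp
  then have "continuous_map (Euclidean_space d) euclideanreal (\<lambda>x. torus_point d x i)"
    by (simp add: Euclidean_space_def euclidean_product_topology topspace_Euclidean_space)
  then have "continuous_map (Euclidean_space d) euclideanreal ((\<lambda>t. torus_embedding d t i) \<circ> lattice_coset d)"
    by (rule continuous_map_eq) (simp add: torus_embedding_coset)
  then show ?thesis
    unfolding torus_def by (rule continuous_compose_quotient_map[OF quotient_map_quotient_topology])
qed

lemma torus_embedding_inject:
  assumes "t \<in> topspace (torus d)" "s \<in> topspace (torus d)"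
    "\<And>i. i \<le> d \<Longrightarrow> torus_embedding d t i = torus_embedding d s i"
  shows "t = s"
proof -
  obtain x y where xy: "x \<in> topspace (Euclidean_space d)" "y \<in> topspace (Euclidean_space d)"
    "t = lattice_coset d x" "s = lattice_coset d y"
    using assms(1,2) by (auto simp: topspace_torus)
  then have eq: "torus_point d x i = torus_point d y i" if "i \<le> d" for i
    using assms(3)[OF that] by (simp add: torus_embedding_coset)
  have "\<forall>i<d. x i - y i \<in> \<int>"
  proof (rule torus_radius_inject)
    show "torus_radius d x = torus_radius d y"
      using eq[of d] by (simp add: torus_point_def)
    show "torus_radius i x * sin (2 * pi * x i) = torus_radius i y * sin (2 * pi * y i)" if "i < d" for i
      using eq[of i] that by (simp add: torus_point_def)
  qed
  moreover have "x i - y i \<in> \<int>" if "i \<ge> d" for i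
    using xy(1,2) that by (simp add: topspace_Euclidean_space)
  ultimately have "\<forall>i. x i - y i \<in> \<int>"
    using not_le by blast
  with xy show ?thesis
    by (simp add: lattice_coset_eq_iff)
qed

lemma Hausdorff_space_torus: "Hausdorff_space (torus d)"
proof (rule Hausdorff_space_injective_preimage)
  show "Hausdorff_space (powertop_real UNIV)"
    by (simp add: Hausdorff_space_product_topology)
  show "continuous_map (torus d) (powertop_real UNIV) (torus_embedding d)"
    using continuous_map_torus_embedding by (simp add: continuous_map_componentwise_UNIV)
  show "inj_on (torus_embedding d) (topspace (torus d))"
    using torus_embedding_inject by (metis inj_onI)
qed

definition torus_difference :: "nat \<Rightarrow> (nat \<Rightarrow> real) set \<times> (nat \<Rightarrow> real) set \<Rightarrow> nat \<Rightarrow> real" where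
  "torus_difference d z i = torus_embedding d (fst z) i - torus_embedding d (snd z) i"

lemma continuous_map_torus_difference:
  "continuous_map (ordered_config2 (torus d)) euclideanreal (\<lambda>z. torus_difference d z i)"
proof -
  have "continuous_map (prod_topology (torus d) (torus d)) euclideanreal ((\<lambda>t. torus_embedding d t i) \<circ> fst)"
    "continuous_map (prod_topology (torus d) (torus d)) euclideanreal ((\<lambda>t. torus_embedding d t i) \<circ> snd)"
    using continuous_map_torus_embedding
    by (blast intro: continuous_map_compose continuous_map_fst continuous_map_snd)+
  then have "continuous_map (prod_topology (torus d) (torus d)) euclideanreal (\<lambda>z. torus_difference d z i)"
    unfolding torus_difference_def by (intro continuous_map_diff) (simp_all add: o_def)
  then show ?thesis
    unfolding ordered_config2_def by (rule continuous_map_from_subtopology)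
qed

lemma torus_difference_swap: "torus_difference d (prod.swap z) i = - torus_difference d z i"
  by (simp add: torus_difference_def)

lemma torus_difference_nonzero:
  assumes "z \<in> topspace (ordered_config2 (torus d))"
  shows "\<exists>i\<le>d. torus_difference d z i \<noteq> 0"
  using assms torus_embedding_inject[of "fst z" d "snd z"]
  by (auto simp: ordered_config2_def torus_difference_def)


section \<open>Boundaries and prisms of lists of vertices\<close>

text \<open>A cochain is evaluated on affine simplices, which are given by their lists of vertices.\<close>

primrec list_boundary :: "'v list \<Rightarrow> ('v list \<Rightarrow> bit) \<Rightarrow> bit" where
  "list_boundary [] \<phi> = 0"
| "list_boundary (v # vs) \<phi> = \<phi> vs + list_boundary vs (\<lambda>l. \<phi> (v # l))"

text \<open>The prism operator of the straight-line homotopy from \<open>M\<close> to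
  \<open>P\<close>: the sum of \<open>\<phi>\<close> over the lists
  \<open>M v0, ..., M vi, P vi, ..., P vn\<close>.\<close>

primrec prism :: "('v \<Rightarrow> 'w) \<Rightarrow> ('v \<Rightarrow> 'w) \<Rightarrow> 'v list \<Rightarrow> ('w list \<Rightarrow> bit) \<Rightarrow> bit" where
  "prism M P [] \<phi> = 0"
| "prism M P (v # vs) \<phi> = \<phi> (M v # P v # map P vs) + prism M P vs (\<lambda>l. \<phi> (M v # l))"

lemma list_boundary_add:
  "list_boundary vs (\<lambda>l. \<phi> l + \<psi> l) = list_boundary vs \<phi> + list_boundary vs \<psi>"
  by (induction vs arbitrary: \<phi> \<psi>) (simp_all add: ac_simps)

lemma list_boundary_mult: "list_boundary vs (\<lambda>l. a * \<phi> l) = a * list_boundary vs \<phi>"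
  by (induction vs arbitrary: \<phi>) (simp_all add: distrib_left)

lemma list_boundary_map: "list_boundary (map f vs) \<phi> = list_boundary vs (\<lambda>l. \<phi> (map f l))"
  by (induction vs arbitrary: \<phi>) simp_all

lemma list_boundary_sum:
  "list_boundary vs \<phi> = (\<Sum>k<length vs. \<phi> (take k vs @ drop (Suc k) vs))"
proof (induction vs arbitrary: \<phi>)
  case (Cons v vs)
  then show ?case
    by (simp only: list_boundary.simps length_Cons sum.lessThan_Suc_shift) simp
qed simp

lemma prism_add: "prism M P vs (\<lambda>l. \<phi> l + \<psi> l) = prism M P vs \<phi> + prism M P vs \<psi>"
  by (induction vs arbitrary: \<phi> \<psi>) (simp_all add: ac_simps)

text \<open>The chain homotopy formula. In the induction the faces of the first prism simplex that
  keep \<open>M v\<close> and \<open>P v\<close> (the term \<open>?a\<close>) occur twice, and the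
  face without \<open>P v\<close> cancels against the induction hypothesis for \<open>\<phi>\<close>
  with \<open>M v\<close> prepended.\<close>

lemma prism_boundary:
  "prism M P vs (\<lambda>l. list_boundary l \<phi>) + list_boundary vs (\<lambda>l. prism M P l \<phi>) =
     \<phi> (map M vs) + \<phi> (map P vs)"
proof (induction vs arbitrary: \<phi>)
  case (Cons v vs)
  let ?\<phi> = "\<lambda>l. \<phi> (M v # l)"
  let ?a = "list_boundary vs (\<lambda>l. \<phi> (M v # P v # map P l))"
  have 1: "prism M P (v # vs) (\<lambda>l. list_boundary l \<phi>) =
      \<phi> (map P (v # vs)) + (?\<phi> (map P vs) + ?a) + (prism M P vs \<phi> + prism M P vs (\<lambda>l. list_boundary l ?\<phi>))"
    by (simp add: prism_add list_boundary_map ac_simps)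
  have 2: "list_boundary (v # vs) (\<lambda>l. prism M P l \<phi>) =
      prism M P vs \<phi> + (?a + list_boundary vs (\<lambda>l. prism M P l ?\<phi>))"
    by (simp add: list_boundary_add)
  have "(x + (y + a) + (p + s)) + (p + (a + t)) = z + x"
    if "s + t = z + y" for x y z a p s t :: bit
    using that by (cases x; cases y; cases z; cases a; cases p; cases s; cases t) simp_all
  from this[OF Cons[of ?\<phi>]] show ?case
    unfolding 1 2 by simp
qed simp

lemma prism_eq_0:
  assumes "\<And>i. i < length vs \<Longrightarrow> \<phi> (map M (take (Suc i) vs) @ map P (drop i vs)) = 0"
  shows "prism M P vs \<phi> = 0"
  using assms
proof (induction vs arbitrary: \<phi>)
  case (Cons v vs)
  have "\<phi> (M v # P v # map P vs) = 0"
    using Cons.prems[of 0] by simp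
  moreover have "prism M P vs (\<lambda>l. \<phi> (M v # l)) = 0"
  proof (rule Cons.IH)
    fix i assume "i < length vs"
    then show "\<phi> (M v # map M (take (Suc i) vs) @ map P (drop i vs)) = 0"
      using Cons.prems[of "Suc i"] by simp
  qed
  ultimately show ?case by simp
qed simp

text \<open>On the vertex labels of a lifted simplex this is the value of the power of the cochain,
  as in \<open>sw_product_lift\<close> with one labelling.\<close>

primrec alternation :: "bit list \<Rightarrow> bit" where
  "alternation [] = 1"
| "alternation (b # bs) = (case bs of [] \<Rightarrow> 1 | c # cs \<Rightarrow> (b + c) * alternation bs)"

lemma alternation_prod:
  "alternation bs = (\<Prod>j<length bs - 1. bs ! j + bs ! Suc j)"
proof (induction bs)
  case (Cons b bs)
  show ?case
  proof (cases bs)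
    case (Cons c cs)
    then have "(\<Prod>j<length (b # bs) - 1. (b # bs) ! j + (b # bs) ! Suc j) =
        (b + c) * (\<Prod>j<length bs - 1. bs ! j + bs ! Suc j)"
      by (simp add: prod.lessThan_Suc_shift del: prod.lessThan_Suc)
    then show ?thesis
      using Cons.IH Cons by simp
  qed simp
qed simp

text \<open>Together with the face that omits \<open>b\<close> this is the cocycle property of
  \<open>alternation\<close>.\<close>

lemma list_boundary_alternation_Cons:
  "bs \<noteq> [] \<Longrightarrow> list_boundary bs (\<lambda>l. alternation (b # l)) = alternation bs"
proof (induction bs arbitrary: b)
  case (Cons c bs)
  show ?case
  proof (cases bs)
    case (Cons c' cs)
    have "list_boundary bs (\<lambda>l. alternation (b # c # l)) = (b + c) * alternation bs"
      using Cons.IH[of c] Cons by (simp add: list_boundary_mult del: list_boundary.simps)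
    moreover have "(b + c') * x + (b + c) * x = (c + c') * x" for x
      by (cases b; cases c; cases c'; cases x) simp_all
    ultimately show ?thesis
      using Cons by simp
  qed simp
qed simp

text \<open>With \<open>h\<close> the label of a vertex, this is \<open>\<delta>(h (\<delta>h)\<^sup>n) = (\<delta>h)\<^sup>n\<^sup>+\<^sup>1\<close>.\<close>

lemma list_boundary_hd_alternation:
  assumes "length bs \<ge> 2"
  shows "list_boundary bs (\<lambda>l. hd l * alternation l) = alternation bs"
proof -
  obtain b c cs where bs: "bs = b # c # cs"
    using assms by (metis Suc_le_length_iff numeral_2_eq_2)
  have "list_boundary bs (\<lambda>l. hd l * alternation l) =
      c * alternation (c # cs) + b * list_boundary (c # cs) (\<lambda>l. alternation (b # l))"
    unfolding bs by (simp only: list_boundary.simps(2)[of b] list_boundary_mult list.sel)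
  also have "\<dots> = (b + c) * alternation (c # cs)"
    by (simp add: list_boundary_alternation_Cons distrib_right add.commute del: list_boundary.simps alternation.simps)
  finally show ?thesis
    by (simp add: bs)
qed

lemma alternation_complement: "alternation (map (\<lambda>b. b + 1) bs) = alternation bs"
proof (induction bs)
  case (Cons b bs)
  have "(b + 1) + (c + 1) = b + c" for b c :: bit
    by (cases b; cases c) simp_all
  with Cons show ?case
    by (cases bs) simp_all
qed simp


section \<open>Signed flags\<close>

text \<open>The boundary of the cube \<open>[-1/2, 1/2]\<^sup>J\<close> is triangulated by flags of faces: a vertex is the
  centre of a face, and the faces get smaller along the list. The set \<open>S i\<close> contains the values that
  the coordinate \<open>i\<close> may take when it is fixed, so that a singleton \<open>S i\<close> gives a hemisphere.\<close>

primrec flag_sum ::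
  "nat \<Rightarrow> (nat \<Rightarrow> real) \<Rightarrow> nat set \<Rightarrow> (nat \<Rightarrow> real set) \<Rightarrow> ((nat \<Rightarrow> real) list \<Rightarrow> bit) \<Rightarrow> bit" where
  "flag_sum 0 u J S \<phi> = \<phi> []"
| "flag_sum (Suc n) u J S \<phi> =
     (\<Sum>i\<in>J. \<Sum>\<epsilon>\<in>S i. flag_sum n (u(i := \<epsilon>)) (J - {i}) S (\<lambda>l. \<phi> (u(i := \<epsilon>) # l)))"

text \<open>The lists over which \<open>flag_sum\<close> runs, as a predicate, so that
  \<open>flag_sum_cong\<close> can exploit properties of their vertices.\<close>

inductive flag :: "(nat \<Rightarrow> real set) \<Rightarrow> (nat \<Rightarrow> real) \<Rightarrow> nat set \<Rightarrow> (nat \<Rightarrow> real) list \<Rightarrow> bool" for S where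
  Nil: "flag S u J []"
| Cons: "i \<in> J \<Longrightarrow> \<epsilon> \<in> S i \<Longrightarrow> flag S (u(i := \<epsilon>)) (J - {i}) l \<Longrightarrow> flag S u J (u(i := \<epsilon>) # l)"

lemma flag_outside: "flag S u J l \<Longrightarrow> i \<notin> J \<Longrightarrow> v \<in> set l \<Longrightarrow> v i = u i"
  by (induction rule: flag.induct) auto

text \<open>The coordinate fixed first is never changed later. This is what keeps the affine
  simplices off the diagonal.\<close>

lemma flag_common_coordinate:
  assumes "flag S u J l" "l \<noteq> []"
  obtains i \<epsilon> where "i \<in> J" "\<epsilon> \<in> S i" "\<And>v. v \<in> set l \<Longrightarrow> v i = \<epsilon>"
  using assms(1)
proof cases
  case (Cons i \<epsilon> l')
  then have "v i = \<epsilon>" if "v \<in> set l" for v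
    using that flag_outside[of S "u(i := \<epsilon>)" "J - {i}" l' i v] by auto
  with Cons that show ?thesis by blast
qed (use assms(2) in simp)

lemma flag_sum_cong:
  assumes "\<And>l. flag S u J l \<Longrightarrow> length l = n \<Longrightarrow> \<phi> l = \<psi> l"
  shows "flag_sum n u J S \<phi> = flag_sum n u J S \<psi>"
  using assms
proof (induction n arbitrary: u J \<phi> \<psi>)
  case 0
  then show ?case
    by (simp add: flag.Nil)
next
  case (Suc n)
  show ?case
    unfolding flag_sum.simps
  proof (intro sum.cong refl Suc.IH)
    fix i \<epsilon> l assume "i \<in> J" "\<epsilon> \<in> S i" "flag S (u(i := \<epsilon>)) (J - {i}) l" "length l = n"
    then show "\<phi> (u(i := \<epsilon>) # l) = \<psi> (u(i := \<epsilon>) # l)"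
      by (intro Suc.prems flag.Cons) simp_all
  qed
qed

lemma flag_sum_cong_signs:
  "(\<And>i. i \<in> J \<Longrightarrow> S i = S' i) \<Longrightarrow> flag_sum n u J S \<phi> = flag_sum n u J S' \<phi>"
proof (induction n arbitrary: u J \<phi>)
  case (Suc n)
  have "flag_sum n v (J - {i}) S \<psi> = flag_sum n v (J - {i}) S' \<psi>" for v i \<psi>
    by (rule Suc.IH) (use Suc.prems in auto)
  then show ?case
    unfolding flag_sum.simps using Suc.prems by (intro sum.cong) auto
qed simp

lemma flag_sum_add:
  "flag_sum n u J S (\<lambda>l. \<phi> l + \<psi> l) = flag_sum n u J S \<phi> + flag_sum n u J S \<psi>"
  by (induction n arbitrary: u J \<phi> \<psi>) (simp_all add: sum.distrib)

lemma flag_sum_zero: "flag_sum n u J S (\<lambda>l. 0) = 0"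
  by (induction n arbitrary: u J) simp_all

lemma sum_symmetric_off_diagonal:
  fixes g :: "'a \<Rightarrow> 'a \<Rightarrow> bit"
  assumes "finite J" "\<And>i j. g i j = g j i"
  shows "(\<Sum>i\<in>J. \<Sum>j\<in>J - {i}. g i j) = 0"
  using assms(1)
proof (induction J)
  case (insert a J)
  have "(\<Sum>j\<in>insert a J - {i}. g i j) = g i a + (\<Sum>j\<in>J - {i}. g i j)" if "i \<in> J" for i
  proof -
    have "insert a J - {i} = insert a (J - {i})"
      using that insert.hyps by auto
    then show ?thesis
      using insert.hyps by simp
  qed
  moreover have "insert a J - {a} = J"
    using insert.hyps by auto
  ultimately have "(\<Sum>i\<in>insert a J. \<Sum>j\<in>insert a J - {i}. g i j) =
      (\<Sum>j\<in>J. g a j) + ((\<Sum>i\<in>J. g i a) + (\<Sum>i\<in>J. \<Sum>j\<in>J - {i}. g i j))"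
    using insert.hyps by (simp add: sum.distrib)
  also have "\<dots> = 0"
    using insert.IH assms(2)[of a] by simp
  finally show ?case .
qed simp

text \<open>The dropped vertex sits between fixing \<open>i\<close> and fixing \<open>j\<close>; the
  opposite order leaves the same list, so the terms cancel in pairs.\<close>

lemma flag_sum_drop_first:
  assumes "finite J"
  shows "(\<Sum>i\<in>J. \<Sum>\<epsilon>\<in>S i. flag_sum (Suc n) (u(i := \<epsilon>)) (J - {i}) S \<phi>) = 0"
proof -
  let ?G = "\<lambda>i \<epsilon> j \<delta>. flag_sum n (u(i := \<epsilon>, j := \<delta>)) (J - {i} - {j}) S (\<lambda>l. \<phi> (u(i := \<epsilon>, j := \<delta>) # l))"
  define g where "g i j = (if i = j then 0 else \<Sum>\<epsilon>\<in>S i. \<Sum>\<delta>\<in>S j. ?G i \<epsilon> j \<delta>)" for i j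
  have "g i j = g j i" for i j
  proof (cases "i = j")
    case False
    have "g i j = (\<Sum>\<delta>\<in>S j. \<Sum>\<epsilon>\<in>S i. ?G i \<epsilon> j \<delta>)"
      using False by (simp add: g_def sum.swap[of _ "S i" "S j"])
    also have "\<dots> = (\<Sum>\<delta>\<in>S j. \<Sum>\<epsilon>\<in>S i. ?G j \<delta> i \<epsilon>)"
      using False by (simp add: fun_upd_twist[of i j] Diff_insert2[symmetric] insert_commute)
    also have "\<dots> = g j i"
      using False by (simp add: g_def)
    finally show ?thesis .
  qed simp
  then have "(\<Sum>i\<in>J. \<Sum>j\<in>J - {i}. g i j) = 0"
    by (rule sum_symmetric_off_diagonal[OF assms])
  moreover have "(\<Sum>\<epsilon>\<in>S i. \<Sum>j\<in>J - {i}. \<Sum>\<delta>\<in>S j. ?G i \<epsilon> j \<delta>) = (\<Sum>j\<in>J - {i}. g i j)" for i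
    by (subst sum.swap) (auto simp: g_def intro!: sum.cong)
  ultimately show ?thesis
    by simp
qed

lemma flag_sum_boundary_step:
  "flag_sum (Suc n) u J S (\<lambda>l. list_boundary l \<phi>) =
     (\<Sum>i\<in>J. \<Sum>\<epsilon>\<in>S i. flag_sum n (u(i := \<epsilon>)) (J - {i}) S \<phi>) +
     (\<Sum>i\<in>J. \<Sum>\<epsilon>\<in>S i. flag_sum n (u(i := \<epsilon>)) (J - {i}) S
        (\<lambda>l. list_boundary l (\<lambda>m. \<phi> (u(i := \<epsilon>) # m))))"
  by (simp add: flag_sum_add sum.distrib)

text \<open>The flags form a cycle: a dropped vertex other than the last cancels by exchanging two
  coordinates, a dropped last vertex by the other values of the last coordinate. The hypothesis on
  \<open>S\<close> is the form in which the latter is used.\<close>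

lemma flag_sum_boundary:
  assumes "finite J" "card J = n" "\<And>i (x::bit). i \<in> J \<Longrightarrow> (\<Sum>\<epsilon>\<in>S i. x) = 0"
  shows "flag_sum n u J S (\<lambda>l. list_boundary l \<phi>) = 0"
  using assms
proof (induction n arbitrary: u J \<phi>)
  case (Suc n)
  have "flag_sum n v (J - {i}) S (\<lambda>l. list_boundary l \<psi>) = 0" if "i \<in> J" for i v \<psi>
    by (rule Suc.IH) (use Suc.prems that in auto)
  moreover have "(\<Sum>i\<in>J. \<Sum>\<epsilon>\<in>S i. flag_sum n (u(i := \<epsilon>)) (J - {i}) S \<phi>) = 0"
  proof (cases n)
    case 0
    show ?thesis
      unfolding 0 flag_sum.simps by (intro sum.neutral ballI Suc.prems(3))
  next
    case (Suc m)
    then show ?thesis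
      using flag_sum_drop_first[OF Suc.prems(1)] by simp
  qed
  ultimately show ?case
    unfolding flag_sum_boundary_step by simp
qed simp

text \<open>The boundary of a hemisphere is its equator: only in flags that fix \<open>k\<close>
  last does the last vertex lack a partner, and dropping it leaves a flag in
  \<open>J - {k}\<close>.\<close>

lemma flag_sum_hemisphere_boundary:
  assumes "finite J" "card J = Suc n" "k \<in> J" "S k = {a}"
    "\<And>i (x::bit). i \<in> J \<Longrightarrow> i \<noteq> k \<Longrightarrow> (\<Sum>\<epsilon>\<in>S i. x) = 0"
  shows "flag_sum (Suc n) u J S (\<lambda>l. list_boundary l \<phi>) = flag_sum n u (J - {k}) S \<phi>"
  using assms
proof (induction n arbitrary: u J \<phi>)
  case 0
  then have "J = {k}"
    by (metis card_1_singletonE One_nat_def singletonD)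
  with 0 show ?case by simp
next
  case (Suc n)
  have k: "flag_sum (Suc n) v (J - {k}) S (\<lambda>l. list_boundary l \<psi>) = 0" for v \<psi>
    by (rule flag_sum_boundary) (use Suc.prems in auto)
  have i: "flag_sum (Suc n) v (J - {i}) S (\<lambda>l. list_boundary l \<psi>) = flag_sum n v (J - {k} - {i}) S \<psi>"
    if "i \<in> J - {k}" for i v \<psi>
  proof -
    have "flag_sum (Suc n) v (J - {i}) S (\<lambda>l. list_boundary l \<psi>) = flag_sum n v (J - {i} - {k}) S \<psi>"
      by (rule Suc.IH) (use Suc.prems that in auto)
    moreover have "J - {i} - {k} = J - {k} - {i}"
      by auto
    ultimately show ?thesis by simp
  qed
  have "flag_sum (Suc (Suc n)) u J S (\<lambda>l. list_boundary l \<phi>) =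
      (\<Sum>i\<in>J. \<Sum>\<epsilon>\<in>S i. flag_sum (Suc n) (u(i := \<epsilon>)) (J - {i}) S
        (\<lambda>l. list_boundary l (\<lambda>m. \<phi> (u(i := \<epsilon>) # m))))"
    unfolding flag_sum_boundary_step[of "Suc n"] flag_sum_drop_first[OF Suc.prems(1)] by simp
  also have "\<dots> = (\<Sum>i\<in>J - {k}. \<Sum>\<epsilon>\<in>S i. flag_sum (Suc n) (u(i := \<epsilon>)) (J - {i}) S
        (\<lambda>l. list_boundary l (\<lambda>m. \<phi> (u(i := \<epsilon>) # m))))"
    by (subst sum.remove[OF Suc.prems(1,3)]) (simp only: k, simp)
  also have "\<dots> = flag_sum (Suc n) u (J - {k}) S \<phi>"
    unfolding flag_sum.simps(2)[of n u "J - {k}"] by (intro sum.cong refl i)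
  finally show ?case .
qed

text \<open>As \<open>n\<close> is the number of free coordinates, every flag fixes \<open>k\<close>
  exactly once, at one of the two values.\<close>

lemma flag_sum_split:
  assumes "finite J" "card J = n" "k \<in> J" "S k = {a, b}" "a \<noteq> b"
  shows "flag_sum n u J S \<phi> = flag_sum n u J (S(k := {a})) \<phi> + flag_sum n u J (S(k := {b})) \<phi>"
  using assms
proof (induction n arbitrary: u J \<phi>)
  case (Suc n)
  let ?f = "\<lambda>S i. \<Sum>\<epsilon>\<in>S i. flag_sum n (u(i := \<epsilon>)) (J - {i}) S (\<lambda>l. \<phi> (u(i := \<epsilon>) # l))"
  have "?f S i = ?f (S(k := {a})) i + ?f (S(k := {b})) i" if "i \<in> J - {k}" for i
  proof -
    have "flag_sum n v (J - {i}) S \<psi> =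
        flag_sum n v (J - {i}) (S(k := {a})) \<psi> + flag_sum n v (J - {i}) (S(k := {b})) \<psi>" for v \<psi>
      by (rule Suc.IH) (use Suc.prems that in auto)
    then show ?thesis
      using that by (simp add: sum.distrib)
  qed
  moreover have "?f S k = ?f (S(k := {a})) k + ?f (S(k := {b})) k"
  proof -
    have "flag_sum n v (J - {k}) (S(k := c)) \<psi> = flag_sum n v (J - {k}) S \<psi>" for v c \<psi>
      by (rule flag_sum_cong_signs) simp
    then show ?thesis
      using Suc.prems by simp
  qed
  ultimately show ?case
    unfolding flag_sum.simps using Suc.prems
    by (simp only: sum.remove[OF Suc.prems(1,3)] sum.distrib cong: sum.cong) (simp add: ac_simps)
qed (use assms in auto)

lemma flag_sum_antipode:
  "flag_sum n (antipode u) J (\<lambda>i. uminus ` S i) \<phi> = flag_sum n u J S (\<lambda>l. \<phi> (map antipode l))"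
proof (induction n arbitrary: u J \<phi>)
  case (Suc n)
  have upd: "(antipode u)(i := - \<epsilon>) = antipode (u(i := \<epsilon>))" for i \<epsilon>
    by (auto simp: antipode_def)
  have "flag_sum n ((antipode u)(i := - \<epsilon>)) (J - {i}) (\<lambda>i. uminus ` S i) (\<lambda>l. \<phi> ((antipode u)(i := - \<epsilon>) # l)) =
      flag_sum n (u(i := \<epsilon>)) (J - {i}) S (\<lambda>l. \<phi> (map antipode (u(i := \<epsilon>) # l)))" for i \<epsilon>
    unfolding upd list.map by (rule Suc.IH)
  moreover have "sum f (uminus ` S i) = (\<Sum>\<epsilon>\<in>S i. f (- \<epsilon>))" for f :: "real \<Rightarrow> bit" and i
    by (simp add: sum.reindex o_def)
  ultimately show ?case
    by (simp only: flag_sum.simps)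
qed simp

lemma flag_sum_update:
  assumes "i \<notin> J"
  shows "flag_sum n (u(i := b)) J S \<phi> =
         flag_sum n (u(i := a)) J S (\<lambda>l. \<phi> (map (\<lambda>v. v(i := b)) l))"
  using assms
proof (induction n arbitrary: u J \<phi>)
  case (Suc n)
  have "flag_sum n (u(i := b, j := \<epsilon>)) (J - {j}) S (\<lambda>l. \<phi> (u(i := b, j := \<epsilon>) # l)) =
      flag_sum n (u(i := a, j := \<epsilon>)) (J - {j}) S (\<lambda>l. \<phi> (map (\<lambda>v. v(i := b)) (u(i := a, j := \<epsilon>) # l)))"
    if "j \<in> J" for j \<epsilon>
  proof -
    have "i \<noteq> j"
      using that Suc.prems by auto
    then have tw: "u(i := c, j := \<epsilon>) = u(j := \<epsilon>, i := c)" for c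
      by (rule fun_upd_twist)
    show ?thesis
      unfolding tw list.map fun_upd_upd by (rule Suc.IH) (use Suc.prems in simp)
  qed
  then show ?case
    unfolding flag_sum.simps by (intro sum.cong refl) auto
qed simp

text \<open>Flags that start in opposite faces are exchanged by changing one coordinate, which
  \<open>\<phi>\<close> does not notice. In the application this is the identification of opposite
  faces in the torus.\<close>

lemma flag_sum_opposite_faces:
  assumes "\<And>i. i \<in> J \<Longrightarrow> S i = {a, b}" "a \<noteq> b"
    and \<phi>: "\<And>i l. i \<in> J \<Longrightarrow> \<phi> (map (\<lambda>v. v(i := a)) l) = \<phi> (map (\<lambda>v. v(i := b)) l)"
  shows "flag_sum (Suc n) u J S \<phi> = 0"
proof -
  have "flag_sum n (u(i := b)) (J - {i}) S (\<lambda>l. \<phi> (u(i := b) # l)) =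
      flag_sum n (u(i := a)) (J - {i}) S (\<lambda>l. \<phi> (u(i := a) # l))" if i: "i \<in> J" for i
  proof -
    have eq: "flag_sum n (u(i := c)) (J - {i}) S (\<lambda>l. \<phi> (u(i := c) # l)) =
        flag_sum n (u(i := a)) (J - {i}) S (\<lambda>l. \<phi> (map (\<lambda>v. v(i := c)) (u(i := a) # l)))" for c
      using flag_sum_update[of i "J - {i}" n u c S "\<lambda>l. \<phi> (u(i := c) # l)" a] by simp
    show ?thesis
      unfolding eq[of b] \<phi>[OF i, symmetric] eq[of a, symmetric] ..
  qed
  then show ?thesis
    using assms(1,2) by simp
qed

text \<open>The value of \<open>(\<delta>L)\<^sup>n\<^sup>-\<^sup>1\<close> on a hemisphere, computed by passing to ever smaller equators.\<close>

lemma flag_sum_alternation: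
  assumes "a \<noteq> 0" "\<And>i. S i = {a, - a}"
    and L: "\<And>v i. i \<le> n \<Longrightarrow> v i \<in> {a, - a} \<Longrightarrow> (\<And>i. i > n \<Longrightarrow> v i = 0) \<Longrightarrow> L (antipode v) = L v + 1"
  shows "flag_sum (Suc n) (\<lambda>i. 0) {..n} (S(n := {a})) (\<lambda>l. alternation (map L l)) = 1"
  using L
proof (induction n)
  case 0
  show ?case by simp
next
  case (Suc n)
  have ab: "a \<noteq> - a"
    using assms(1) by simp
  let ?K = "\<lambda>l. hd l * alternation l"
  let ?z = "\<lambda>i::nat. 0::real"
  have z: "antipode ?z = ?z"
    by (simp add: antipode_def)
  have "flag_sum (Suc (Suc n)) ?z {..Suc n} (S(Suc n := {a})) (\<lambda>l. alternation (map L l)) =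
      flag_sum (Suc (Suc n)) ?z {..Suc n} (S(Suc n := {a})) (\<lambda>l. list_boundary l (\<lambda>l. ?K (map L l)))"
  proof (rule flag_sum_cong)
    fix l :: "(nat \<Rightarrow> real) list"
    assume "length l = Suc (Suc n)"
    then have "length (map L l) \<ge> 2"
      by simp
    from list_boundary_hd_alternation[OF this]
    show "alternation (map L l) = list_boundary l (\<lambda>l. ?K (map L l))"
      unfolding list_boundary_map by (rule sym)
  qed
  \<comment> \<open>The alternation is the boundary of \<open>?K\<close>, so its sum over the
    hemisphere is that of \<open>?K\<close> over the equator.\<close>
  also have "\<dots> = flag_sum (Suc n) ?z ({..Suc n} - {Suc n}) (S(Suc n := {a})) (\<lambda>l. ?K (map L l))"
    by (rule flag_sum_hemisphere_boundary[where k = "Suc n" and a = a]) (use assms(2) ab in auto)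
  also have "\<dots> = flag_sum (Suc n) ?z {..n} S (\<lambda>l. ?K (map L l))"
  proof -
    have "{..Suc n} - {Suc n} = {..n}"
      by auto
    then show ?thesis
      by (simp only:) (rule flag_sum_cong_signs, auto)
  qed
  also have "\<dots> = flag_sum (Suc n) ?z {..n} (S(n := {a})) (\<lambda>l. ?K (map L l)) +
      flag_sum (Suc n) ?z {..n} (S(n := {- a})) (\<lambda>l. ?K (map L l))"
    by (rule flag_sum_split) (use assms(2) ab in auto)
  also have "S(n := {- a}) = (\<lambda>i. uminus ` (S(n := {a})) i)"
    using assms(2) by (intro ext) (simp add: insert_commute)
  also have "flag_sum (Suc n) ?z {..n} (\<lambda>i. uminus ` (S(n := {a})) i) (\<lambda>l. ?K (map L l)) =
      flag_sum (Suc n) ?z {..n} (S(n := {a})) (\<lambda>l. ?K (map L (map antipode l)))"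
    using flag_sum_antipode[of "Suc n" ?z "{..n}" "S(n := {a})" "\<lambda>l. ?K (map L l)"] unfolding z .
  \<comment> \<open>The antipode exchanges the halves of the equator and complements all labels,
    which adds the alternation to \<open>?K\<close>. The halves together leave the alternation on
    one of them, a hemisphere of one dimension less.\<close>
  also have "\<dots> = flag_sum (Suc n) ?z {..n} (S(n := {a})) (\<lambda>l. ?K (map L l) + alternation (map L l))"
  proof (rule flag_sum_cong)
    fix l assume l: "flag (S(n := {a})) ?z {..n} l" "length l = Suc n"
    then have ne: "l \<noteq> []" by auto
    obtain i \<epsilon> where i: "i \<in> {..n}" "\<epsilon> \<in> (S(n := {a})) i" "\<And>v. v \<in> set l \<Longrightarrow> v i = \<epsilon>"
      using flag_common_coordinate[OF l(1) ne] by blast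
    then have \<epsilon>: "\<epsilon> \<in> {a, - a}"
      using assms(2) by (auto split: if_splits)
    have "L (antipode v) = L v + 1" if v: "v \<in> set l" for v
    proof (rule Suc.prems[of i])
      show "v j = 0" if "j > Suc n" for j
        using flag_outside[OF l(1) _ v, of j] that by simp
    qed (use i v \<epsilon> in auto)
    then have lab: "map L (map antipode l) = map (\<lambda>b. b + 1) (map L l)"
      by simp
    have "hd (map (\<lambda>b. b + 1) (map L l)) = hd (map L l) + 1"
      using ne by (cases l) simp_all
    then show "?K (map L (map antipode l)) = ?K (map L l) + alternation (map L l)"
      unfolding lab alternation_complement by (simp add: distrib_right)
  qed
  also have "flag_sum (Suc n) ?z {..n} (S(n := {a})) (\<lambda>l. ?K (map L l)) + \<dots> =
      flag_sum (Suc n) ?z {..n} (S(n := {a})) (\<lambda>l. alternation (map L l))"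
    by (simp only: flag_sum_add bit_add_self)
  also have "\<dots> = 1"
  proof (rule Suc.IH)
    show "L (antipode v) = L v + 1" if "i \<le> n" "v i \<in> {a, - a}" "\<And>i. n < i \<Longrightarrow> v i = 0" for v i
      by (rule Suc.prems[of i]) (use that in simp_all)
  qed
  finally show ?case .
qed


section \<open>Affine simplices in the configuration space of the torus\<close>

definition config_point ::
  "nat \<Rightarrow> (nat \<Rightarrow> real) \<times> (nat \<Rightarrow> real) \<Rightarrow> (nat \<Rightarrow> real) set \<times> (nat \<Rightarrow> real) set" where
  "config_point d z = (lattice_coset d (fst z), lattice_coset d (snd z))"

text \<open>Affine in pairs of points of Euclidean space and only then projected, so that lists
  differing by a lattice translation give the same simplex.\<close>

definition config_simplex ::
  "nat \<Rightarrow> ((nat \<Rightarrow> real) \<times> (nat \<Rightarrow> real)) list \<Rightarrow> (nat \<Rightarrow> real) \<Rightarrow> (nat \<Rightarrow> real) set \<times> (nat \<Rightarrow> real) set" where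
  "config_simplex d ps = (let p = length ps - 1 in
     restrict (\<lambda>x. config_point d (oriented_simplex p (\<lambda>j. fst (ps ! j)) x, oriented_simplex p (\<lambda>j. snd (ps ! j)) x))
       (standard_simplex p))"

text \<open>A coordinate in which the two points have a constant nonintegral difference keeps the whole
  simplex off the diagonal.\<close>

definition config_list :: "nat \<Rightarrow> ((nat \<Rightarrow> real) \<times> (nat \<Rightarrow> real)) list \<Rightarrow> bool" where
  "config_list d ps \<longleftrightarrow> ps \<noteq> [] \<and>
     (\<forall>z\<in>set ps. fst z \<in> topspace (Euclidean_space d) \<and> snd z \<in> topspace (Euclidean_space d)) \<and>
     (\<exists>i \<epsilon>. \<epsilon> \<notin> \<int> \<and> (\<forall>z\<in>set ps. fst z i - snd z i = \<epsilon>))"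

lemma oriented_simplex_vertex: "j \<le> p \<Longrightarrow> oriented_simplex p l (simplex_vertex j) = l j"
proof -
  assume "j \<le> p"
  then have "(\<Sum>i\<le>p. l i t * simplex_vertex j i) = l j t" for t
    by (simp add: simplex_vertex_def if_distrib[of "\<lambda>x. _ * x"] cong: if_cong)
  moreover have "simplex_vertex j \<in> standard_simplex p"
    using \<open>j \<le> p\<close> by simp
  ultimately show ?thesis
    unfolding oriented_simplex_def by simp
qed

text \<open>Barycentric coordinates sum to 1. Used with nonintegral \<open>c\<close> to avoid the
  diagonal and with integral \<open>c\<close> for lattice translations.\<close>

lemma oriented_simplex_diff:
  assumes "x \<in> standard_simplex p" "\<And>j. j \<le> p \<Longrightarrow> l j i - l' j i = c"
  shows "oriented_simplex p l x i - oriented_simplex p l' x i = c"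
proof -
  have "oriented_simplex p l x i - oriented_simplex p l' x i = (\<Sum>j\<le>p. (l j i - l' j i) * x j)"
    using assms(1) by (simp add: oriented_simplex_def sum_subtractf left_diff_distrib)
  also have "\<dots> = (\<Sum>j\<le>p. c * x j)"
    using assms(2) by (intro sum.cong) auto
  also have "\<dots> = c"
    using assms(1) by (simp add: standard_simplex_def flip: sum_distrib_left)
  finally show ?thesis .
qed

lemma continuous_map_oriented_simplex:
  assumes "\<And>j. j \<le> p \<Longrightarrow> l j \<in> topspace (Euclidean_space d)"
  shows "continuous_map (simplex_space p) (Euclidean_space d) (oriented_simplex p l)"
proof -
  have "simplicial_simplex p {x. \<forall>i\<ge>d. x i = 0} (oriented_simplex p l)"
    unfolding simplicial_simplex_oriented_simplex
    using assms by (auto simp: topspace_Euclidean_space intro!: sum.neutral)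
  from simplicial_imp_singular_simplex[OF this] show ?thesis
    by (simp add: singular_simplex_def Euclidean_space_def)
qed

lemma config_simplex_vertex:
  assumes "j < length ps"
  shows "config_simplex d ps (simplex_vertex j) = config_point d (ps ! j)"
proof -
  have "j \<le> length ps - 1"
    using assms by linarith
  then show ?thesis
    by (simp add: config_simplex_def Let_def oriented_simplex_vertex del: One_nat_def)
qed

lemma config_point_in:
  assumes "fst z \<in> topspace (Euclidean_space d)" "snd z \<in> topspace (Euclidean_space d)"
    and "fst z i - snd z i \<notin> \<int>"
  shows "config_point d z \<in> topspace (ordered_config2 (torus d))"
proof -
  have "lattice_coset d (fst z) \<noteq> lattice_coset d (snd z)"
    using lattice_coset_eq_iff[OF assms(1)] assms(3) by blast
  then show ?thesis
    using assms(1,2) by (simp add: config_point_def ordered_config2_def topspace_torus)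
qed

lemma singular_simplex_config_simplex:
  assumes "config_list d ps"
  shows "singular_simplex (length ps - 1) (ordered_config2 (torus d)) (config_simplex d ps)"
proof -
  define p where "p = length ps - 1"
  let ?S = "simplex_space p"
  let ?a = "oriented_simplex p (\<lambda>j. fst (ps ! j))" and ?b = "oriented_simplex p (\<lambda>j. snd (ps ! j))"
  obtain i \<epsilon> where i: "\<epsilon> \<notin> \<int>" "\<And>z. z \<in> set ps \<Longrightarrow> fst z i - snd z i = \<epsilon>"
    using assms by (auto simp: config_list_def)
  have in_ps: "ps ! j \<in> set ps" if "j \<le> p" for j
  proof -
    have "0 < length ps"
      using assms by (simp add: config_list_def)
    with that have "j < length ps"
      unfolding p_def by linarith
    then show ?thesis by simp
  qed
  have a: "continuous_map ?S (Euclidean_space d) ?a" and b: "continuous_map ?S (Euclidean_space d) ?b"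
    by (rule continuous_map_oriented_simplex; use assms in_ps in \<open>simp add: config_list_def\<close>)+
  have "quotient_map (Euclidean_space d) (torus d) (lattice_coset d)"
    unfolding torus_def by (rule quotient_map_quotient_topology)
  then have q: "continuous_map (Euclidean_space d) (torus d) (lattice_coset d)"
    by (rule quotient_imp_continuous_map)
  have "continuous_map ?S (torus d) (\<lambda>x. lattice_coset d (?a x))"
    "continuous_map ?S (torus d) (\<lambda>x. lattice_coset d (?b x))"
    using continuous_map_compose[OF a q] continuous_map_compose[OF b q] by (simp_all add: o_def)
  then have cont: "continuous_map ?S (prod_topology (torus d) (torus d)) (\<lambda>x. config_point d (?a x, ?b x))"
    unfolding config_point_def fst_conv snd_conv by (rule continuous_map_pairedI)
  have "config_point d (?a x, ?b x) \<in> topspace (ordered_config2 (torus d))" if x: "x \<in> standard_simplex p" for x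
  proof (rule config_point_in)
    show "fst (?a x, ?b x) \<in> topspace (Euclidean_space d)" "snd (?a x, ?b x) \<in> topspace (Euclidean_space d)"
      using a b x by (auto simp: continuous_map_def)
    have "?a x i - ?b x i = \<epsilon>"
      by (rule oriented_simplex_diff[OF x]) (use i in_ps in blast)
    with i show "fst (?a x, ?b x) i - snd (?a x, ?b x) i \<notin> \<int>"
      by simp
  qed
  then have "(\<lambda>x. config_point d (?a x, ?b x)) \<in> topspace ?S \<rightarrow> {(x, y). x \<noteq> y}"
    by (auto simp: ordered_config2_def)
  with cont have "continuous_map ?S (ordered_config2 (torus d)) (\<lambda>x. config_point d (?a x, ?b x))"
    unfolding ordered_config2_def continuous_map_in_subtopology by blast
  then show ?thesis
    unfolding config_simplex_def Let_def p_def[symmetric] by (simp add: singular_simplex_def)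
qed

text \<open>Matches singular faces with the lists in \<open>list_boundary_sum\<close>, so that
  coboundaries of cochains become boundaries of lists.\<close>

lemma singular_face_config_simplex:
  assumes "length ps = Suc (Suc m)" "k < length ps"
  shows "singular_face (Suc m) k (config_simplex d ps) = config_simplex d (take k ps @ drop (Suc k) ps)"
proof -
  let ?ds = "take k ps @ drop (Suc k) ps"
  have k: "k \<le> Suc m"
    using assms by simp
  have len: "length ?ds = Suc m"
    using assms by simp
  have nth: "?ds ! j = (if j < k then ps ! j else ps ! Suc j)" if "j \<le> m" for j
    using that assms by (auto simp: nth_append min_def)
  have face: "simplical_face k x \<in> standard_simplex (Suc m)" if "x \<in> standard_simplex m" for x
    using simplical_face_in_standard_simplex[of "Suc m" k x] that k by simp
  have or: "oriented_simplex (Suc m) (\<lambda>j. f (ps ! j)) (simplical_face k x) = oriented_simplex m (\<lambda>j. f (?ds ! j)) x"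
    if x: "x \<in> standard_simplex m" for x and f :: "(nat \<Rightarrow> real) \<times> (nat \<Rightarrow> real) \<Rightarrow> nat \<Rightarrow> real"
  proof -
    have "oriented_simplex (Suc m) (\<lambda>j. f (ps ! j)) (simplical_face k x) =
        singular_face (Suc m) k (oriented_simplex (Suc m) (\<lambda>j. f (ps ! j))) x"
      using x by (simp add: singular_face_def)
    also have "\<dots> = oriented_simplex m (\<lambda>j. if j < k then f (ps ! j) else f (ps ! Suc j)) x"
      using singular_face_oriented_simplex[of "Suc m" k "\<lambda>j. f (ps ! j)"] k by simp
    also have "oriented_simplex m (\<lambda>j. if j < k then f (ps ! j) else f (ps ! Suc j)) =
        oriented_simplex m (\<lambda>j. f (?ds ! j))"
      unfolding oriented_simplex_eq using nth by simp
    finally show ?thesis .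
  qed
  show ?thesis
    unfolding config_simplex_def Let_def len unfolding assms(1) singular_face_def diff_Suc_1 One_nat_def diff_Suc_Suc diff_zero
    by (rule restrict_ext) (simp add: face or)
qed

lemma config_simplex_swap:
  assumes "ps \<noteq> []"
  shows "config_simplex d (map prod.swap ps) = simplex_map (length ps - 1) prod.swap (config_simplex d ps)"
proof -
  have "oriented_simplex (length ps - 1) (\<lambda>j. f (map prod.swap ps ! j)) =
      oriented_simplex (length ps - 1) (\<lambda>j. f (prod.swap (ps ! j)))"
    for f :: "(nat \<Rightarrow> real) \<times> (nat \<Rightarrow> real) \<Rightarrow> nat \<Rightarrow> real"
    unfolding oriented_simplex_eq
  proof (intro allI impI)
    fix j assume "j \<le> length ps - 1"
    moreover have "0 < length ps"
      using assms by simp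
    ultimately have "j < length ps"
      by linarith
    then show "f (map prod.swap ps ! j) = f (prod.swap (ps ! j))"
      by simp
  qed
  from this[of fst] this[of snd]
  have coords: "oriented_simplex (length ps - 1) (\<lambda>j. fst (map prod.swap ps ! j)) =
      oriented_simplex (length ps - 1) (\<lambda>j. snd (ps ! j))"
    "oriented_simplex (length ps - 1) (\<lambda>j. snd (map prod.swap ps ! j)) =
      oriented_simplex (length ps - 1) (\<lambda>j. fst (ps ! j))"
    by simp_all
  show ?thesis
    unfolding config_simplex_def Let_def length_map coords simplex_map_def
    by (intro ext) (simp add: restrict_def config_point_def)
qed

lemma config_simplex_shift:
  assumes "length ps = length qs" "ps \<noteq> []"
    and "\<And>j. j < length ps \<Longrightarrow> snd (ps ! j) = snd (qs ! j)"
    and "\<And>j i. j < length ps \<Longrightarrow> fst (ps ! j) i - fst (qs ! j) i = w i" "\<And>i. w i \<in> \<int>"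
  shows "config_simplex d ps = config_simplex d qs"
proof -
  define p where "p = length ps - 1"
  have j: "j < length ps" if "j \<le> p" for j
    using that assms(2) by (cases ps) (auto simp: p_def)
  have snd_eq: "oriented_simplex p (\<lambda>j. snd (ps ! j)) = oriented_simplex p (\<lambda>j. snd (qs ! j))"
    unfolding oriented_simplex_eq using assms(3) j by simp
  have "lattice_coset d (oriented_simplex p (\<lambda>j. fst (ps ! j)) x) =
      lattice_coset d (oriented_simplex p (\<lambda>j. fst (qs ! j)) x)" if x: "x \<in> standard_simplex p" for x
  proof (rule lattice_coset_shift)
    fix i
    have "oriented_simplex p (\<lambda>j. fst (ps ! j)) x i - oriented_simplex p (\<lambda>j. fst (qs ! j)) x i = w i"
      by (rule oriented_simplex_diff[OF x]) (use assms(4) j in blast)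
    with assms(5) show "oriented_simplex p (\<lambda>j. fst (ps ! j)) x i - oriented_simplex p (\<lambda>j. fst (qs ! j)) x i \<in> \<int>"
      by simp
  qed
  then show ?thesis
    unfolding config_simplex_def Let_def assms(1)[symmetric] p_def[symmetric] snd_eq
    by (intro restrict_ext) (simp add: config_point_def)
qed


section \<open>The lower bound\<close>

lemma half_not_integer: "(1/2::real) \<notin> \<int>" "(-1/2::real) \<notin> \<int>"
proof -
  have "2 * of_int n \<noteq> (1::real)" "2 * of_int n \<noteq> (-1::real)" for n :: int
    by (metis dvd_triv_left of_int_1 of_int_eq_iff of_int_mult of_int_numeral odd_one)
      (metis dvd_triv_left of_int_1 of_int_eq_iff of_int_minus of_int_mult of_int_numeral odd_one dvd_minus_iff)
  then show "(1/2::real) \<notin> \<int>" "(-1/2::real) \<notin> \<int>"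
    by (auto elim!: Ints_cases simp: field_simps)
qed

definition centred_pair :: "(nat \<Rightarrow> real) \<Rightarrow> (nat \<Rightarrow> real) \<times> (nat \<Rightarrow> real)" where
  "centred_pair v = (\<lambda>i. v i / 2, \<lambda>i. - v i / 2)"

definition based_pair :: "(nat \<Rightarrow> real) \<Rightarrow> (nat \<Rightarrow> real) \<times> (nat \<Rightarrow> real)" where
  "based_pair v = (v, \<lambda>i. 0)"

lemma centred_pair_antipode: "centred_pair (antipode v) = prod.swap (centred_pair v)"
  by (auto simp: centred_pair_def antipode_def)

text \<open>Both kinds of pairs over \<open>v\<close> have difference \<open>v\<close>, so lists
  that mix them, as in the prism, keep the difference \<open>\<epsilon>\<close> in coordinate
  \<open>i\<close>.\<close>

lemma config_list_pairs:
  assumes "l \<noteq> []" "set l \<subseteq> (centred_pair ` V) \<union> (based_pair ` V)"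
    "\<And>v. v \<in> V \<Longrightarrow> v \<in> topspace (Euclidean_space d)"
    "\<And>v. v \<in> V \<Longrightarrow> v i = \<epsilon>" "\<epsilon> \<in> {1/2, -1/2}"
  shows "config_list d l"
proof -
  have "fst z \<in> topspace (Euclidean_space d) \<and> snd z \<in> topspace (Euclidean_space d) \<and> fst z i - snd z i = \<epsilon>"
    if "z \<in> set l" for z
  proof -
    have "z \<in> (centred_pair ` V) \<union> (based_pair ` V)"
      using that assms(2) by blast
    then obtain v where "v \<in> V" "z = centred_pair v \<or> z = based_pair v"
      by blast
    with assms(3,4)[of v] show ?thesis
      by (auto simp: centred_pair_def based_pair_def topspace_Euclidean_space)
  qed
  moreover have "\<epsilon> \<notin> \<int>"
    using assms(5) half_not_integer by (metis insertE singletonD)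
  ultimately show ?thesis
    using assms(1) unfolding config_list_def by blast
qed

theorem sw_product_not_coboundary:
  assumes h: "odd_labelling (ordered_config2 (torus (Suc m))) prod.swap h"
  shows "sw_product (ordered_config2 (torus (Suc m))) prod.swap (\<lambda>_. h) (Suc m) \<notin>
           coboundaries (Suc m) (unordered_config2 (torus (Suc m)))"
proof
  let ?d = "Suc m"
  let ?E = "ordered_config2 (torus ?d)" and ?B = "unordered_config2 (torus ?d)"
  let ?p = "orbit2 prod.swap :: _ \<Rightarrow> ((nat \<Rightarrow> real) set \<times> (nat \<Rightarrow> real) set) set"
  let ?W = "sw_product ?E prod.swap (\<lambda>_. h)"
  assume "?W ?d \<in> coboundaries ?d ?B"
  then obtain \<psi> where \<psi>: "?W ?d = coboundary m ?B \<psi>"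
    by (auto simp: coboundaries_def)
  interpret double_cover ?E prod.swap
    by (rule double_cover_ordered_config2[OF Hausdorff_space_torus])
  have B: "?B = base"
    by (simp add: unordered_config2_def)
  let ?\<sigma> = "config_simplex ?d"
  define label where "label z = h (config_point ?d z)" for z
  \<comment> \<open>The first summand comes from the base, so only the second one sees the
    swap.\<close>
  define \<Theta> where "\<Theta> \<sigma> = \<psi> (simplex_map m ?p \<sigma>) +
      h (\<sigma> (simplex_vertex 0)) * (\<Prod>j<m. h (\<sigma> (simplex_vertex j)) + h (\<sigma> (simplex_vertex (Suc j))))" for \<sigma>
  define \<Phi> where "\<Phi> ps = \<Theta> (?\<sigma> ps)" for ps
  let ?K = "\<lambda>l. hd l * alternation l"
  have prod_label: "(\<Prod>j<n. h (?\<sigma> ps (simplex_vertex j)) + h (?\<sigma> ps (simplex_vertex (Suc j)))) = alternation (map label ps)"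
    if "length ps = Suc n" for ps n
    unfolding alternation_prod using that
    by (intro prod.cong) (auto simp: config_simplex_vertex label_def)
  have \<Phi>: "\<Phi> ps = \<psi> (simplex_map m ?p (?\<sigma> ps)) + ?K (map label ps)" if "length ps = Suc m" for ps
  proof -
    have "h (?\<sigma> ps (simplex_vertex 0)) = hd (map label ps)"
      using that by (cases ps) (auto simp: config_simplex_vertex label_def)
    then show ?thesis
      using prod_label[OF that] by (simp add: \<Phi>_def \<Theta>_def)
  qed
  \<comment> \<open>Both summands of \<open>\<Phi>\<close> have the alternation as coboundary, the
    first by the choice of \<open>\<psi>\<close>, the second by
    \<open>list_boundary_hd_alternation\<close>.\<close>
  have cocycle: "list_boundary ps \<Phi> = 0" if ps: "config_list ?d ps" "length ps = Suc (Suc m)" for ps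
  proof -
    let ?D = "\<lambda>k. take k ps @ drop (Suc k) ps"
    have sing: "singular_simplex (Suc m) ?E (?\<sigma> ps)"
      using singular_simplex_config_simplex[OF ps(1)] ps(2) by simp
    have face: "singular_face (Suc m) k (simplex_map (Suc m) ?p (?\<sigma> ps)) = simplex_map m ?p (?\<sigma> (?D k))" if k: "k < Suc (Suc m)" for k
    proof -
      have "simplical_face k x \<in> standard_simplex (Suc m)" if "x \<in> standard_simplex m" for x
        using simplical_face_in_standard_simplex[of "Suc m" k x] that k by simp
      then have "singular_face (Suc m) k (simplex_map (Suc m) ?p (?\<sigma> ps)) =
          simplex_map m ?p (singular_face (Suc m) k (?\<sigma> ps))"
        by (intro ext) (simp add: simplex_map_def singular_face_def restrict_def)
      then show ?thesis
        using singular_face_config_simplex[OF ps(2)] k ps(2) by simp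
    qed
    have "list_boundary ps \<Phi> = (\<Sum>k<Suc (Suc m). \<Phi> (?D k))"
      unfolding list_boundary_sum ps(2) ..
    also have "\<dots> = (\<Sum>k<Suc (Suc m). \<psi> (simplex_map m ?p (?\<sigma> (?D k))) + ?K (map label (?D k)))"
      by (intro sum.cong refl \<Phi>) (use ps(2) in auto)
    also have "\<dots> = (\<Sum>k<Suc (Suc m). \<psi> (singular_face (Suc m) k (simplex_map (Suc m) ?p (?\<sigma> ps)))) +
        list_boundary ps (\<lambda>l. ?K (map label l))"
      unfolding list_boundary_sum ps(2) sum.distrib
      by (intro arg_cong2[of _ _ _ _ "(+)"] sum.cong refl) (simp add: face)
    also have "(\<Sum>k<Suc (Suc m). \<psi> (singular_face (Suc m) k (simplex_map (Suc m) ?p (?\<sigma> ps)))) =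
        coboundary m base \<psi> (simplex_map (Suc m) ?p (?\<sigma> ps))"
      by (simp only: coboundary_simplex[OF singular_simplex_proj[OF sing]] lessThan_Suc_atMost)
    also have "\<dots> = alternation (map label ps)"
      using sw_product_lift[of "\<lambda>_. h", OF h sing] prod_label[OF ps(2)] \<psi> B by simp
    also have "list_boundary ps (\<lambda>l. ?K (map label l)) = alternation (map label ps)"
    proof -
      have "length (map label ps) \<ge> 2"
        using ps(2) by simp
      from list_boundary_hd_alternation[OF this] show ?thesis
        unfolding list_boundary_map .
    qed
    finally show ?thesis by simp
  qed
  have label_swap: "label (prod.swap z) = label z + 1" if "config_point ?d z \<in> topspace ?E" for z
  proof -
    have "config_point ?d (prod.swap z) = prod.swap (config_point ?d z)"
      by (simp add: config_point_def)
    then show ?thesis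
      using h that by (simp add: label_def odd_labelling_def)
  qed
  \<comment> \<open>The swap complements all labels, which preserves the alternation and adds 1 to
    its factor \<open>hd\<close>.\<close>
  have \<Phi>_swap: "\<Phi> (map prod.swap ps) = \<Phi> ps + alternation (map label ps)"
    if ps: "config_list ?d ps" "length ps = Suc m" for ps
  proof -
    have ne: "ps \<noteq> []"
      using ps(2) by auto
    have sing: "singular_simplex m ?E (?\<sigma> ps)"
      using singular_simplex_config_simplex[OF ps(1)] ps(2) by simp
    have "?p (prod.swap (?\<sigma> ps x)) = ?p (?\<sigma> ps x)" if "x \<in> standard_simplex m" for x
      using singular_simplex_in[OF sing that] by (rule proj_involution)
    then have "simplex_map m ?p (?\<sigma> (map prod.swap ps)) = simplex_map m ?p (?\<sigma> ps)"
      unfolding config_simplex_swap[OF ne] using ps(2)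
      by (intro ext) (simp add: simplex_map_def restrict_def)
    moreover have "label (prod.swap z) = label z + 1" if "z \<in> set ps" for z
      using that ps(1) config_point_in[of z ?d] unfolding config_list_def by (intro label_swap) metis
    then have lab: "map label (map prod.swap ps) = map (\<lambda>b. b + 1) (map label ps)"
      by simp
    have "hd (map (\<lambda>b. b + 1) (map label ps)) = hd (map label ps) + 1"
      using ne by (cases ps) simp_all
    then have "?K (map label (map prod.swap ps)) = ?K (map label ps) + alternation (map label ps)"
      unfolding lab alternation_complement by (simp add: distrib_right)
    ultimately show ?thesis
      using \<Phi>[of ps] \<Phi>[of "map prod.swap ps"] ps(2) by (simp add: ac_simps)
  qed
  let ?S = "\<lambda>i::nat. {1/2, -1/2} :: real set"
  let ?z = "\<lambda>i::nat. 0 :: real"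
  have flag_pairs: "config_list ?d ps"
    if l: "flag S ?z {..m} l" "length l = Suc m" and S: "\<And>i. S i \<subseteq> {1/2, -1/2}"
      and ps: "ps \<noteq> []" "set ps \<subseteq> centred_pair ` set l \<union> based_pair ` set l" for S l ps
  proof -
    have "l \<noteq> []"
      using l(2) by auto
    then obtain i \<epsilon> where i: "\<epsilon> \<in> S i" "\<And>v. v \<in> set l \<Longrightarrow> v i = \<epsilon>"
      using flag_common_coordinate[OF l(1)] by metis
    show ?thesis
    proof (rule config_list_pairs[OF ps, where i = i and \<epsilon> = \<epsilon>])
      show "v \<in> topspace (Euclidean_space ?d)" if "v \<in> set l" for v
        using flag_outside[OF l(1) _ that] by (simp add: topspace_Euclidean_space)
    qed (use i S in blast)+
  qed
  \<comment> \<open>The prism consists of \<open>Suc m\<close>-simplices in the configuration space,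
    where the cocycle condition applies.\<close>
  have "flag_sum ?d ?z {..m} ?S (\<lambda>l. prism centred_pair based_pair l (\<lambda>l. list_boundary l \<Phi>)) =
      flag_sum ?d ?z {..m} ?S (\<lambda>l. 0)"
  proof (rule flag_sum_cong, rule prism_eq_0, rule cocycle)
    fix l i assume l: "flag ?S ?z {..m} l" "length l = Suc m" and i: "i < length l"
    let ?ps = "map centred_pair (take (Suc i) l) @ map based_pair (drop i l)"
    show "config_list ?d ?ps"
    proof (rule flag_pairs[OF l])
      show "?ps \<noteq> []"
        using l(2) by auto
      show "set ?ps \<subseteq> centred_pair ` set l \<union> based_pair ` set l"
        using set_take_subset[of "Suc i" l] set_drop_subset[of i l] by auto
    qed simp
    show "length ?ps = Suc (Suc m)"
      using l(2) i by simp
  qed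
  \<comment> \<open>The boundary of the cube is itself a cycle, so the side walls of the prism
    cancel.\<close>
  moreover have "flag_sum ?d ?z {..m} ?S (\<lambda>l. list_boundary l (\<lambda>l. prism centred_pair based_pair l \<Phi>)) = 0"
    by (rule flag_sum_boundary) auto
  ultimately have "flag_sum ?d ?z {..m} ?S (\<lambda>l. prism centred_pair based_pair l (\<lambda>l. list_boundary l \<Phi>) +
      list_boundary l (\<lambda>l. prism centred_pair based_pair l \<Phi>)) = 0"
    by (simp only: flag_sum_add flag_sum_zero add_0)
  then have homotopy: "flag_sum ?d ?z {..m} ?S (\<lambda>l. \<Phi> (map centred_pair l)) +
      flag_sum ?d ?z {..m} ?S (\<lambda>l. \<Phi> (map based_pair l)) = 0"
    unfolding prism_boundary flag_sum_add .
  \<comment> \<open>Opposite faces differ by a unit vector in the first point, and the second point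
    is 0 on both: they carry the same singular simplices.\<close>
  have based: "flag_sum ?d ?z {..m} ?S (\<lambda>l. \<Phi> (map based_pair l)) = 0"
  proof (rule flag_sum_opposite_faces)
    fix i :: nat and l :: "(nat \<Rightarrow> real) list"
    show "\<Phi> (map based_pair (map (\<lambda>v. v(i := 1/2)) l)) = \<Phi> (map based_pair (map (\<lambda>v. v(i := -1/2)) l))"
    proof (cases "l = []")
      case False
      have "?\<sigma> (map based_pair (map (\<lambda>v. v(i := 1/2)) l)) = ?\<sigma> (map based_pair (map (\<lambda>v. v(i := -1/2)) l))"
        by (rule config_simplex_shift[where w = "\<lambda>j. if j = i then 1 else 0"])
          (use False in \<open>auto simp: based_pair_def\<close>)
      then show ?thesis
        by (simp add: \<Phi>_def)
    qed simp
  qed auto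
  \<comment> \<open>The hemisphere with last coordinate 1/2. The antipode, which is the swap on
    centred pairs, exchanges it with the other one, so that the sphere yields the alternation on
    \<open>?H\<close>.\<close>
  let ?H = "?S(m := {1/2})"
  have "flag_sum ?d ?z {..m} ?S (\<lambda>l. \<Phi> (map centred_pair l)) =
      flag_sum ?d ?z {..m} ?H (\<lambda>l. \<Phi> (map centred_pair l)) +
      flag_sum ?d ?z {..m} (?S(m := {-1/2})) (\<lambda>l. \<Phi> (map centred_pair l))"
    by (rule flag_sum_split) auto
  also have "?S(m := {-1/2}) = (\<lambda>i. uminus ` ?H i)"
    by (intro ext) (simp add: insert_commute)
  also have "flag_sum ?d ?z {..m} (\<lambda>i. uminus ` ?H i) (\<lambda>l. \<Phi> (map centred_pair l)) =
      flag_sum ?d ?z {..m} ?H (\<lambda>l. \<Phi> (map centred_pair (map antipode l)))"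
  proof -
    have z: "antipode ?z = ?z"
      by (simp add: antipode_def)
    show ?thesis
      using flag_sum_antipode[of ?d ?z "{..m}" ?H "\<lambda>l. \<Phi> (map centred_pair l)"] unfolding z .
  qed
  also have "\<dots> = flag_sum ?d ?z {..m} ?H (\<lambda>l. \<Phi> (map centred_pair l) + alternation (map (\<lambda>v. label (centred_pair v)) l))"
  proof (rule flag_sum_cong)
    fix l assume l: "flag ?H ?z {..m} l" "length l = Suc m"
    have "config_list ?d (map centred_pair l)"
      by (rule flag_pairs[OF l]) (use l(2) in auto)
    from \<Phi>_swap[OF this] l(2)
    show "\<Phi> (map centred_pair (map antipode l)) =
        \<Phi> (map centred_pair l) + alternation (map (\<lambda>v. label (centred_pair v)) l)"
      by (simp add: centred_pair_antipode o_def)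
  qed
  also have "flag_sum ?d ?z {..m} ?H (\<lambda>l. \<Phi> (map centred_pair l)) + \<dots> =
      flag_sum ?d ?z {..m} ?H (\<lambda>l. alternation (map (\<lambda>v. label (centred_pair v)) l))"
    by (simp only: flag_sum_add bit_add_self)
  also have "\<dots> = 1"
  proof (rule flag_sum_alternation)
    fix v :: "nat \<Rightarrow> real" and i
    assume v: "i \<le> m" "v i \<in> {1/2, - (1/2)}" "\<And>i. i > m \<Longrightarrow> v i = 0"
    have "config_point ?d (centred_pair v) \<in> topspace ?E"
    proof (rule config_point_in)
      show "fst (centred_pair v) i - snd (centred_pair v) i \<notin> \<int>"
      proof -
        have "v i = 1/2 \<or> v i = -1/2"
          using v(2) by auto
        then have "v i \<notin> \<int>"
          using half_not_integer by metis
        then show ?thesis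
          by (simp add: centred_pair_def)
      qed
    qed (use v(3) in \<open>auto simp: centred_pair_def topspace_Euclidean_space\<close>)
    then show "label (centred_pair (antipode v)) = label (centred_pair v) + 1"
      unfolding centred_pair_antipode by (rule label_swap)
  qed auto
  finally have "flag_sum ?d ?z {..m} ?S (\<lambda>l. \<Phi> (map centred_pair l)) = 1" .
  with homotopy based show False
    by simp
qed

theorem theorem1p3:
  fixes d :: nat
  assumes "d \<ge> 2"
  shows "has_SW_height (ordered_config2 (torus d)) prod.swap
           (unordered_config2 (torus d)) (orbit2 prod.swap) d"
proof -
  let ?E = "ordered_config2 (torus d)"
  interpret double_cover ?E prod.swap
    by (rule double_cover_ordered_config2[OF Hausdorff_space_torus])
  have B: "unordered_config2 (torus d) = base"
    by (simp add: unordered_config2_def)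
  obtain h where h: "odd_labelling ?E prod.swap h"
    by (rule odd_labelling_exists)
  \<comment> \<open>The coordinates are numbered from 0 to \<open>d\<close>, so the target has
    dimension \<open>d + 1\<close> and the powers beyond \<open>d\<close> will vanish.\<close>
  have ex: "\<exists>f. classifying_map ?E prod.swap base proj f"
    by (rule classifying_map_exists[of "torus_difference d" d])
      (simp_all only: continuous_map_torus_difference torus_difference_swap torus_difference_nonzero)
  define \<alpha> where "\<alpha> = cohomology_class 1 base (sw_cochain ?E prod.swap h)"
  \<comment> \<open>The height quantifies over all classes of the bundle; here there is exactly
    one.\<close>
  have \<alpha>: "first_SW_class ?E prod.swap base proj \<beta> \<longleftrightarrow> \<beta> = \<alpha>" for \<beta>
    using first_SW_class_iff[OF h] ex by (simp add: \<alpha>_def)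
  obtain m where m: "d = Suc m"
    using assms by (cases d) auto
  have "cup_power base \<alpha> d \<noteq> \<one>\<^bsub>cohomology_group d base\<^esub>"
    using sw_product_not_coboundary[of m h] h cup_power_sw_class[of "\<lambda>_. h", OF h h] B
    by (simp only: m \<alpha>_def cohomology_class_eq_one_iff not_False_eq_True)
  moreover have "cup_power base \<alpha> i = \<one>\<^bsub>cohomology_group i base\<^esub>" if i: "d < i" for i
  proof -
    obtain hs where hs: "\<And>i. odd_labelling ?E prod.swap (hs i)"
      "sw_product ?E prod.swap hs i \<in> coboundaries i base"
      by (rule sw_product_coboundary[of "torus_difference d" d i])
        (use i continuous_map_torus_difference torus_difference_swap torus_difference_nonzero in blast)+
    have "cup_power base \<alpha> i = cohomology_class i base (sw_product ?E prod.swap hs i)"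
      unfolding \<alpha>_def by (rule cup_power_sw_class[OF hs(1) h])
    with hs(2) show ?thesis
      by (simp add: cohomology_class_eq_one_iff)
  qed
  ultimately show ?thesis
    unfolding has_SW_height_def B \<alpha> by (metis not_le)
qed

end
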